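(* Let $n\ge 1$ be an integer and let $(\mathscr{C},\mathbb{E},\mathfrak{s})$ be an $n$-exangulated category. Then $\mathscr{C}$ has an $\mathbb{E}$-compatible $(n+2)$-angulated structure $(\mathscr{C},\Sigma,\Theta)$ if and only if for every object $X\in\mathscr{C}$, the morphism $X\to 0$ is a trivial inflation and the morphism $0\to X$ is a trivial deflation.
   Context: **Extensions.** Let $\mathscr{C}$ be an additive category, $n\ge1$, and $\mathbb{E}\colon\mathscr{C}^{\mathrm{op}}\times\mathscr{C}\to\mathsf{Ab}$ an additive bifunctor. An $\mathbb{E}$-extension is an element $\delta\in\mathbb{E}(C,A)$. For $a\in\mathscr{C}(A,A')$ and $c\in\mathscr{C}(C',C)$ write $a_*\delta=\mathbb{E}(C,a)(\delta)$ and $c^*\delta=\mathbb{E}(c,A)(\delta)$. A morphism of extensions $(a,c)\colon\delta\to\delta'$, with $\delta\in\mathbb{E}(C,A)$, $\delta'\in\mathbb{E}(C',A')$, is a pair $a\in\mathscr{C}(A,A')$, $c\in\mathscr{C}(C,C')$ with $a_*\delta=c^*\delta'$. An extension $\delta\in\mathbb{E}(C,A)$ induces natural transformations $\delta_\sharp\colon\mathscr{C}(-,C)\Rightarrow\mathbb{E}(-,A)$, $f\mapsto f^*\delta$, and $\delta^\sharp\colon\mathscr{C}(A,-)\Rightarrow\mathbb{E}(C,-)$, $g\mapsto g_*\delta$. **Complexes.** $\mathbf{C}^{n+2}_{\mathscr{C}}$ is the category of complexes $X^{\cdot}\colon X_0\xrightarrow{d^X_0}X_1\to\cdots\to X_n\xrightarrow{d^X_n}X_{n+1}$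 in $\mathscr{C}$ concentrated in degrees $0,\dots,n+1$. For fixed $A,C$, consider complexes with $X_0=A$, $X_{n+1}=C$ and chain maps that are $\mathrm{id}_A$ in degree $0$ and $\mathrm{id}_C$ in degree $n+1$; two such maps $f,g\colon X^\cdot\to Y^\cdot$ are homotopic if there are $\varphi_i\colon X_i\to Y_{i-1}$ ($1\le i\le n+1$) with $\varphi_1d^X_0=0$, $g_i-f_i=d^Y_{i-1}\varphi_i+\varphi_{i+1}d^X_i$ ($1\le i\le n$), $d^Y_n\varphi_{n+1}=0$. $[X^\cdot]$ denotes the resulting homotopy equivalence class. **$n$-exangles.** A pair $\langle X^\cdot,\delta\rangle$ with $\delta\in\mathbb{E}(X_{n+1},X_0)$, $(d_0^X)_*\delta=0$ and $(d_n^X)^*\delta=0$ is an $n$-exangle if the sequences of functors $\mathscr{C}(-,X_0)\to\cdots\to\mathscr{C}(-,X_{n+1})\xrightarrow{\delta_\sharp}\mathbb{E}(-,X_0)$ and $\mathscr{C}(X_{n+1},-)\to\cdots\to\mathscr{C}(X_0,-)\xrightarrow{\delta^\sharp}\mathbb{E}(X_{n+1},-)$ are exact. It is written $X_0\to X_1\to\cdots\to X_{n+1}\overset{\delta}{\dashrightarrow}$. A morphism $\langle X^\cdot,\delta\rangle\to\langle Y^\cdot,\rho\rangle$ is a chain map $f^\cdot$ with $(f_0)_*\delta=(f_{n+1})^*\rho$. **Exact realizations.** A realization $\mathfrak{s}$ of $\mathbb{E}$ assigns to each $\delta\in\mathbb{E}(C,A)$ a class $\mathfrak{s}(\delta)=[X^\cdot]$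 with $X_0=A$, $X_{n+1}=C$, such that (R0) for $\mathfrak{s}(\delta)=[X^\cdot]$, $\mathfrak{s}(\rho)=[Y^\cdot]$, every morphism of extensions $(a,c)\colon\delta\to\rho$ has a lift, i.e. a chain map $f^\cdot=(a,f_1,\dots,f_n,c)\colon X^\cdot\to Y^\cdot$. It is exact if moreover (R1) $\langle X^\cdot,\delta\rangle$ is an $n$-exangle whenever $\mathfrak{s}(\delta)=[X^\cdot]$; (R2) for every $A$, $0\in\mathbb{E}(0,A)$ is realized by $[A\xrightarrow{\mathrm{id}}A\to0\to\cdots\to0]$ and $0\in\mathbb{E}(A,0)$ by $[0\to\cdots\to0\to A\xrightarrow{\mathrm{id}}A]$. If $\mathfrak{s}(\delta)=[X^\cdot]$, then $\langle X^\cdot,\delta\rangle$ is a distinguished $n$-exangle, $X^\cdot$ is a conflation, $d^X_0$ is an inflation and $d^X_n$ is a deflation. **$n$-exangulated category.** A triple $(\mathscr{C},\mathbb{E},\mathfrak{s})$ with $\mathfrak{s}$ an exact realization of the additive bifunctor $\mathbb{E}$, satisfying: (EA1) compositions of inflations are inflations; compositions of deflations are deflations. (EA2) For $\rho\in\mathbb{E}(D,A)$, $c\in\mathscr{C}(C,D)$ and distinguished $\langle X^\cdot,c^*\rho\rangle$, $\langle Y^\cdot,\rho\rangle$, the pair $(\mathrm{id}_A,c)$ has a lift $f^\cdot\colon X^\cdot\to Y^\cdot$ such that $\langle M_f^\cdot,(d^X_0)_*\rho\rangle$ is distinguished, where $M_f^\cdot$ is the mapping cone $X_1\to X_2\oplus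 Y_1\to\cdots\to X_{n+1}\oplus Y_n\to Y_{n+1}$ with differentials $\begin{bmatrix}-d^X_1\\ f_1\end{bmatrix}$, $\begin{bmatrix}-d^X_{i+1}&0\\ f_{i+1}&d^Y_i\end{bmatrix}$ ($1\le i\le n-1$), $\begin{bmatrix}f_{n+1}&d^Y_n\end{bmatrix}$. (EA2$^{\mathrm{op}}$) The dual of (EA2): for $\rho\in\mathbb{E}(C,A)$, $a\in\mathscr{C}(A,B)$ and distinguished $\langle X^\cdot,\rho\rangle$, $\langle Y^\cdot,a_*\rho\rangle$, the pair $(a,\mathrm{id}_C)$ has a lift $h^\cdot\colon X^\cdot\to Y^\cdot$ such that $\langle N_h^\cdot,(d^Y_n)^*\rho\rangle$ is distinguished, where $N_h^\cdot$ is the mapping cocone $X_0\to Y_0\oplus X_1\to\cdots\to Y_{n-1}\oplus X_n\to Y_n$ with differentials $\begin{bmatrix}h_0\\ d^X_0\end{bmatrix}$, $\begin{bmatrix}-d^Y_{i-1}&h_i\\ 0&d^X_i\end{bmatrix}$ ($1\le i\le n-1$), $\begin{bmatrix}-d^Y_{n-1}&h_n\end{bmatrix}$. **Trivial inflations/deflations.** $X\to0$ is a trivial inflation if there is a distinguished $n$-exangle $X\to0\to\cdots\to0\to Y\dashrightarrow$ (all $n$ middle terms zero) for some $Y$. $0\to X$ is a trivial deflation if there is a distinguished $n$-exangle $Z\to0\to\cdots\to0\to X\dashrightarrow$ for some $Z$. **$(n+2)$-angulated category.** Let $\Sigma$ be an auto-equivalence of $\mathscr{C}$. An $(n+2)$-$\Sigma$-sequence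 is a sequence $A_0\xrightarrow{f_0}A_1\to\cdots\xrightarrow{f_n}A_{n+1}\xrightarrow{f_{n+1}}\Sigma A_0$. Its left rotation is $A_1\xrightarrow{f_1}\cdots\to A_{n+1}\xrightarrow{f_{n+1}}\Sigma A_0\xrightarrow{(-1)^n\Sigma f_0}\Sigma A_1$. A morphism of such sequences is a tuple $(\varphi_0,\dots,\varphi_{n+1})$ commuting with all maps, with $\Sigma\varphi_0$ on the last term; it is an isomorphism if all $\varphi_i$ are. An $(n+2)$-angulated category is a triple $(\mathscr{C},\Sigma,\Theta)$ with $\Theta$ a class of $(n+2)$-$\Sigma$-sequences (called $(n+2)$-angles) such that: (N1) (a) $\Theta$ is closed under isomorphisms, direct sums and direct summands; (b) for each $A$ the sequence $A\xrightarrow{1_A}A\to0\to\cdots\to0\to\Sigma A$ is in $\Theta$; (c) each morphism $f_0\colon A_0\to A_1$ is the first morphism of some sequence in $\Theta$. (N2) A sequence is in $\Theta$ iff its left rotation is. (N3) Given two rows $(A_i,f_i)$, $(B_i,g_i)$ in $\Theta$ and $\varphi_0,\varphi_1$ with $\varphi_1f_0=g_0\varphi_0$, there are $\varphi_2,\dots,\varphi_{n+1}$ making $(\varphi_0,\dots,\varphi_{n+1})$ a morphism of sequences. (N4) In (N3), $\varphi_2,\dots,\varphi_{n+1}$ can be chosen so that the mapping cone $A_1\oplus B_0\to A_2\oplus B_1\to\cdots\to\Sigma A_0\oplus B_{n+1}\to\Sigma A_1\oplus\Sigma B_0$, with maps $\begin{pmatrix}-f_{i}&0\\ \varphi_{i}&g_{i-1}\end{pmatrix}$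 ($1\le i\le n+1$) and last map $\begin{pmatrix}-\Sigma f_0&0\\ \Sigma\varphi_0&g_{n+1}\end{pmatrix}$, is in $\Theta$. **$\mathbb{E}$-compatibility.** For an $n$-exangulated category $(\mathscr{C},\mathbb{E},\mathfrak{s})$, an $(n+2)$-angulated structure $(\mathscr{C},\Sigma,\Theta)$ on $\mathscr{C}$ is $\mathbb{E}$-compatible if for every $(n+2)$-angle $X_0\xrightarrow{d_0}X_1\to\cdots\xrightarrow{d_n}X_{n+1}\xrightarrow{d_{n+1}}\Sigma X_0$ in $\Theta$ there is some $\delta\in\mathbb{E}(X_{n+1},X_0)$ such that $X_0\xrightarrow{d_0}X_1\to\cdots\xrightarrow{d_n}X_{n+1}\overset{\delta}{\dashrightarrow}$ is a distinguished $n$-exangle. *)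

theory Defs
  imports "HOL-Algebra.Group"
begin

section \<open>Additive categories\<close>

text \<open>
  A category has a set of objects and a set of arrows with domain and codomain. The record also
  carries the addition of parallel arrows and the zero arrows, which make each hom-set an abelian
  group. Nothing is said about values outside the sets of objects and arrows.
\<close>

record ('o, 'm) cat =
  Ob :: "'o set"
  Ar :: "'m set"
  Dom :: "'m \<Rightarrow> 'o"
  Cod :: "'m \<Rightarrow> 'o"
  Id :: "'o \<Rightarrow> 'm"
  comp :: "'m \<Rightarrow> 'm \<Rightarrow> 'm"  (infixr "\<bullet>\<index>" 70)
  madd :: "'m \<Rightarrow> 'm \<Rightarrow> 'm"  (infixl "\<boxplus>\<index>" 65)
  mzero :: "'o \<Rightarrow> 'o \<Rightarrow> 'm"

definition homset :: "('o, 'm) cat \<Rightarrow> 'o \<Rightarrow> 'o \<Rightarrow> 'm set" where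
  "homset C A B = {f \<in> Ar C. Dom C f = A \<and> Cod C f = B}"

definition hom_group :: "('o, 'm) cat \<Rightarrow> 'o \<Rightarrow> 'o \<Rightarrow> 'm monoid" where
  "hom_group C A B = \<lparr>carrier = homset C A B, mult = madd C, one = mzero C A B\<rparr>"

definition mneg :: "('o, 'm) cat \<Rightarrow> 'm \<Rightarrow> 'm"  ("\<boxminus>\<index> _" [81] 80) where
  "mneg C f = inv\<^bsub>hom_group C (Dom C f) (Cod C f)\<^esub> f"

definition is_iso :: "('o, 'm) cat \<Rightarrow> 'm \<Rightarrow> bool" where
  "is_iso C f \<longleftrightarrow> f \<in> Ar C \<and>
     (\<exists>g \<in> homset C (Cod C f) (Dom C f).
        g \<bullet>\<^bsub>C\<^esub> f = Id C (Dom C f) \<and> f \<bullet>\<^bsub>C\<^esub> g = Id C (Cod C f))"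

definition zero_object :: "('o, 'm) cat \<Rightarrow> 'o \<Rightarrow> bool" where
  "zero_object C Z \<longleftrightarrow> Z \<in> Ob C \<and>
     (\<forall>A \<in> Ob C. (\<exists>!f. f \<in> homset C A Z) \<and> (\<exists>!f. f \<in> homset C Z A))"

definition biproduct ::
  "('o, 'm) cat \<Rightarrow> 'o \<Rightarrow> 'o \<Rightarrow> 'o \<times> 'm \<times> 'm \<times> 'm \<times> 'm \<Rightarrow> bool" where
  "biproduct C A B = (\<lambda>(S, i1, i2, p1, p2). S \<in> Ob C \<and>
     i1 \<in> homset C A S \<and> i2 \<in> homset C B S \<and> p1 \<in> homset C S A \<and> p2 \<in> homset C S B \<and>
     p1 \<bullet>\<^bsub>C\<^esub> i1 = Id C A \<and> p2 \<bullet>\<^bsub>C\<^esub> i2 = Id C B \<and>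
     p2 \<bullet>\<^bsub>C\<^esub> i1 = mzero C A B \<and> p1 \<bullet>\<^bsub>C\<^esub> i2 = mzero C B A \<and>
     (i1 \<bullet>\<^bsub>C\<^esub> p1) \<boxplus>\<^bsub>C\<^esub> (i2 \<bullet>\<^bsub>C\<^esub> p2) = Id C S)"

locale category =
  fixes C :: "('o, 'm) cat" (structure)
  assumes dom_ob: "f \<in> Ar C \<Longrightarrow> Dom C f \<in> Ob C"
    and cod_ob: "f \<in> Ar C \<Longrightarrow> Cod C f \<in> Ob C"
    and id_hom: "A \<in> Ob C \<Longrightarrow> Id C A \<in> homset C A A"
    and comp_hom: "f \<in> homset C A B \<Longrightarrow> g \<in> homset C B D \<Longrightarrow> g \<bullet> f \<in> homset C A D"
    and comp_id_right: "f \<in> homset C A B \<Longrightarrow> f \<bullet> Id C A = f"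
    and comp_id_left: "f \<in> homset C A B \<Longrightarrow> Id C B \<bullet> f = f"
    and comp_assoc: "f \<in> homset C A B \<Longrightarrow> g \<in> homset C B D \<Longrightarrow> h \<in> homset C D F \<Longrightarrow>
       (h \<bullet> g) \<bullet> f = h \<bullet> (g \<bullet> f)"

locale additive_category = category +
  assumes hom_comm_group: "A \<in> Ob C \<Longrightarrow> B \<in> Ob C \<Longrightarrow> comm_group (hom_group C A B)"
    and comp_add_right: "f \<in> homset C A B \<Longrightarrow> f' \<in> homset C A B \<Longrightarrow> g \<in> homset C B D \<Longrightarrow>
       g \<bullet> (f \<boxplus> f') = (g \<bullet> f) \<boxplus> (g \<bullet> f')"
    and comp_add_left: "f \<in> homset C A B \<Longrightarrow> g \<in> homset C B D \<Longrightarrow> g' \<in> homset C B D \<Longrightarrow>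
       (g \<boxplus> g') \<bullet> f = (g \<bullet> f) \<boxplus> (g' \<bullet> f)"
    and ex_zero_object: "\<exists>Z. zero_object C Z"
    and ex_biproduct: "A \<in> Ob C \<Longrightarrow> B \<in> Ob C \<Longrightarrow> \<exists>P. biproduct C A B P"

text \<open>
  An additive category merely has a zero object and biproducts; to write down complexes with
  entries \<open>0\<close> and \<open>A \<oplus> B\<close> we fix a choice. It is immaterial, since
  homotopy classes and the class of angles are invariant under isomorphism of the entries.
\<close>

definition zero_ob :: "('o, 'm) cat \<Rightarrow> 'o" where
  "zero_ob C = (SOME Z. zero_object C Z)"

definition biprod :: "('o, 'm) cat \<Rightarrow> 'o \<Rightarrow> 'o \<Rightarrow> 'o \<times> 'm \<times> 'm \<times> 'm \<times> 'm" where
  "biprod C A B = (SOME P. biproduct C A B P)"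

definition dsum :: "('o, 'm) cat \<Rightarrow> 'o \<Rightarrow> 'o \<Rightarrow> 'o" where
  "dsum C A B = (case biprod C A B of (S, i1, i2, p1, p2) \<Rightarrow> S)"

definition inj1 :: "('o, 'm) cat \<Rightarrow> 'o \<Rightarrow> 'o \<Rightarrow> 'm" where
  "inj1 C A B = (case biprod C A B of (S, i1, i2, p1, p2) \<Rightarrow> i1)"

definition inj2 :: "('o, 'm) cat \<Rightarrow> 'o \<Rightarrow> 'o \<Rightarrow> 'm" where
  "inj2 C A B = (case biprod C A B of (S, i1, i2, p1, p2) \<Rightarrow> i2)"

definition proj1 :: "('o, 'm) cat \<Rightarrow> 'o \<Rightarrow> 'o \<Rightarrow> 'm" where
  "proj1 C A B = (case biprod C A B of (S, i1, i2, p1, p2) \<Rightarrow> p1)"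

definition proj2 :: "('o, 'm) cat \<Rightarrow> 'o \<Rightarrow> 'o \<Rightarrow> 'm" where
  "proj2 C A B = (case biprod C A B of (S, i1, i2, p1, p2) \<Rightarrow> p2)"

text \<open>
  Matrices of arrows: \<open>row f g\<close> is \<open>[f g] : A \<oplus> B \<rightarrow> Y\<close>, \<open>col f g\<close> is the column
  \<open>X \<rightarrow> A \<oplus> B\<close> with entries \<open>f\<close> above \<open>g\<close>, and \<open>mat a b c d\<close> has rows \<open>[a b]\<close>, \<open>[c d]\<close>.
\<close>

definition row :: "('o, 'm) cat \<Rightarrow> 'm \<Rightarrow> 'm \<Rightarrow> 'm" where
  "row C f g = (f \<bullet>\<^bsub>C\<^esub> proj1 C (Dom C f) (Dom C g)) \<boxplus>\<^bsub>C\<^esub> (g \<bullet>\<^bsub>C\<^esub> proj2 C (Dom C f) (Dom C g))"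

definition col :: "('o, 'm) cat \<Rightarrow> 'm \<Rightarrow> 'm \<Rightarrow> 'm" where
  "col C f g = (inj1 C (Cod C f) (Cod C g) \<bullet>\<^bsub>C\<^esub> f) \<boxplus>\<^bsub>C\<^esub> (inj2 C (Cod C f) (Cod C g) \<bullet>\<^bsub>C\<^esub> g)"

definition mat :: "('o, 'm) cat \<Rightarrow> 'm \<Rightarrow> 'm \<Rightarrow> 'm \<Rightarrow> 'm \<Rightarrow> 'm" where
  "mat C a b c d = col C (row C a b) (row C c d)"

section \<open>Additive bifunctors and extensions\<close>

text \<open>
  \<open>EOb E C A\<close> is the abelian group \<open>E(C, A)\<close>, written multiplicatively as in the library, so that
  its unit is the zero extension. \<open>EMor E c a\<close> is the map \<open>E(c, a)\<close>, contravariant in \<open>c\<close>.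
\<close>

record ('o, 'm, 'e) bifun =
  EOb :: "'o \<Rightarrow> 'o \<Rightarrow> 'e monoid"
  EMor :: "'m \<Rightarrow> 'm \<Rightarrow> 'e \<Rightarrow> 'e"

abbreviation ext :: "('o, 'm, 'e) bifun \<Rightarrow> 'o \<Rightarrow> 'o \<Rightarrow> 'e set" where
  "ext E C A \<equiv> carrier (EOb E C A)"

abbreviation ext_zero :: "('o, 'm, 'e) bifun \<Rightarrow> 'o \<Rightarrow> 'o \<Rightarrow> 'e" where
  "ext_zero E C A \<equiv> \<one>\<^bsub>EOb E C A\<^esub>"

locale additive_bifunctor = additive_category C
  for C :: "('o, 'm) cat" (structure) +
  fixes E :: "('o, 'm, 'e) bifun"
  assumes ext_comm_group: "Y \<in> Ob C \<Longrightarrow> A \<in> Ob C \<Longrightarrow> comm_group (EOb E Y A)"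
    and EMor_hom: "c \<in> homset C Y' Y \<Longrightarrow> a \<in> homset C A A' \<Longrightarrow>
       EMor E c a \<in> hom (EOb E Y A) (EOb E Y' A')"
    and EMor_id: "Y \<in> Ob C \<Longrightarrow> A \<in> Ob C \<Longrightarrow> \<delta> \<in> ext E Y A \<Longrightarrow> EMor E (Id C Y) (Id C A) \<delta> = \<delta>"
    and EMor_comp: "c \<in> homset C Y' Y \<Longrightarrow> c' \<in> homset C Y'' Y' \<Longrightarrow>
       a \<in> homset C A A' \<Longrightarrow> a' \<in> homset C A' A'' \<Longrightarrow> \<delta> \<in> ext E Y A \<Longrightarrow>
       EMor E (c \<bullet> c') (a' \<bullet> a) \<delta> = EMor E c' a' (EMor E c a \<delta>)"
    and EMor_add_left: "c \<in> homset C Y' Y \<Longrightarrow> c' \<in> homset C Y' Y \<Longrightarrow> a \<in> homset C A A' \<Longrightarrow>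
       \<delta> \<in> ext E Y A \<Longrightarrow> EMor E (c \<boxplus> c') a \<delta> = EMor E c a \<delta> \<otimes>\<^bsub>EOb E Y' A'\<^esub> EMor E c' a \<delta>"
    and EMor_add_right: "c \<in> homset C Y' Y \<Longrightarrow> a \<in> homset C A A' \<Longrightarrow> a' \<in> homset C A A' \<Longrightarrow>
       \<delta> \<in> ext E Y A \<Longrightarrow> EMor E c (a \<boxplus> a') \<delta> = EMor E c a \<delta> \<otimes>\<^bsub>EOb E Y' A'\<^esub> EMor E c a' \<delta>"

text \<open>
  \<open>push C E Y a \<delta>\<close> is \<open>a\<^sub>* \<delta> = E(Y, a)(\<delta>)\<close>, and \<open>pull C E c A \<delta>\<close> is \<open>c\<^sup>* \<delta> = E(c, A)(\<delta>)\<close>.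
\<close>

definition push :: "('o, 'm) cat \<Rightarrow> ('o, 'm, 'e) bifun \<Rightarrow> 'o \<Rightarrow> 'm \<Rightarrow> 'e \<Rightarrow> 'e" where
  "push C E Y a \<delta> = EMor E (Id C Y) a \<delta>"

definition pull :: "('o, 'm) cat \<Rightarrow> ('o, 'm, 'e) bifun \<Rightarrow> 'm \<Rightarrow> 'o \<Rightarrow> 'e \<Rightarrow> 'e" where
  "pull C E c A \<delta> = EMor E c (Id C A) \<delta>"

definition ext_morphism :: "('o, 'm) cat \<Rightarrow> ('o, 'm, 'e) bifun \<Rightarrow>
    'o \<Rightarrow> 'o \<Rightarrow> 'e \<Rightarrow> 'o \<Rightarrow> 'o \<Rightarrow> 'e \<Rightarrow> 'm \<Rightarrow> 'm \<Rightarrow> bool" where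
  "ext_morphism C E Y A \<delta> Y' A' \<delta>' a c \<longleftrightarrow> a \<in> homset C A A' \<and> c \<in> homset C Y Y' \<and>
     push C E Y a \<delta> = pull C E c A' \<delta>'"

section \<open>Complexes and exangles\<close>

text \<open>
  A sequence of objects \<open>tm X i\<close> and arrows \<open>df X i\<close> out of \<open>tm X i\<close>. Only the indices \<open>i \<le> n + 1\<close>
  of objects and \<open>i \<le> n\<close> of arrows (\<open>i \<le> n + 1\<close> for the sequences of an angulation)
  are meaningful. Since no notion below looks at the other indices, homotopy classes and
  isomorphism-closed classes of sequences contain all the variants in the remaining values.
\<close>

record ('o, 'm) sequ =
  tm :: "nat \<Rightarrow> 'o"
  df :: "nat \<Rightarrow> 'm"

definition cplx :: "nat \<Rightarrow> ('o, 'm) cat \<Rightarrow> ('o, 'm) sequ \<Rightarrow> bool" where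
  "cplx n C X \<longleftrightarrow> (\<forall>i \<le> n + 1. tm X i \<in> Ob C) \<and>
     (\<forall>i \<le> n. df X i \<in> homset C (tm X i) (tm X (i + 1))) \<and>
     (\<forall>i < n. df X (i + 1) \<bullet>\<^bsub>C\<^esub> df X i = mzero C (tm X i) (tm X (i + 2)))"

definition chain_map ::
  "nat \<Rightarrow> ('o, 'm) cat \<Rightarrow> ('o, 'm) sequ \<Rightarrow> ('o, 'm) sequ \<Rightarrow> (nat \<Rightarrow> 'm) \<Rightarrow> bool" where
  "chain_map n C X Y f \<longleftrightarrow> (\<forall>i \<le> n + 1. f i \<in> homset C (tm X i) (tm Y i)) \<and>
     (\<forall>i \<le> n. f (i + 1) \<bullet>\<^bsub>C\<^esub> df X i = df Y i \<bullet>\<^bsub>C\<^esub> f i)"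

definition end_chain_map ::
  "nat \<Rightarrow> ('o, 'm) cat \<Rightarrow> ('o, 'm) sequ \<Rightarrow> ('o, 'm) sequ \<Rightarrow> (nat \<Rightarrow> 'm) \<Rightarrow> bool" where
  "end_chain_map n C X Y f \<longleftrightarrow> tm X 0 = tm Y 0 \<and> tm X (n + 1) = tm Y (n + 1) \<and>
     chain_map n C X Y f \<and> f 0 = Id C (tm X 0) \<and> f (n + 1) = Id C (tm X (n + 1))"

definition homotopic :: "nat \<Rightarrow> ('o, 'm) cat \<Rightarrow> ('o, 'm) sequ \<Rightarrow> ('o, 'm) sequ \<Rightarrow>
    (nat \<Rightarrow> 'm) \<Rightarrow> (nat \<Rightarrow> 'm) \<Rightarrow> bool" where
  "homotopic n C X Y f g \<longleftrightarrow>
     (\<exists>\<phi>. (\<forall>i \<in> {1..n + 1}. \<phi> i \<in> homset C (tm X i) (tm Y (i - 1))) \<and>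
        \<phi> 1 \<bullet>\<^bsub>C\<^esub> df X 0 = mzero C (tm X 0) (tm Y 0) \<and>
        (\<forall>i \<in> {1..n}. g i \<boxplus>\<^bsub>C\<^esub> \<boxminus>\<^bsub>C\<^esub> f i =
           (df Y (i - 1) \<bullet>\<^bsub>C\<^esub> \<phi> i) \<boxplus>\<^bsub>C\<^esub> (\<phi> (i + 1) \<bullet>\<^bsub>C\<^esub> df X i)) \<and>
        df Y n \<bullet>\<^bsub>C\<^esub> \<phi> (n + 1) = mzero C (tm X (n + 1)) (tm Y (n + 1)))"

definition homotopy_equiv ::
  "nat \<Rightarrow> ('o, 'm) cat \<Rightarrow> ('o, 'm) sequ \<Rightarrow> ('o, 'm) sequ \<Rightarrow> bool" where
  "homotopy_equiv n C X Y \<longleftrightarrow>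
     (\<exists>f g. end_chain_map n C X Y f \<and> end_chain_map n C Y X g \<and>
        homotopic n C X X (\<lambda>i. g i \<bullet>\<^bsub>C\<^esub> f i) (\<lambda>i. Id C (tm X i)) \<and>
        homotopic n C Y Y (\<lambda>i. f i \<bullet>\<^bsub>C\<^esub> g i) (\<lambda>i. Id C (tm Y i)))"

definition hclass :: "nat \<Rightarrow> ('o, 'm) cat \<Rightarrow> ('o, 'm) sequ \<Rightarrow> ('o, 'm) sequ set" where
  "hclass n C X = {Y. cplx n C Y \<and> homotopy_equiv n C X Y}"

text \<open>
  Exactness of the two sequences of functors is exactness at every object \<open>T\<close>; there is no
  condition at the leftmost terms.
\<close>

definition exangle :: "nat \<Rightarrow> ('o, 'm) cat \<Rightarrow> ('o, 'm, 'e) bifun \<Rightarrow> ('o, 'm) sequ \<Rightarrow> 'e \<Rightarrow> bool" where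
  "exangle n C E X \<delta> \<longleftrightarrow> cplx n C X \<and> \<delta> \<in> ext E (tm X (n + 1)) (tm X 0) \<and>
     push C E (tm X (n + 1)) (df X 0) \<delta> = ext_zero E (tm X (n + 1)) (tm X 1) \<and>
     pull C E (df X n) (tm X 0) \<delta> = ext_zero E (tm X n) (tm X 0) \<and>
     (\<forall>T \<in> Ob C.
        (\<forall>i \<in> {1..n}. {f \<in> homset C T (tm X i). df X i \<bullet>\<^bsub>C\<^esub> f = mzero C T (tm X (i + 1))} =
           (\<lambda>g. df X (i - 1) \<bullet>\<^bsub>C\<^esub> g) ` homset C T (tm X (i - 1))) \<and>
        {f \<in> homset C T (tm X (n + 1)). pull C E f (tm X 0) \<delta> = ext_zero E T (tm X 0)} =
           (\<lambda>g. df X n \<bullet>\<^bsub>C\<^esub> g) ` homset C T (tm X n) \<and>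
        (\<forall>i \<in> {1..n}. {f \<in> homset C (tm X i) T. f \<bullet>\<^bsub>C\<^esub> df X (i - 1) = mzero C (tm X (i - 1)) T} =
           (\<lambda>g. g \<bullet>\<^bsub>C\<^esub> df X i) ` homset C (tm X (i + 1)) T) \<and>
        {f \<in> homset C (tm X 0) T. push C E (tm X (n + 1)) f \<delta> = ext_zero E (tm X (n + 1)) T} =
           (\<lambda>g. g \<bullet>\<^bsub>C\<^esub> df X 0) ` homset C (tm X 1) T)"

section \<open>Exact realizations and exangulated categories\<close>

text \<open>
  A realization is a function \<open>s\<close> taking \<open>Y\<close>, \<open>A\<close> and \<open>\<delta> \<in> E(Y, A)\<close> to a homotopy class.
  \<open>distinguished n C E s X \<delta>\<close> says \<open>s(\<delta>) = [X]\<close>.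
\<close>

type_synonym ('o, 'm, 'e) realiz = "'o \<Rightarrow> 'o \<Rightarrow> 'e \<Rightarrow> ('o, 'm) sequ set"

definition distinguished :: "nat \<Rightarrow> ('o, 'm) cat \<Rightarrow> ('o, 'm, 'e) bifun \<Rightarrow>
    ('o, 'm, 'e) realiz \<Rightarrow> ('o, 'm) sequ \<Rightarrow> 'e \<Rightarrow> bool" where
  "distinguished n C E s X \<delta> \<longleftrightarrow> cplx n C X \<and> \<delta> \<in> ext E (tm X (n + 1)) (tm X 0) \<and>
     s (tm X (n + 1)) (tm X 0) \<delta> = hclass n C X"

definition inflation :: "nat \<Rightarrow> ('o, 'm) cat \<Rightarrow> ('o, 'm, 'e) bifun \<Rightarrow>
    ('o, 'm, 'e) realiz \<Rightarrow> 'm \<Rightarrow> bool" where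
  "inflation n C E s f \<longleftrightarrow> (\<exists>X \<delta>. distinguished n C E s X \<delta> \<and> df X 0 = f)"

definition deflation :: "nat \<Rightarrow> ('o, 'm) cat \<Rightarrow> ('o, 'm, 'e) bifun \<Rightarrow>
    ('o, 'm, 'e) realiz \<Rightarrow> 'm \<Rightarrow> bool" where
  "deflation n C E s f \<longleftrightarrow> (\<exists>X \<delta>. distinguished n C E s X \<delta> \<and> df X n = f)"

text \<open>The complexes \<open>A = A \<rightarrow> 0 \<rightarrow> \<dots> \<rightarrow> 0\<close> and \<open>0 \<rightarrow> \<dots> \<rightarrow> 0 \<rightarrow> A = A\<close>.\<close>

definition id_left :: "('o, 'm) cat \<Rightarrow> 'o \<Rightarrow> ('o, 'm) sequ" where
  "id_left C A = (let t = (\<lambda>i. if i \<le> 1 then A else zero_ob C) in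
     \<lparr>tm = t, df = (\<lambda>i. if i = 0 then Id C A else mzero C (t i) (t (i + 1)))\<rparr>)"

definition id_right :: "nat \<Rightarrow> ('o, 'm) cat \<Rightarrow> 'o \<Rightarrow> ('o, 'm) sequ" where
  "id_right n C A = (let t = (\<lambda>i. if i < n then zero_ob C else A) in
     \<lparr>tm = t, df = (\<lambda>i. if i = n then Id C A else mzero C (t i) (t (i + 1)))\<rparr>)"

locale exact_realization = additive_bifunctor C E
  for C :: "('o, 'm) cat" (structure) and E :: "('o, 'm, 'e) bifun" +
  fixes n :: nat and s :: "('o, 'm, 'e) realiz"
  assumes realized: "D \<in> Ob C \<Longrightarrow> A \<in> Ob C \<Longrightarrow> \<delta> \<in> ext E D A \<Longrightarrow>
       \<exists>X. cplx n C X \<and> tm X 0 = A \<and> tm X (n + 1) = D \<and> s D A \<delta> = hclass n C X"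
    and R0: "distinguished n C E s X \<delta> \<Longrightarrow> distinguished n C E s Y \<rho> \<Longrightarrow>
       ext_morphism C E (tm X (n + 1)) (tm X 0) \<delta> (tm Y (n + 1)) (tm Y 0) \<rho> a c \<Longrightarrow>
       \<exists>f. chain_map n C X Y f \<and> f 0 = a \<and> f (n + 1) = c"
    and R1: "distinguished n C E s X \<delta> \<Longrightarrow> exangle n C E X \<delta>"
    and R2_left: "A \<in> Ob C \<Longrightarrow>
       distinguished n C E s (id_left C A) (ext_zero E (zero_ob C) A)"
    and R2_right: "A \<in> Ob C \<Longrightarrow>
       distinguished n C E s (id_right n C A) (ext_zero E A (zero_ob C))"

definition cone :: "nat \<Rightarrow> ('o, 'm) cat \<Rightarrow> ('o, 'm) sequ \<Rightarrow> ('o, 'm) sequ \<Rightarrow>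
    (nat \<Rightarrow> 'm) \<Rightarrow> ('o, 'm) sequ" where
  "cone n C X Y f =
     \<lparr>tm = (\<lambda>i. if i = 0 then tm X 1 else if i \<le> n then dsum C (tm X (i + 1)) (tm Y i)
               else tm Y (n + 1)),
      df = (\<lambda>i. if i = 0 then col C (\<boxminus>\<^bsub>C\<^esub> df X 1) (f 1)
               else if i < n then mat C (\<boxminus>\<^bsub>C\<^esub> df X (i + 1)) (mzero C (tm Y i) (tm X (i + 2)))
                                        (f (i + 1))        (df Y i)
               else row C (f (n + 1)) (df Y n))\<rparr>"

definition cocone :: "nat \<Rightarrow> ('o, 'm) cat \<Rightarrow> ('o, 'm) sequ \<Rightarrow> ('o, 'm) sequ \<Rightarrow>
    (nat \<Rightarrow> 'm) \<Rightarrow> ('o, 'm) sequ" where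
  "cocone n C X Y h =
     \<lparr>tm = (\<lambda>i. if i = 0 then tm X 0 else if i \<le> n then dsum C (tm Y (i - 1)) (tm X i)
               else tm Y n),
      df = (\<lambda>i. if i = 0 then col C (h 0) (df X 0)
               else if i < n then mat C (\<boxminus>\<^bsub>C\<^esub> df Y (i - 1))                  (h i)
                                        (mzero C (tm Y (i - 1)) (tm X (i + 1))) (df X i)
               else row C (\<boxminus>\<^bsub>C\<^esub> df Y (n - 1)) (h n))\<rparr>"

locale exangulated_category = exact_realization C E n s
  for C :: "('o, 'm) cat" (structure) and E :: "('o, 'm, 'e) bifun"
    and n :: nat and s :: "('o, 'm, 'e) realiz" +
  assumes EA1_inflation: "inflation n C E s f \<Longrightarrow> inflation n C E s g \<Longrightarrow> Cod C f = Dom C g \<Longrightarrow>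
       inflation n C E s (g \<bullet> f)"
    and EA1_deflation: "deflation n C E s f \<Longrightarrow> deflation n C E s g \<Longrightarrow> Cod C f = Dom C g \<Longrightarrow>
       deflation n C E s (g \<bullet> f)"
    and EA2: "tm X 0 = tm Y 0 \<Longrightarrow> c \<in> homset C (tm X (n + 1)) (tm Y (n + 1)) \<Longrightarrow>
       distinguished n C E s X (pull C E c (tm Y 0) \<rho>) \<Longrightarrow> distinguished n C E s Y \<rho> \<Longrightarrow>
       \<exists>f. chain_map n C X Y f \<and> f 0 = Id C (tm X 0) \<and> f (n + 1) = c \<and>
           distinguished n C E s (cone n C X Y f) (push C E (tm Y (n + 1)) (df X 0) \<rho>)"
    and EA2_op: "tm X (n + 1) = tm Y (n + 1) \<Longrightarrow> a \<in> homset C (tm X 0) (tm Y 0) \<Longrightarrow>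
       distinguished n C E s X \<rho> \<Longrightarrow> distinguished n C E s Y (push C E (tm X (n + 1)) a \<rho>) \<Longrightarrow>
       \<exists>h. chain_map n C X Y h \<and> h 0 = a \<and> h (n + 1) = Id C (tm X (n + 1)) \<and>
           distinguished n C E s (cocone n C X Y h) (pull C E (df Y n) (tm X 0) \<rho>)"

definition trivial_inflation :: "nat \<Rightarrow> ('o, 'm) cat \<Rightarrow> ('o, 'm, 'e) bifun \<Rightarrow>
    ('o, 'm, 'e) realiz \<Rightarrow> 'm \<Rightarrow> bool" where
  "trivial_inflation n C E s f \<longleftrightarrow> (\<exists>X \<delta>. distinguished n C E s X \<delta> \<and>
     (\<forall>i \<in> {1..n}. zero_object C (tm X i)) \<and> df X 0 = f)"

definition trivial_deflation :: "nat \<Rightarrow> ('o, 'm) cat \<Rightarrow> ('o, 'm, 'e) bifun \<Rightarrow>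
    ('o, 'm, 'e) realiz \<Rightarrow> 'm \<Rightarrow> bool" where
  "trivial_deflation n C E s f \<longleftrightarrow> (\<exists>X \<delta>. distinguished n C E s X \<delta> \<and>
     (\<forall>i \<in> {1..n}. zero_object C (tm X i)) \<and> df X n = f)"

section \<open>Auto-equivalences\<close>

record ('o, 'm) endofun =
  FOb :: "'o \<Rightarrow> 'o"
  FMor :: "'m \<Rightarrow> 'm"

definition is_functor :: "('o, 'm) cat \<Rightarrow> ('o, 'm) endofun \<Rightarrow> bool" where
  "is_functor C F \<longleftrightarrow>
     (\<forall>A \<in> Ob C. FOb F A \<in> Ob C \<and> FMor F (Id C A) = Id C (FOb F A)) \<and>
     (\<forall>A B. \<forall>f \<in> homset C A B. FMor F f \<in> homset C (FOb F A) (FOb F B)) \<and>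
     (\<forall>A B D. \<forall>f \<in> homset C A B. \<forall>g \<in> homset C B D.
        FMor F (g \<bullet>\<^bsub>C\<^esub> f) = FMor F g \<bullet>\<^bsub>C\<^esub> FMor F f)"

definition id_functor :: "('o, 'm) endofun" where
  "id_functor = \<lparr>FOb = (\<lambda>A. A), FMor = (\<lambda>f. f)\<rparr>"

definition comp_functor :: "('o, 'm) endofun \<Rightarrow> ('o, 'm) endofun \<Rightarrow> ('o, 'm) endofun" where
  "comp_functor G F = \<lparr>FOb = FOb G \<circ> FOb F, FMor = FMor G \<circ> FMor F\<rparr>"

definition nat_isomorphic ::
  "('o, 'm) cat \<Rightarrow> ('o, 'm) endofun \<Rightarrow> ('o, 'm) endofun \<Rightarrow> bool" where
  "nat_isomorphic C F G \<longleftrightarrow>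
     (\<exists>\<eta>. (\<forall>A \<in> Ob C. \<eta> A \<in> homset C (FOb F A) (FOb G A) \<and> is_iso C (\<eta> A)) \<and>
        (\<forall>A B. \<forall>f \<in> homset C A B. \<eta> B \<bullet>\<^bsub>C\<^esub> FMor F f = FMor G f \<bullet>\<^bsub>C\<^esub> \<eta> A))"

definition auto_equivalence :: "('o, 'm) cat \<Rightarrow> ('o, 'm) endofun \<Rightarrow> bool" where
  "auto_equivalence C F \<longleftrightarrow> is_functor C F \<and>
     (\<exists>G. is_functor C G \<and> nat_isomorphic C (comp_functor G F) id_functor \<and>
        nat_isomorphic C (comp_functor F G) id_functor)"

section \<open>Angulated categories\<close>

definition sigma_seq :: "nat \<Rightarrow> ('o, 'm) cat \<Rightarrow> ('o, 'm) endofun \<Rightarrow> ('o, 'm) sequ \<Rightarrow> bool" where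
  "sigma_seq n C \<Sigma> A \<longleftrightarrow> (\<forall>i \<le> n + 1. tm A i \<in> Ob C) \<and>
     (\<forall>i \<le> n. df A i \<in> homset C (tm A i) (tm A (i + 1))) \<and>
     df A (n + 1) \<in> homset C (tm A (n + 1)) (FOb \<Sigma> (tm A 0))"

definition left_rotation ::
  "nat \<Rightarrow> ('o, 'm) cat \<Rightarrow> ('o, 'm) endofun \<Rightarrow> ('o, 'm) sequ \<Rightarrow> ('o, 'm) sequ" where
  "left_rotation n C \<Sigma> A =
     \<lparr>tm = (\<lambda>i. if i \<le> n then tm A (i + 1) else FOb \<Sigma> (tm A 0)),
      df = (\<lambda>i. if i \<le> n then df A (i + 1)
               else if even n then FMor \<Sigma> (df A 0) else \<boxminus>\<^bsub>C\<^esub> FMor \<Sigma> (df A 0))\<rparr>"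

definition seq_morphism :: "nat \<Rightarrow> ('o, 'm) cat \<Rightarrow> ('o, 'm) endofun \<Rightarrow>
    ('o, 'm) sequ \<Rightarrow> ('o, 'm) sequ \<Rightarrow> (nat \<Rightarrow> 'm) \<Rightarrow> bool" where
  "seq_morphism n C \<Sigma> A B \<phi> \<longleftrightarrow> (\<forall>i \<le> n + 1. \<phi> i \<in> homset C (tm A i) (tm B i)) \<and>
     (\<forall>i \<le> n. \<phi> (i + 1) \<bullet>\<^bsub>C\<^esub> df A i = df B i \<bullet>\<^bsub>C\<^esub> \<phi> i) \<and>
     FMor \<Sigma> (\<phi> 0) \<bullet>\<^bsub>C\<^esub> df A (n + 1) = df B (n + 1) \<bullet>\<^bsub>C\<^esub> \<phi> (n + 1)"

definition seq_isomorphic :: "nat \<Rightarrow> ('o, 'm) cat \<Rightarrow> ('o, 'm) endofun \<Rightarrow>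
    ('o, 'm) sequ \<Rightarrow> ('o, 'm) sequ \<Rightarrow> bool" where
  "seq_isomorphic n C \<Sigma> A B \<longleftrightarrow>
     (\<exists>\<phi>. seq_morphism n C \<Sigma> A B \<phi> \<and> (\<forall>i \<le> n + 1. is_iso C (\<phi> i)))"

text \<open>
  The canonical isomorphism \<open>\<Sigma> A \<oplus> \<Sigma> B \<rightarrow> \<Sigma> (A \<oplus> B)\<close>, which is needed to make the last arrow of a
  direct sum or of a mapping cone end in \<open>\<Sigma>\<close> of the first term.
\<close>

definition sigma_sum :: "('o, 'm) cat \<Rightarrow> ('o, 'm) endofun \<Rightarrow> 'o \<Rightarrow> 'o \<Rightarrow> 'm" where
  "sigma_sum C \<Sigma> A B = row C (FMor \<Sigma> (inj1 C A B)) (FMor \<Sigma> (inj2 C A B))"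

definition seq_dsum :: "nat \<Rightarrow> ('o, 'm) cat \<Rightarrow> ('o, 'm) endofun \<Rightarrow>
    ('o, 'm) sequ \<Rightarrow> ('o, 'm) sequ \<Rightarrow> ('o, 'm) sequ" where
  "seq_dsum n C \<Sigma> A B =
     (let d = (\<lambda>i. mat C (df A i) (mzero C (Dom C (df B i)) (Cod C (df A i)))
                         (mzero C (Dom C (df A i)) (Cod C (df B i))) (df B i)) in
     \<lparr>tm = (\<lambda>i. dsum C (tm A i) (tm B i)),
      df = (\<lambda>i. if i \<le> n then d i else sigma_sum C \<Sigma> (tm A 0) (tm B 0) \<bullet>\<^bsub>C\<^esub> d i)\<rparr>)"

text \<open>
  The sequence \<open>A \<rightarrow> A \<rightarrow> 0 \<rightarrow> \<dots> \<rightarrow> 0 \<rightarrow> \<Sigma> A\<close> starting with the identity.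
\<close>

definition seq_id :: "nat \<Rightarrow> ('o, 'm) cat \<Rightarrow> ('o, 'm) endofun \<Rightarrow> 'o \<Rightarrow> ('o, 'm) sequ" where
  "seq_id n C \<Sigma> A =
     \<lparr>tm = tm (id_left C A),
      df = (\<lambda>i. if i \<le> n then df (id_left C A) i else mzero C (zero_ob C) (FOb \<Sigma> A))\<rparr>"

text \<open>
  The \<open>i\<close>-th arrow of the cone, for \<open>i \<le> n\<close>, has entries indexed by \<open>i + 1\<close> in \<open>A\<close> and \<open>i\<close> in \<open>B\<close>.
\<close>

definition seq_cone :: "nat \<Rightarrow> ('o, 'm) cat \<Rightarrow> ('o, 'm) endofun \<Rightarrow>
    ('o, 'm) sequ \<Rightarrow> ('o, 'm) sequ \<Rightarrow> (nat \<Rightarrow> 'm) \<Rightarrow> ('o, 'm) sequ" where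
  "seq_cone n C \<Sigma> A B \<phi> =
     \<lparr>tm = (\<lambda>i. if i \<le> n then dsum C (tm A (i + 1)) (tm B i)
               else dsum C (FOb \<Sigma> (tm A 0)) (tm B (n + 1))),
      df = (\<lambda>i. if i \<le> n
               then mat C (\<boxminus>\<^bsub>C\<^esub> df A (i + 1)) (mzero C (tm B i) (Cod C (df A (i + 1))))
                          (\<phi> (i + 1))        (df B i)
               else sigma_sum C \<Sigma> (tm A 1) (tm B 0) \<bullet>\<^bsub>C\<^esub>
                    mat C (\<boxminus>\<^bsub>C\<^esub> FMor \<Sigma> (df A 0)) (mzero C (tm B (n + 1)) (FOb \<Sigma> (tm A 1)))
                          (FMor \<Sigma> (\<phi> 0))     (df B (n + 1)))\<rparr>"

locale angulated_category = additive_category C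
  for C :: "('o, 'm) cat" (structure) +
  fixes n :: nat and \<Sigma> :: "('o, 'm) endofun" and \<Theta> :: "('o, 'm) sequ set"
  assumes sigma_equiv: "auto_equivalence C \<Sigma>"
    and angles_seq: "A \<in> \<Theta> \<Longrightarrow> sigma_seq n C \<Sigma> A"
    and N1a_iso: "A \<in> \<Theta> \<Longrightarrow> sigma_seq n C \<Sigma> B \<Longrightarrow> seq_isomorphic n C \<Sigma> A B \<Longrightarrow> B \<in> \<Theta>"
    and N1a_sum: "A \<in> \<Theta> \<Longrightarrow> B \<in> \<Theta> \<Longrightarrow> seq_dsum n C \<Sigma> A B \<in> \<Theta>"
    and N1a_summand: "sigma_seq n C \<Sigma> A \<Longrightarrow> sigma_seq n C \<Sigma> B \<Longrightarrow>
       seq_dsum n C \<Sigma> A B \<in> \<Theta> \<Longrightarrow> A \<in> \<Theta> \<and> B \<in> \<Theta>"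
    and N1b: "X \<in> Ob C \<Longrightarrow> seq_id n C \<Sigma> X \<in> \<Theta>"
    and N1c: "f \<in> Ar C \<Longrightarrow> \<exists>A \<in> \<Theta>. df A 0 = f"
    and N2: "sigma_seq n C \<Sigma> A \<Longrightarrow> A \<in> \<Theta> \<longleftrightarrow> left_rotation n C \<Sigma> A \<in> \<Theta>"
    and N3: "A \<in> \<Theta> \<Longrightarrow> B \<in> \<Theta> \<Longrightarrow>
       \<phi>0 \<in> homset C (tm A 0) (tm B 0) \<Longrightarrow> \<phi>1 \<in> homset C (tm A 1) (tm B 1) \<Longrightarrow>
       \<phi>1 \<bullet> df A 0 = df B 0 \<bullet> \<phi>0 \<Longrightarrow>
       \<exists>\<phi>. \<phi> 0 = \<phi>0 \<and> \<phi> 1 = \<phi>1 \<and> seq_morphism n C \<Sigma> A B \<phi>"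
    and N4: "A \<in> \<Theta> \<Longrightarrow> B \<in> \<Theta> \<Longrightarrow>
       \<phi>0 \<in> homset C (tm A 0) (tm B 0) \<Longrightarrow> \<phi>1 \<in> homset C (tm A 1) (tm B 1) \<Longrightarrow>
       \<phi>1 \<bullet> df A 0 = df B 0 \<bullet> \<phi>0 \<Longrightarrow>
       \<exists>\<phi>. \<phi> 0 = \<phi>0 \<and> \<phi> 1 = \<phi>1 \<and> seq_morphism n C \<Sigma> A B \<phi> \<and> seq_cone n C \<Sigma> A B \<phi> \<in> \<Theta>"

text \<open>
  Forgetting the last arrow of a sequence in \<open>\<Theta>\<close> needs no operation, as \<open>distinguished n\<close> only
  looks at \<open>df X i\<close> for \<open>i \<le> n\<close>.
\<close>

definition E_compatible :: "nat \<Rightarrow> ('o, 'm) cat \<Rightarrow> ('o, 'm, 'e) bifun \<Rightarrow>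
    ('o, 'm, 'e) realiz \<Rightarrow> ('o, 'm) sequ set \<Rightarrow> bool" where
  "E_compatible n C E s \<Theta> \<longleftrightarrow>
     (\<forall>X \<in> \<Theta>. \<exists>\<delta> \<in> ext E (tm X (n + 1)) (tm X 0). distinguished n C E s X \<delta>)"

end

theory Submission
  imports Defs
begin

text \<open>
  If every object \<open>A\<close> starts a trivial exangle with extension \<open>\<delta>\<^sub>A \<in> E(\<Sigma>A, A)\<close>, exactness of the
  sequences of functors, continued by one \<open>E\<close>-term, makes \<open>c \<mapsto> c\<^sup>* \<delta>\<^sub>A\<close> a natural bijection from
  \<open>C(-, \<Sigma>A)\<close> to \<open>E(-, A)\<close>. This turns \<open>\<Sigma>\<close> into a functor, an equivalence because the objects also end
  trivial exangles, and the angles are the sequences whose last arrow \<open>h\<close> makes the remaining complex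
  distinguished with extension \<open>h\<^sup>* \<delta>\<close>. Rotation is (EA2) and (EA2\<open>\<^sup>o\<^sup>p\<close>) against a trivial exangle; the
  mapping cone axiom is (EA2) after adding trivial summands. Conversely, rotating \<open>A = A \<rightarrow> 0 \<rightarrow> \<dots>\<close>
  in an angulation yields the trivial exangles.
\<close>

section \<open>Calculus in additive categories\<close>

text \<open>The obstacle is that \<open>s\<close> assigns only a homotopy class to an extension, so
  a complex with the expected terms must be compared with an abstract realization before it is known
  to be distinguished. The comparison is cheap: for complexes whose differentials are successive
  weak cokernels, a pair of opposite chain maps with identity ends already forces homotopy
  equivalence, and (R0) supplies the chain maps. Closure under isomorphisms, sums and retracts is
  obtained in this way.

  The extension of a trivial exangle is a universal element, so arrows into \<open>susp_ob A\<close>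
  are equal as soon as they pull it back to the same extension. Functoriality of the suspension and
  the last square of a morphism of angles are proved by such computations with extensions.

  (EA2) concerns lifts that are the identity on the first term, whereas the cone axiom prescribes
  two arrows at once. Enlarging both complexes to a common first term turns the given square into a
  condition on the second arrow alone, and \<open>good_lift\<close> allows that arrow to be
  prescribed. Cones and rotations carry different signs; the discrepancy is absorbed by
  automorphisms with entries 1 and -1.\<close>

context category
begin

lemma homsetI: "f \<in> Ar C \<Longrightarrow> Dom C f = A \<Longrightarrow> Cod C f = B \<Longrightarrow> f \<in> homset C A B"
  by (simp add: homset_def)

lemma homsetD:
  assumes "f \<in> homset C A B"
  shows "f \<in> Ar C" "Dom C f = A" "Cod C f = B" "A \<in> Ob C" "B \<in> Ob C"
  using assms dom_ob cod_ob by (auto simp: homset_def)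

lemma dom_cod_ob [simp]: "f \<in> Ar C \<Longrightarrow> Dom C f \<in> Ob C" "f \<in> Ar C \<Longrightarrow> Cod C f \<in> Ob C"
  by (auto simp: dom_ob cod_ob)

lemma Id_simps [simp]:
  assumes "A \<in> Ob C"
  shows "Id C A \<in> Ar C" "Dom C (Id C A) = A" "Cod C (Id C A) = A"
  using id_hom[OF assms] by (auto simp: homset_def)

text \<open>Typing is stated through \<open>Ar\<close>, \<open>Dom\<close> and \<open>Cod\<close>,
  so that side conditions become equations for the simplifier; objects occurring only in
  \<open>homset\<close> premises would have to be guessed.\<close>

lemma comp_simps [simp]:
  assumes "f \<in> Ar C" "g \<in> Ar C" "Cod C f = Dom C g"
  shows "g \<bullet> f \<in> Ar C" "Dom C (g \<bullet> f) = Dom C f" "Cod C (g \<bullet> f) = Cod C g"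
  using comp_hom[of f "Dom C f" "Cod C f" g "Cod C g"] assms by (auto simp: homset_def)

lemma comp_Id [simp]:
  "f \<in> Ar C \<Longrightarrow> Dom C f = A \<Longrightarrow> f \<bullet> Id C A = f"
  "f \<in> Ar C \<Longrightarrow> Cod C f = B \<Longrightarrow> Id C B \<bullet> f = f"
  using comp_id_right[of f A "Cod C f"] comp_id_left[of f "Dom C f" B] by (auto simp: homset_def)

lemma assoc [simp]:
  assumes "f \<in> Ar C" "g \<in> Ar C" "h \<in> Ar C" "Cod C f = Dom C g" "Cod C g = Dom C h"
  shows "(h \<bullet> g) \<bullet> f = h \<bullet> (g \<bullet> f)"
  using comp_assoc[of f "Dom C f" "Cod C f" g "Cod C g" h "Cod C h"] assms
  by (auto simp: homset_def)

lemma is_iso_Id: "A \<in> Ob C \<Longrightarrow> is_iso C (Id C A)"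
  unfolding is_iso_def homset_def by (auto intro!: exI[of _ "Id C A"])

text \<open>Composites are normalised to the right, and there the left side of a commuting square no
  longer matches if another arrow \<open>k\<close> comes before it. This form applies the square in
  that position.\<close>

lemma comp_reassoc:
  assumes "g \<bullet> f = g' \<bullet> f'" "k \<in> Ar C" "f \<in> Ar C" "g \<in> Ar C" "f' \<in> Ar C" "g' \<in> Ar C"
    "Cod C k = Dom C f" "Cod C f = Dom C g" "Cod C k = Dom C f'" "Cod C f' = Dom C g'"
  shows "g \<bullet> (f \<bullet> k) = g' \<bullet> (f' \<bullet> k)"
  using assms assoc[of k f g] assoc[of k f' g'] by simp

end

context additive_category
begin

lemma hom_group_simps:
  "carrier (hom_group C A B) = homset C A B" "mult (hom_group C A B) = madd C"
  "\<one>\<^bsub>hom_group C A B\<^esub> = mzero C A B"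
  by (auto simp: hom_group_def)

lemma mzero_simps [simp]:
  assumes "A \<in> Ob C" "B \<in> Ob C"
  shows "mzero C A B \<in> Ar C" "Dom C (mzero C A B) = A" "Cod C (mzero C A B) = B"
proof -
  interpret G: comm_group "hom_group C A B" using hom_comm_group assms by blast
  have "mzero C A B \<in> homset C A B" using G.one_closed by (simp add: hom_group_simps)
  then show "mzero C A B \<in> Ar C" "Dom C (mzero C A B) = A" "Cod C (mzero C A B) = B"
    by (auto simp: homset_def)
qed

lemma madd_simps [simp]:
  assumes "f \<in> Ar C" "g \<in> Ar C" "Dom C f = Dom C g" "Cod C f = Cod C g"
  shows "f \<boxplus> g \<in> Ar C" "Dom C (f \<boxplus> g) = Dom C g" "Cod C (f \<boxplus> g) = Cod C g"
proof -
  interpret G: comm_group "hom_group C (Dom C f) (Cod C f)" using hom_comm_group assms by simp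
  have "f \<boxplus> g \<in> homset C (Dom C f) (Cod C f)"
    using G.m_closed[of f g] assms by (simp add: hom_group_simps homset_def)
  then show "f \<boxplus> g \<in> Ar C" "Dom C (f \<boxplus> g) = Dom C g" "Cod C (f \<boxplus> g) = Cod C g"
    using assms by (auto simp: homset_def)
qed

lemma mneg_simps [simp]:
  assumes "f \<in> Ar C"
  shows "\<boxminus> f \<in> Ar C" "Dom C (\<boxminus> f) = Dom C f" "Cod C (\<boxminus> f) = Cod C f"
proof -
  interpret G: comm_group "hom_group C (Dom C f) (Cod C f)" using hom_comm_group assms by simp
  have "\<boxminus> f \<in> homset C (Dom C f) (Cod C f)"
    using G.inv_closed[of f] assms by (simp add: hom_group_simps homset_def mneg_def)
  then show "\<boxminus> f \<in> Ar C" "Dom C (\<boxminus> f) = Dom C f" "Cod C (\<boxminus> f) = Cod C f"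
    using assms by (auto simp: homset_def)
qed

lemma madd_assoc [simp]:
  assumes "f \<in> Ar C" "g \<in> Ar C" "h \<in> Ar C" "Dom C f = Dom C g" "Cod C f = Cod C g"
    "Dom C g = Dom C h" "Cod C g = Cod C h"
  shows "f \<boxplus> g \<boxplus> h = f \<boxplus> (g \<boxplus> h)"
proof -
  interpret G: comm_group "hom_group C (Dom C f) (Cod C f)" using hom_comm_group assms by simp
  show ?thesis using G.m_assoc[of f g h] assms by (simp add: hom_group_simps homset_def)
qed

lemma madd_comm:
  assumes "f \<in> Ar C" "g \<in> Ar C" "Dom C f = Dom C g" "Cod C f = Cod C g"
  shows "f \<boxplus> g = g \<boxplus> f"
proof -
  interpret G: comm_group "hom_group C (Dom C f) (Cod C f)" using hom_comm_group assms by simp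
  show ?thesis using G.m_comm[of f g] assms by (simp add: hom_group_simps homset_def)
qed

lemma madd_left_comm:
  assumes "f \<in> Ar C" "g \<in> Ar C" "h \<in> Ar C" "Dom C f = Dom C g" "Cod C f = Cod C g"
    "Dom C g = Dom C h" "Cod C g = Cod C h"
  shows "f \<boxplus> (g \<boxplus> h) = g \<boxplus> (f \<boxplus> h)"
  using madd_assoc[of f g h] madd_assoc[of g f h] madd_comm[of f g] assms by simp

lemmas madd_ac = madd_comm madd_left_comm

lemma madd_zero [simp]:
  assumes "f \<in> Ar C" "Dom C f = A" "Cod C f = B"
  shows "f \<boxplus> mzero C A B = f" "mzero C A B \<boxplus> f = f"
proof -
  interpret G: comm_group "hom_group C A B" using hom_comm_group assms by auto
  show "f \<boxplus> mzero C A B = f" "mzero C A B \<boxplus> f = f"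
    using G.r_one[of f] G.l_one[of f] assms by (auto simp: hom_group_simps homset_def)
qed

lemma madd_neg [simp]:
  assumes "f \<in> Ar C"
  shows "f \<boxplus> \<boxminus> f = mzero C (Dom C f) (Cod C f)" "\<boxminus> f \<boxplus> f = mzero C (Dom C f) (Cod C f)"
proof -
  interpret G: comm_group "hom_group C (Dom C f) (Cod C f)" using hom_comm_group assms by auto
  show "f \<boxplus> \<boxminus> f = mzero C (Dom C f) (Cod C f)" "\<boxminus> f \<boxplus> f = mzero C (Dom C f) (Cod C f)"
    using G.r_inv[of f] G.l_inv[of f] assms by (auto simp: hom_group_simps homset_def mneg_def)
qed

lemma madd_neg_cancel [simp]:
  assumes "f \<in> Ar C" "g \<in> Ar C" "Dom C f = Dom C g" "Cod C f = Cod C g"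
  shows "f \<boxplus> (\<boxminus> f \<boxplus> g) = g" "\<boxminus> f \<boxplus> (f \<boxplus> g) = g"
  using madd_assoc[of f "\<boxminus> f" g] madd_assoc[of "\<boxminus> f" f g] assms by simp_all

lemma madd_neg_conj [simp]:
  assumes "f \<in> Ar C" "g \<in> Ar C" "Dom C f = Dom C g" "Cod C f = Cod C g"
  shows "f \<boxplus> (g \<boxplus> \<boxminus> f) = g" "\<boxminus> f \<boxplus> (g \<boxplus> f) = g"
  by (subst madd_left_comm; use assms in simp)+

lemma madd_left_cancel:
  assumes "f \<boxplus> g = f \<boxplus> h" "f \<in> Ar C" "g \<in> Ar C" "h \<in> Ar C" "Dom C f = Dom C g" "Cod C f = Cod C g"
    "Dom C g = Dom C h" "Cod C g = Cod C h"
  shows "g = h"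
proof -
  have "g = \<boxminus> f \<boxplus> (f \<boxplus> g)"
    by (rule madd_neg_cancel(2)[symmetric]) (use assms(2-) in simp_all)
  also have "\<dots> = h"
    unfolding assms(1) by (rule madd_neg_cancel(2)) (use assms(2-) in simp_all)
  finally show ?thesis .
qed

lemma mneg_unique:
  assumes "f \<boxplus> g = mzero C (Dom C f) (Cod C f)" "f \<in> Ar C" "g \<in> Ar C"
    "Dom C f = Dom C g" "Cod C f = Cod C g"
  shows "g = \<boxminus> f"
  by (rule madd_left_cancel[of f g "\<boxminus> f"]) (use assms in simp_all)

lemma mneg_mneg [simp]: "f \<in> Ar C \<Longrightarrow> \<boxminus> (\<boxminus> f) = f"
  using mneg_unique[of "\<boxminus> f" f] by simp

lemma mneg_zero [simp]: "A \<in> Ob C \<Longrightarrow> B \<in> Ob C \<Longrightarrow> \<boxminus> mzero C A B = mzero C A B"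
  using mneg_unique[of "mzero C A B" "mzero C A B"] by simp

lemma mneg_madd [simp]:
  assumes "f \<in> Ar C" "g \<in> Ar C" "Dom C f = Dom C g" "Cod C f = Cod C g"
  shows "\<boxminus> (f \<boxplus> g) = \<boxminus> f \<boxplus> \<boxminus> g"
  by (rule mneg_unique[symmetric], subst madd_left_comm) (use assms in \<open>simp_all\<close>)

lemma diff_eq_zeroD:
  assumes "f \<boxplus> \<boxminus> g = mzero C A B" "f \<in> Ar C" "g \<in> Ar C" "Dom C f = A" "Dom C g = A"
    "Cod C f = B" "Cod C g = B"
  shows "f = g"
  using mneg_unique[of "\<boxminus> g" f] madd_comm[of f "\<boxminus> g"] assms by simp

lemma comp_madd [simp]:
  "f \<in> Ar C \<Longrightarrow> f' \<in> Ar C \<Longrightarrow> g \<in> Ar C \<Longrightarrow> Dom C f = Dom C f' \<Longrightarrow> Cod C f = Dom C g \<Longrightarrow>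
    Cod C f' = Dom C g \<Longrightarrow> g \<bullet> (f \<boxplus> f') = (g \<bullet> f) \<boxplus> (g \<bullet> f')"
  "f \<in> Ar C \<Longrightarrow> g \<in> Ar C \<Longrightarrow> g' \<in> Ar C \<Longrightarrow> Cod C f = Dom C g \<Longrightarrow> Cod C f = Dom C g' \<Longrightarrow>
    Cod C g = Cod C g' \<Longrightarrow> (g \<boxplus> g') \<bullet> f = (g \<bullet> f) \<boxplus> (g' \<bullet> f)"
  using comp_add_right[of f "Dom C f" "Dom C g" f' g "Cod C g"]
    comp_add_left[of f "Dom C f" "Dom C g" g "Cod C g" g']
  by (auto simp: homset_def)

lemma comp_mzero [simp]:
  assumes "f \<in> Ar C" "A \<in> Ob C"
  shows "B = Dom C f \<Longrightarrow> f \<bullet> mzero C A B = mzero C A (Cod C f)"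
    "B = Cod C f \<Longrightarrow> mzero C B A \<bullet> f = mzero C (Dom C f) A"
proof -
  let ?z = "f \<bullet> mzero C A (Dom C f)" and ?w = "mzero C (Cod C f) A \<bullet> f"
  have "?z \<boxplus> ?z = ?z \<boxplus> mzero C A (Cod C f)"
    using comp_madd(1)[of "mzero C A (Dom C f)" "mzero C A (Dom C f)" f] assms by simp
  then show "B = Dom C f \<Longrightarrow> f \<bullet> mzero C A B = mzero C A (Cod C f)"
    using madd_left_cancel[of ?z ?z "mzero C A (Cod C f)"] assms by simp
  have "?w \<boxplus> ?w = ?w \<boxplus> mzero C (Dom C f) A"
    using comp_madd(2)[of f "mzero C (Cod C f) A" "mzero C (Cod C f) A"] assms by simp
  then show "B = Cod C f \<Longrightarrow> mzero C B A \<bullet> f = mzero C (Dom C f) A"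
    using madd_left_cancel[of ?w ?w "mzero C (Dom C f) A"] assms by simp
qed

lemma comp_mneg [simp]:
  assumes "f \<in> Ar C" "g \<in> Ar C" "Cod C f = Dom C g"
  shows "g \<bullet> \<boxminus> f = \<boxminus> (g \<bullet> f)" "\<boxminus> g \<bullet> f = \<boxminus> (g \<bullet> f)"
proof -
  show "g \<bullet> \<boxminus> f = \<boxminus> (g \<bullet> f)"
    by (rule mneg_unique) (use assms comp_madd(1)[of f "\<boxminus> f" g] in simp_all)
  show "\<boxminus> g \<bullet> f = \<boxminus> (g \<bullet> f)"
    by (rule mneg_unique) (use assms comp_madd(2)[of f g "\<boxminus> g"] in simp_all)
qed

section \<open>Biproducts and matrices of arrows\<close>

lemma biprod_biproduct:
  assumes "A \<in> Ob C" "B \<in> Ob C"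
  shows "biproduct C A B (dsum C A B, inj1 C A B, inj2 C A B, proj1 C A B, proj2 C A B)"
proof -
  have "biproduct C A B (biprod C A B)"
    using someI_ex[OF ex_biproduct[OF assms]] by (simp add: biprod_def)
  then show ?thesis
    by (auto simp: dsum_def inj1_def inj2_def proj1_def proj2_def split: prod.splits)
qed

lemma dsum_simps [simp]:
  assumes "A \<in> Ob C" "B \<in> Ob C"
  shows "dsum C A B \<in> Ob C"
    "inj1 C A B \<in> Ar C" "Dom C (inj1 C A B) = A" "Cod C (inj1 C A B) = dsum C A B"
    "inj2 C A B \<in> Ar C" "Dom C (inj2 C A B) = B" "Cod C (inj2 C A B) = dsum C A B"
    "proj1 C A B \<in> Ar C" "Dom C (proj1 C A B) = dsum C A B" "Cod C (proj1 C A B) = A"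
    "proj2 C A B \<in> Ar C" "Dom C (proj2 C A B) = dsum C A B" "Cod C (proj2 C A B) = B"
    "proj1 C A B \<bullet> inj1 C A B = Id C A" "proj2 C A B \<bullet> inj2 C A B = Id C B"
    "proj2 C A B \<bullet> inj1 C A B = mzero C A B" "proj1 C A B \<bullet> inj2 C A B = mzero C B A"
    "(inj1 C A B \<bullet> proj1 C A B) \<boxplus> (inj2 C A B \<bullet> proj2 C A B) = Id C (dsum C A B)"
  using biprod_biproduct[OF assms] by (auto simp: biproduct_def homset_def)

lemma proj_inj_comp [simp]:
  assumes "A \<in> Ob C" "B \<in> Ob C" "f \<in> Ar C"
  shows "Cod C f = A \<Longrightarrow> proj1 C A B \<bullet> (inj1 C A B \<bullet> f) = f"
    "Cod C f = B \<Longrightarrow> proj2 C A B \<bullet> (inj2 C A B \<bullet> f) = f"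
    "Cod C f = A \<Longrightarrow> proj2 C A B \<bullet> (inj1 C A B \<bullet> f) = mzero C (Dom C f) B"
    "Cod C f = B \<Longrightarrow> proj1 C A B \<bullet> (inj2 C A B \<bullet> f) = mzero C (Dom C f) A"
  using assms assoc[of f "inj1 C A B" "proj1 C A B"] assoc[of f "inj2 C A B" "proj2 C A B"]
     assoc[of f "inj1 C A B" "proj2 C A B"] assoc[of f "inj2 C A B" "proj1 C A B"]
  by simp_all

lemma row_simps [simp]:
  assumes "f \<in> Ar C" "g \<in> Ar C" "Cod C f = Cod C g"
  shows "row C f g \<in> Ar C" "Dom C (row C f g) = dsum C (Dom C f) (Dom C g)"
    "Cod C (row C f g) = Cod C g"
    "A = Dom C f \<Longrightarrow> B = Dom C g \<Longrightarrow> row C f g \<bullet> inj1 C A B = f"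
    "A = Dom C f \<Longrightarrow> B = Dom C g \<Longrightarrow> row C f g \<bullet> inj2 C A B = g"
    "A = Dom C f \<Longrightarrow> B = Dom C g \<Longrightarrow> h \<in> Ar C \<Longrightarrow> Cod C h = Dom C f \<Longrightarrow>
      row C f g \<bullet> (inj1 C A B \<bullet> h) = f \<bullet> h"
    "A = Dom C f \<Longrightarrow> B = Dom C g \<Longrightarrow> h \<in> Ar C \<Longrightarrow> Cod C h = Dom C g \<Longrightarrow>
      row C f g \<bullet> (inj2 C A B \<bullet> h) = g \<bullet> h"
    "k \<in> Ar C \<Longrightarrow> Dom C k = Cod C g \<Longrightarrow> k \<bullet> row C f g = row C (k \<bullet> f) (k \<bullet> g)"
  using assms by (simp_all add: row_def)

lemma col_simps [simp]:
  assumes "f \<in> Ar C" "g \<in> Ar C" "Dom C f = Dom C g"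
  shows "col C f g \<in> Ar C" "Cod C (col C f g) = dsum C (Cod C f) (Cod C g)"
    "Dom C (col C f g) = Dom C g"
    "A = Cod C f \<Longrightarrow> B = Cod C g \<Longrightarrow> proj1 C A B \<bullet> col C f g = f"
    "A = Cod C f \<Longrightarrow> B = Cod C g \<Longrightarrow> proj2 C A B \<bullet> col C f g = g"
    "k \<in> Ar C \<Longrightarrow> Cod C k = Dom C g \<Longrightarrow> col C f g \<bullet> k = col C (f \<bullet> k) (g \<bullet> k)"
  using assms by (simp_all add: col_def)

lemma row_col [simp]:
  assumes "f \<in> Ar C" "g \<in> Ar C" "Cod C f = Cod C g" "h \<in> Ar C" "k \<in> Ar C" "Dom C h = Dom C k"
    "Cod C h = Dom C f" "Cod C k = Dom C g"
  shows "row C f g \<bullet> col C h k = (f \<bullet> h) \<boxplus> (g \<bullet> k)"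
  using assms by (simp add: col_def)

text \<open>Insert the decomposition of the identity of A \<oplus> B into its two idempotents.
  Equalities of matrices are checked entry by entry through this rule and
  \<open>col_ext\<close>.\<close>

lemma row_ext:
  assumes "u \<in> Ar C" "v \<in> Ar C" "Dom C u = dsum C A B" "Dom C v = dsum C A B" "Cod C u = Cod C v"
    "A \<in> Ob C" "B \<in> Ob C" "u \<bullet> inj1 C A B = v \<bullet> inj1 C A B" "u \<bullet> inj2 C A B = v \<bullet> inj2 C A B"
  shows "u = v"
proof -
  have *: "w = ((w \<bullet> inj1 C A B) \<bullet> proj1 C A B) \<boxplus> ((w \<bullet> inj2 C A B) \<bullet> proj2 C A B)"
    if "w \<in> Ar C" "Dom C w = dsum C A B" for w
    using that assms(6,7)
      comp_madd(1)[of "inj1 C A B \<bullet> proj1 C A B" "inj2 C A B \<bullet> proj2 C A B" w] by simp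
  show ?thesis using *[of u] *[of v] assms by metis
qed

lemma col_ext:
  assumes "u \<in> Ar C" "v \<in> Ar C" "Cod C u = dsum C A B" "Cod C v = dsum C A B" "Dom C u = Dom C v"
    "A \<in> Ob C" "B \<in> Ob C" "proj1 C A B \<bullet> u = proj1 C A B \<bullet> v" "proj2 C A B \<bullet> u = proj2 C A B \<bullet> v"
  shows "u = v"
proof -
  have *: "w = (inj1 C A B \<bullet> (proj1 C A B \<bullet> w)) \<boxplus> (inj2 C A B \<bullet> (proj2 C A B \<bullet> w))"
    if "w \<in> Ar C" "Cod C w = dsum C A B" for w
    using that assms(6,7)
      comp_madd(2)[of w "inj1 C A B \<bullet> proj1 C A B" "inj2 C A B \<bullet> proj2 C A B"] by simp
  show ?thesis using *[of u] *[of v] assms by metis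
qed

lemma col_madd [simp]:
  assumes "f \<in> Ar C" "g \<in> Ar C" "f' \<in> Ar C" "g' \<in> Ar C" "Dom C f = Dom C g" "Dom C f' = Dom C g'"
    "Dom C g = Dom C g'" "Cod C f = Cod C f'" "Cod C g = Cod C g'"
  shows "col C f g \<boxplus> col C f' g' = col C (f \<boxplus> f') (g \<boxplus> g')"
  by (rule col_ext[of _ _ "Cod C f'" "Cod C g'"]) (use assms in simp_all)

lemma row_madd [simp]:
  assumes "f \<in> Ar C" "g \<in> Ar C" "f' \<in> Ar C" "g' \<in> Ar C" "Cod C f = Cod C g" "Cod C f' = Cod C g'"
    "Cod C g = Cod C g'" "Dom C f = Dom C f'" "Dom C g = Dom C g'"
  shows "row C f g \<boxplus> row C f' g' = row C (f \<boxplus> f') (g \<boxplus> g')"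
  by (rule row_ext[of _ _ "Dom C f'" "Dom C g'"]) (use assms in simp_all)

lemma col_mneg [simp]:
  assumes "f \<in> Ar C" "g \<in> Ar C" "Dom C f = Dom C g"
  shows "\<boxminus> (col C f g) = col C (\<boxminus> f) (\<boxminus> g)"
  by (rule col_ext[of _ _ "Cod C f" "Cod C g"]) (use assms in simp_all)

lemma row_mneg [simp]:
  assumes "f \<in> Ar C" "g \<in> Ar C" "Cod C f = Cod C g"
  shows "\<boxminus> (row C f g) = row C (\<boxminus> f) (\<boxminus> g)"
  by (rule row_ext[of _ _ "Dom C f" "Dom C g"]) (use assms in simp_all)

text \<open>A block matrix can be read by columns or by rows. \<open>mat\<close> reads by rows,
  while the last differential of a cone may arise as a row of columns.\<close>

lemma row_col_interchange:
  assumes "a \<in> Ar C" "b \<in> Ar C" "c \<in> Ar C" "d \<in> Ar C" "Cod C a = Cod C b" "Cod C c = Cod C d"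
    "Dom C a = Dom C c" "Dom C b = Dom C d"
  shows "row C (col C a c) (col C b d) = col C (row C a b) (row C c d)"
  by (rule row_ext[of _ _ "Dom C a" "Dom C b"]) (use assms in simp_all)

lemma zero_object_zero_ob: "zero_object C (zero_ob C)"
  unfolding zero_ob_def by (rule someI_ex[OF ex_zero_object])

lemma zero_ob_Ob [simp]: "zero_ob C \<in> Ob C"
  using zero_object_zero_ob by (simp add: zero_object_def)

lemma zero_object_Ob: "zero_object C Z \<Longrightarrow> Z \<in> Ob C"
  by (simp add: zero_object_def)

lemma into_zero:
  assumes "zero_object C (Cod C f)" "f \<in> Ar C"
  shows "f = mzero C (Dom C f) (Cod C f)"
proof -
  have "\<exists>!g. g \<in> homset C (Dom C f) (Cod C f)" using assms by (simp add: zero_object_def)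
  moreover have "f \<in> homset C (Dom C f) (Cod C f)" "mzero C (Dom C f) (Cod C f) \<in> homset C (Dom C f) (Cod C f)"
    using assms by (simp_all add: homset_def)
  ultimately show ?thesis by blast
qed

lemma from_zero:
  assumes "zero_object C (Dom C f)" "f \<in> Ar C"
  shows "f = mzero C (Dom C f) (Cod C f)"
proof -
  have "\<exists>!g. g \<in> homset C (Dom C f) (Cod C f)" using assms by (simp add: zero_object_def)
  moreover have "f \<in> homset C (Dom C f) (Cod C f)" "mzero C (Dom C f) (Cod C f) \<in> homset C (Dom C f) (Cod C f)"
    using assms by (simp_all add: homset_def)
  ultimately show ?thesis by blast
qed

lemma col_eta: "u \<in> Ar C \<Longrightarrow> Cod C u = dsum C A B \<Longrightarrow> A \<in> Ob C \<Longrightarrow> B \<in> Ob C \<Longrightarrow>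
    u = col C (proj1 C A B \<bullet> u) (proj2 C A B \<bullet> u)"
  by (rule col_ext[of _ _ A B]) simp_all

lemma row_eta: "u \<in> Ar C \<Longrightarrow> Dom C u = dsum C A B \<Longrightarrow> A \<in> Ob C \<Longrightarrow> B \<in> Ob C \<Longrightarrow>
    u = row C (u \<bullet> inj1 C A B) (u \<bullet> inj2 C A B)"
  by (rule row_ext[of _ _ A B]) simp_all

text \<open>The second projection ends in a zero object, so one idempotent of the decomposition
  vanishes. This removes the zero summands that a trivial exangle leaves in cones and
  cocones.\<close>

lemma inj1_proj1_zero:
  assumes "A \<in> Ob C" "zero_object C Z"
  shows "inj1 C A Z \<bullet> proj1 C A Z = Id C (dsum C A Z)"
proof -
  have [simp]: "Z \<in> Ob C" using assms by (simp add: zero_object_Ob)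
  have "proj2 C A Z = mzero C (dsum C A Z) Z" using into_zero[of "proj2 C A Z"] assms by simp
  then show ?thesis using dsum_simps(18)[of A Z] assms by simp
qed

lemma col_row_zero:
  assumes "f \<in> Ar C" "A \<in> Ob C"
  shows "D = Dom C f \<Longrightarrow> col C f (mzero C D A) = inj1 C (Cod C f) A \<bullet> f"
    "D = Dom C f \<Longrightarrow> col C (mzero C D A) f = inj2 C A (Cod C f) \<bullet> f"
    "D = Cod C f \<Longrightarrow> row C f (mzero C A D) = f \<bullet> proj1 C (Dom C f) A"
    "D = Cod C f \<Longrightarrow> row C (mzero C A D) f = f \<bullet> proj2 C A (Dom C f)"
  using assms by (simp_all add: col_def row_def)

text \<open>The factor (-1)^k. Cones and cocones negate differentials one by one, while a rotation
  has a single sign (-1)^n; the comparison isomorphisms collect these powers.\<close>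

definition sg where "sg k f = (if even k then f else \<boxminus> f)"

lemma sg_simps [simp]:
  assumes "f \<in> Ar C"
  shows "sg k f \<in> Ar C" "Dom C (sg k f) = Dom C f" "Cod C (sg k f) = Cod C f"
    "g \<in> Ar C \<Longrightarrow> Cod C f = Dom C g \<Longrightarrow> g \<bullet> sg k f = sg k (g \<bullet> f)"
    "g \<in> Ar C \<Longrightarrow> Dom C f = Cod C g \<Longrightarrow> sg k f \<bullet> g = sg k (f \<bullet> g)"
    "sg (Suc k) f = \<boxminus> (sg k f)" "sg k (\<boxminus> f) = \<boxminus> (sg k f)" "sg k (sg k f) = f" "sg 0 f = f"
    "sg (n + k) (sg k f) = sg n f"  "sg (n + k) (sg n f) = sg k f" "sg (n + n) f = f"
  using assms by (auto simp: sg_def)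

section \<open>Homotopy of complexes\<close>

lemma cplxD:
  assumes "cplx n C X"
  shows "i \<le> Suc n \<Longrightarrow> tm X i \<in> Ob C"
    "i \<le> n \<Longrightarrow> df X i \<in> Ar C" "i \<le> n \<Longrightarrow> Dom C (df X i) = tm X i"
    "i \<le> n \<Longrightarrow> Cod C (df X i) = tm X (Suc i)"
    "i < n \<Longrightarrow> df X (Suc i) \<bullet> df X i = mzero C (tm X i) (tm X (Suc (Suc i)))"
  using assms by (auto simp: cplx_def homset_def)

lemma cplx_comp:
  assumes "cplx n C X" "i < n" "k \<in> Ar C" "Cod C k = tm X i"
  shows "df X (Suc i) \<bullet> (df X i \<bullet> k) = mzero C (Dom C k) (tm X (Suc (Suc i)))"
proof -
  have "df X (Suc i) \<bullet> (df X i \<bullet> k) = (df X (Suc i) \<bullet> df X i) \<bullet> k"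
    using assms cplxD[OF assms(1)] by (subst assoc) simp_all
  then show ?thesis using assms cplxD[OF assms(1)] by simp
qed

lemma chain_mapD:
  assumes "chain_map n C X Y f"
  shows "i \<le> Suc n \<Longrightarrow> f i \<in> Ar C" "i \<le> Suc n \<Longrightarrow> Dom C (f i) = tm X i"
    "i \<le> Suc n \<Longrightarrow> Cod C (f i) = tm Y i"
    "i \<le> n \<Longrightarrow> f (Suc i) \<bullet> df X i = df Y i \<bullet> f i"
  using assms by (auto simp: chain_map_def homset_def)

lemma chain_map_comp':
  assumes "chain_map n C X Y f" "cplx n C X" "cplx n C Y" "i \<le> n" "k \<in> Ar C" "Cod C k = tm X i"
  shows "f (Suc i) \<bullet> (df X i \<bullet> k) = df Y i \<bullet> (f i \<bullet> k)"
  using assms cplxD[OF assms(2)] cplxD[OF assms(3)] chain_mapD[OF assms(1)]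
  by (intro comp_reassoc) simp_all

lemma chain_mapI:
  assumes "\<And>i. i \<le> Suc n \<Longrightarrow> f i \<in> Ar C \<and> Dom C (f i) = tm X i \<and> Cod C (f i) = tm Y i"
    "\<And>i. i \<le> n \<Longrightarrow> f (Suc i) \<bullet> df X i = df Y i \<bullet> f i"
  shows "chain_map n C X Y f"
  using assms by (auto simp: chain_map_def homset_def)

lemma chain_map_Id: "cplx n C X \<Longrightarrow> chain_map n C X X (\<lambda>i. Id C (tm X i))"
  by (rule chain_mapI) (simp_all add: cplxD)

lemma chain_map_comp:
  assumes "chain_map n C X Y f" "chain_map n C Y Z g" "cplx n C X" "cplx n C Y" "cplx n C Z"
  shows "chain_map n C X Z (\<lambda>i. g i \<bullet> f i)"
proof (rule chain_mapI)
  note [simp] = chain_mapD[OF assms(1)] chain_mapD[OF assms(2)] cplxD[OF assms(3)]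
    cplxD[OF assms(4)] cplxD[OF assms(5)] chain_map_comp'[OF assms(2,4,5)]
  show "i \<le> n \<Longrightarrow> (g (Suc i) \<bullet> f (Suc i)) \<bullet> df X i = df Z i \<bullet> (g i \<bullet> f i)" for i by simp
qed (use chain_mapD[OF assms(1)] chain_mapD[OF assms(2)] in simp)

lemma chain_map_madd:
  assumes "chain_map n C X Y f" "chain_map n C X Y g" "cplx n C X" "cplx n C Y"
  shows "chain_map n C X Y (\<lambda>i. f i \<boxplus> g i)"
  using chain_mapD[OF assms(1)] chain_mapD[OF assms(2)] cplxD[OF assms(3)] cplxD[OF assms(4)]
  by (intro chain_mapI) simp_all

lemma end_chain_map_comp:
  assumes "end_chain_map n C X Y f" "end_chain_map n C Y Z g" "cplx n C X" "cplx n C Y" "cplx n C Z"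
  shows "end_chain_map n C X Z (\<lambda>i. g i \<bullet> f i)"
  using assms chain_map_comp[of n X Y f Z g] cplxD(1)[OF assms(5)]
  by (auto simp: end_chain_map_def)

text \<open>Applied to the difference of two maps, this turns closure of homotopy under sums and
  composites into additive statements. Degrees 0 and n + 1 of \<open>k\<close> are unconstrained.
  The homotopy is indexed by its target degree, which avoids the predecessor in
  \<open>homotopic\<close>.\<close>

definition null_homotopic where
  "null_homotopic n X Y k \<longleftrightarrow> (\<exists>\<psi>. (\<forall>j \<le> n. \<psi> j \<in> homset C (tm X (Suc j)) (tm Y j)) \<and>
     \<psi> 0 \<bullet> df X 0 = mzero C (tm X 0) (tm Y 0) \<and>
     (\<forall>j < n. k (Suc j) = (df Y j \<bullet> \<psi> j) \<boxplus> (\<psi> (Suc j) \<bullet> df X (Suc j))) \<and>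
     df Y n \<bullet> \<psi> n = mzero C (tm X (Suc n)) (tm Y (Suc n)))"

lemma homotopic_iff_null:
  "homotopic n C X Y f g \<longleftrightarrow> null_homotopic n X Y (\<lambda>i. g i \<boxplus> \<boxminus> f i)"
proof
  assume "homotopic n C X Y f g"
  then obtain \<phi> where \<phi>: "\<forall>i \<in> {1..n + 1}. \<phi> i \<in> homset C (tm X i) (tm Y (i - 1))"
    "\<phi> 1 \<bullet> df X 0 = mzero C (tm X 0) (tm Y 0)"
    "\<forall>i \<in> {1..n}. g i \<boxplus> \<boxminus> f i = (df Y (i - 1) \<bullet> \<phi> i) \<boxplus> (\<phi> (i + 1) \<bullet> df X i)"
    "df Y n \<bullet> \<phi> (n + 1) = mzero C (tm X (n + 1)) (tm Y (n + 1))"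
    unfolding homotopic_def by blast
  have "\<phi> (Suc j) \<in> homset C (tm X (Suc j)) (tm Y j)" if "j \<le> n" for j
    using \<phi>(1)[rule_format, of "Suc j"] that by simp
  moreover have "g (Suc j) \<boxplus> \<boxminus> f (Suc j)
      = (df Y j \<bullet> \<phi> (Suc j)) \<boxplus> (\<phi> (Suc (Suc j)) \<bullet> df X (Suc j))" if "j < n" for j
    using \<phi>(3)[rule_format, of "Suc j"] that by simp
  ultimately show "null_homotopic n X Y (\<lambda>i. g i \<boxplus> \<boxminus> f i)"
    unfolding null_homotopic_def using \<phi>(2,4) by (intro exI[of _ "\<lambda>j. \<phi> (Suc j)"]) auto
next
  assume "null_homotopic n X Y (\<lambda>i. g i \<boxplus> \<boxminus> f i)"
  then obtain \<psi> where \<psi>: "\<forall>j \<le> n. \<psi> j \<in> homset C (tm X (Suc j)) (tm Y j)"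
     "\<psi> 0 \<bullet> df X 0 = mzero C (tm X 0) (tm Y 0)"
     "\<forall>j < n. g (Suc j) \<boxplus> \<boxminus> f (Suc j) = (df Y j \<bullet> \<psi> j) \<boxplus> (\<psi> (Suc j) \<bullet> df X (Suc j))"
     "df Y n \<bullet> \<psi> n = mzero C (tm X (Suc n)) (tm Y (Suc n))"
    unfolding null_homotopic_def by blast
  have "\<psi> (i - 1) \<in> homset C (tm X i) (tm Y (i - 1))" if "i \<in> {1..n + 1}" for i
    using that \<psi>(1) by (cases i) auto
  moreover have "g i \<boxplus> \<boxminus> f i = (df Y (i - 1) \<bullet> \<psi> (i - 1)) \<boxplus> (\<psi> (i + 1 - 1) \<bullet> df X i)"
    if "i \<in> {1..n}" for i
    using that \<psi>(3) by (cases i) auto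
  ultimately show "homotopic n C X Y f g"
    unfolding homotopic_def using \<psi>(2,4) by (intro exI[of _ "\<lambda>i. \<psi> (i - 1)"]) auto
qed

lemma null_homotopic_cong:
  assumes "null_homotopic n X Y k" "\<And>j. j < n \<Longrightarrow> k' (Suc j) = k (Suc j)"
  shows "null_homotopic n X Y k'"
  using assms by (simp add: null_homotopic_def)

lemma null_homotopic_madd:
  assumes "null_homotopic n X Y k" "null_homotopic n X Y k'" "cplx n C X" "cplx n C Y"
  shows "null_homotopic n X Y (\<lambda>i. k i \<boxplus> k' i)"
proof -
  obtain \<psi> \<psi>' where *: "\<And>j. j \<le> n \<Longrightarrow> \<psi> j \<in> homset C (tm X (Suc j)) (tm Y j)"
     "\<psi> 0 \<bullet> df X 0 = mzero C (tm X 0) (tm Y 0)"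
     "\<And>j. j < n \<Longrightarrow> k (Suc j) = (df Y j \<bullet> \<psi> j) \<boxplus> (\<psi> (Suc j) \<bullet> df X (Suc j))"
     "df Y n \<bullet> \<psi> n = mzero C (tm X (Suc n)) (tm Y (Suc n))"
     "\<And>j. j \<le> n \<Longrightarrow> \<psi>' j \<in> homset C (tm X (Suc j)) (tm Y j)"
     "\<psi>' 0 \<bullet> df X 0 = mzero C (tm X 0) (tm Y 0)"
     "\<And>j. j < n \<Longrightarrow> k' (Suc j) = (df Y j \<bullet> \<psi>' j) \<boxplus> (\<psi>' (Suc j) \<bullet> df X (Suc j))"
     "df Y n \<bullet> \<psi>' n = mzero C (tm X (Suc n)) (tm Y (Suc n))"
    using assms(1,2) unfolding null_homotopic_def by blast
  note [simp] = cplxD[OF assms(3)] cplxD[OF assms(4)] homsetD[OF *(1)] homsetD[OF *(5)] * madd_ac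
  show ?thesis unfolding null_homotopic_def
    by (intro exI[of _ "\<lambda>j. \<psi> j \<boxplus> \<psi>' j"]) (auto intro!: homsetI)
qed

lemma null_homotopic_mneg:
  assumes "null_homotopic n X Y k" "cplx n C X" "cplx n C Y"
  shows "null_homotopic n X Y (\<lambda>i. \<boxminus> k i)"
proof -
  obtain \<psi> where *: "\<And>j. j \<le> n \<Longrightarrow> \<psi> j \<in> homset C (tm X (Suc j)) (tm Y j)"
     "\<psi> 0 \<bullet> df X 0 = mzero C (tm X 0) (tm Y 0)"
     "\<And>j. j < n \<Longrightarrow> k (Suc j) = (df Y j \<bullet> \<psi> j) \<boxplus> (\<psi> (Suc j) \<bullet> df X (Suc j))"
     "df Y n \<bullet> \<psi> n = mzero C (tm X (Suc n)) (tm Y (Suc n))"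
    using assms(1) unfolding null_homotopic_def by blast
  note [simp] = cplxD[OF assms(2)] cplxD[OF assms(3)] homsetD[OF *(1)] *
  show ?thesis unfolding null_homotopic_def
    by (intro exI[of _ "\<lambda>j. \<boxminus> \<psi> j"]) (auto intro!: homsetI)
qed

lemma null_homotopic_comp_left:
  assumes "null_homotopic n X Y k" "chain_map n C Y Z g" "cplx n C X" "cplx n C Y" "cplx n C Z"
  shows "null_homotopic n X Z (\<lambda>i. g i \<bullet> k i)"
proof -
  obtain \<psi> where *: "\<And>j. j \<le> n \<Longrightarrow> \<psi> j \<in> homset C (tm X (Suc j)) (tm Y j)"
     "\<psi> 0 \<bullet> df X 0 = mzero C (tm X 0) (tm Y 0)"
     "\<And>j. j < n \<Longrightarrow> k (Suc j) = (df Y j \<bullet> \<psi> j) \<boxplus> (\<psi> (Suc j) \<bullet> df X (Suc j))"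
     "df Y n \<bullet> \<psi> n = mzero C (tm X (Suc n)) (tm Y (Suc n))"
    using assms(1) unfolding null_homotopic_def by blast
  note [simp] = cplxD[OF assms(3)] cplxD[OF assms(4)] cplxD[OF assms(5)] homsetD[OF *(1)] *
    chain_mapD[OF assms(2)] chain_map_comp'[OF assms(2,4,5)]
    chain_map_comp'[OF assms(2,4,5), symmetric, of n]
  show ?thesis unfolding null_homotopic_def
    by (intro exI[of _ "\<lambda>j. g j \<bullet> \<psi> j"])
      (auto intro!: homsetI simp del: chain_map_comp'[OF assms(2,4,5)]
        simp: chain_map_comp'[OF assms(2,4,5), symmetric])
qed

lemma null_homotopic_comp_right:
  assumes "null_homotopic n Y Z k" "chain_map n C X Y g" "cplx n C X" "cplx n C Y" "cplx n C Z"
  shows "null_homotopic n X Z (\<lambda>i. k i \<bullet> g i)"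
proof -
  obtain \<psi> where *: "\<And>j. j \<le> n \<Longrightarrow> \<psi> j \<in> homset C (tm Y (Suc j)) (tm Z j)"
     "\<psi> 0 \<bullet> df Y 0 = mzero C (tm Y 0) (tm Z 0)"
     "\<And>j. j < n \<Longrightarrow> k (Suc j) = (df Z j \<bullet> \<psi> j) \<boxplus> (\<psi> (Suc j) \<bullet> df Y (Suc j))"
     "df Z n \<bullet> \<psi> n = mzero C (tm Y (Suc n)) (tm Z (Suc n))"
    using assms(1) unfolding null_homotopic_def by blast
  note [simp] = cplxD[OF assms(3)] cplxD[OF assms(4)] cplxD[OF assms(5)] homsetD[OF *(1)]
    chain_mapD[OF assms(2)]
  have "\<psi> 0 \<bullet> (df Y 0 \<bullet> g 0) = (\<psi> 0 \<bullet> df Y 0) \<bullet> g 0" by (subst assoc) simp_all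
  moreover have "df Z n \<bullet> (\<psi> n \<bullet> g (Suc n)) = (df Z n \<bullet> \<psi> n) \<bullet> g (Suc n)"
    by (subst assoc) simp_all
  ultimately show ?thesis unfolding null_homotopic_def
    by (intro exI[of _ "\<lambda>j. \<psi> j \<bullet> g (Suc j)"]) (auto intro!: homsetI simp: *)
qed

lemma homotopic_sym:
  assumes "homotopic n C X Y f g" "chain_map n C X Y f" "chain_map n C X Y g"
    "cplx n C X" "cplx n C Y"
  shows "homotopic n C X Y g f"
  unfolding homotopic_iff_null using chain_mapD[OF assms(2)] chain_mapD[OF assms(3)]
  by (intro null_homotopic_cong[OF null_homotopic_mneg[OF assms(1)[unfolded homotopic_iff_null]
    assms(4,5)]]) (simp add: madd_comm)

lemma homotopic_trans:
  assumes "homotopic n C X Y f g" "homotopic n C X Y g h" "chain_map n C X Y f"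
    "chain_map n C X Y g" "chain_map n C X Y h" "cplx n C X" "cplx n C Y"
  shows "homotopic n C X Y f h"
  unfolding homotopic_iff_null
  using chain_mapD[OF assms(3)] chain_mapD[OF assms(4)] chain_mapD[OF assms(5)]
  by (intro null_homotopic_cong[OF null_homotopic_madd[OF assms(2,1)[unfolded homotopic_iff_null]
    assms(6,7)]]) simp

lemma homotopic_comp_left:
  assumes "homotopic n C X Y f f'" "chain_map n C Y Z g" "chain_map n C X Y f" "chain_map n C X Y f'"
    "cplx n C X" "cplx n C Y" "cplx n C Z"
  shows "homotopic n C X Z (\<lambda>i. g i \<bullet> f i) (\<lambda>i. g i \<bullet> f' i)"
  unfolding homotopic_iff_null
  using chain_mapD[OF assms(2)] chain_mapD[OF assms(3)] chain_mapD[OF assms(4)]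
  by (intro null_homotopic_cong[OF null_homotopic_comp_left[OF assms(1)[unfolded homotopic_iff_null]
    assms(2,5-7)]]) simp

lemma homotopic_comp_right:
  assumes "homotopic n C Y Z f f'" "chain_map n C X Y g" "chain_map n C Y Z f" "chain_map n C Y Z f'"
    "cplx n C X" "cplx n C Y" "cplx n C Z"
  shows "homotopic n C X Z (\<lambda>i. f i \<bullet> g i) (\<lambda>i. f' i \<bullet> g i)"
  unfolding homotopic_iff_null
  using chain_mapD[OF assms(2)] chain_mapD[OF assms(3)] chain_mapD[OF assms(4)]
  by (intro null_homotopic_cong[OF null_homotopic_comp_right[OF assms(1)[unfolded homotopic_iff_null]
    assms(2,5-7)]]) simp

lemma homotopic_cong:
  assumes "homotopic n C X Y f g" "\<And>i. i \<le> Suc n \<Longrightarrow> f i = f' i" "\<And>i. i \<le> Suc n \<Longrightarrow> g i = g' i"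
  shows "homotopic n C X Y f' g'"
  using assms unfolding homotopic_iff_null by (elim null_homotopic_cong) auto

lemma homotopy_equiv_sym: "homotopy_equiv n C X Y \<Longrightarrow> homotopy_equiv n C Y X"
  unfolding homotopy_equiv_def by blast

text \<open>Cancel from the inside: f' g' g f is homotopic to f' f and hence to the
  identity.\<close>

lemma homotopic_inverse_comp:
  assumes "chain_map n C X Y f" "chain_map n C Y Z g" "chain_map n C Y X f'" "chain_map n C Z Y g'"
    "homotopic n C X X (\<lambda>i. f' i \<bullet> f i) (\<lambda>i. Id C (tm X i))"
    "homotopic n C Y Y (\<lambda>i. g' i \<bullet> g i) (\<lambda>i. Id C (tm Y i))"
    and [simp]: "cplx n C X" "cplx n C Y" "cplx n C Z"
  shows "homotopic n C X X (\<lambda>i. (f' i \<bullet> g' i) \<bullet> (g i \<bullet> f i)) (\<lambda>i. Id C (tm X i))"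
proof -
  note [simp] = chain_mapD[OF assms(1)] chain_mapD[OF assms(2)] chain_mapD[OF assms(3)]
    chain_mapD[OF assms(4)]
  have a: "homotopic n C X Y (\<lambda>i. (g' i \<bullet> g i) \<bullet> f i) (\<lambda>i. Id C (tm Y i) \<bullet> f i)"
    by (rule homotopic_comp_right[OF assms(6)])
      (use assms in \<open>auto intro!: chain_map_comp[of n Y Z] chain_map_Id\<close>)
  have "homotopic n C X X (\<lambda>i. f' i \<bullet> ((g' i \<bullet> g i) \<bullet> f i)) (\<lambda>i. f' i \<bullet> (Id C (tm Y i) \<bullet> f i))"
    by (rule homotopic_comp_left[OF a])
     (use assms in \<open>auto intro!: chain_map_comp[of n Y Z] chain_map_comp[of n X Y] chain_map_Id\<close>)
  then have b: "homotopic n C X X (\<lambda>i. (f' i \<bullet> g' i) \<bullet> (g i \<bullet> f i)) (\<lambda>i. f' i \<bullet> f i)"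
    by (rule homotopic_cong) simp_all
  have c: "chain_map n C X Z (\<lambda>i. g i \<bullet> f i)" "chain_map n C Z X (\<lambda>i. f' i \<bullet> g' i)"
    "chain_map n C X X (\<lambda>i. f' i \<bullet> f i)"
    using assms by (auto intro: chain_map_comp)
  show ?thesis
    by (rule homotopic_trans[OF b assms(5) chain_map_comp[OF c(1,2)] c(3) chain_map_Id]) simp_all
qed

lemma homotopy_equiv_trans:
  assumes "homotopy_equiv n C X Y" "homotopy_equiv n C Y Z" "cplx n C X" "cplx n C Y" "cplx n C Z"
  shows "homotopy_equiv n C X Z"
proof -
  obtain f f' where f: "end_chain_map n C X Y f" "end_chain_map n C Y X f'"
    "homotopic n C X X (\<lambda>i. f' i \<bullet> f i) (\<lambda>i. Id C (tm X i))"
    "homotopic n C Y Y (\<lambda>i. f i \<bullet> f' i) (\<lambda>i. Id C (tm Y i))"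
    using assms(1) unfolding homotopy_equiv_def by blast
  obtain g g' where g: "end_chain_map n C Y Z g" "end_chain_map n C Z Y g'"
    "homotopic n C Y Y (\<lambda>i. g' i \<bullet> g i) (\<lambda>i. Id C (tm Y i))"
    "homotopic n C Z Z (\<lambda>i. g i \<bullet> g' i) (\<lambda>i. Id C (tm Z i))"
    using assms(2) unfolding homotopy_equiv_def by blast
  have c: "chain_map n C X Y f" "chain_map n C Y X f'" "chain_map n C Y Z g" "chain_map n C Z Y g'"
    using f g by (simp_all add: end_chain_map_def)
  show ?thesis unfolding homotopy_equiv_def
  proof (rule exI[of _ "\<lambda>i. g i \<bullet> f i"], rule exI[of _ "\<lambda>i. f' i \<bullet> g' i"], intro conjI)
    show "end_chain_map n C X Z (\<lambda>i. g i \<bullet> f i)" "end_chain_map n C Z X (\<lambda>i. f' i \<bullet> g' i)"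
      using end_chain_map_comp[OF f(1) g(1)] end_chain_map_comp[OF g(2) f(2)] assms(3-5) by blast+
    show "homotopic n C X X (\<lambda>i. (f' i \<bullet> g' i) \<bullet> (g i \<bullet> f i)) (\<lambda>i. Id C (tm X i))"
      by (rule homotopic_inverse_comp[OF c(1,3,2,4) f(3) g(3) assms(3-5)])
    show "homotopic n C Z Z (\<lambda>i. (g i \<bullet> f i) \<bullet> (f' i \<bullet> g' i)) (\<lambda>i. Id C (tm Z i))"
      by (rule homotopic_inverse_comp[OF c(4,2,3,1) g(4) f(4) assms(5,4,3)])
  qed
qed

lemma hclass_eq:
  assumes "homotopy_equiv n C X Y" "cplx n C X" "cplx n C Y"
  shows "hclass n C X = hclass n C Y"
  using assms homotopy_equiv_trans homotopy_equiv_sym unfolding hclass_def by blast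

text \<open>Each differential is a weak cokernel of the preceding one. This is the covariant half of
  the exactness of an exangle at the middle terms; it allows homotopies to be built from the left,
  and it is inherited by retracts and sums.\<close>

definition coexact where
  "coexact n X \<longleftrightarrow> (\<forall>j < n. \<forall>f \<in> Ar C. Dom C f = tm X (Suc j) \<longrightarrow>
     f \<bullet> df X j = mzero C (tm X j) (Cod C f) \<longrightarrow>
     (\<exists>g \<in> Ar C. Dom C g = tm X (Suc (Suc j)) \<and> Cod C g = Cod C f \<and> f = g \<bullet> df X (Suc j)))"

text \<open>
  A homotopy from \<open>h\<close> to the identity is built from the left. It may fail to vanish after the last
  differential, which is repaired by changing \<open>h\<close> in degree \<open>n\<close> by the square-zero map \<open>p d\<close>.
\<close>

lemma end_map_left_inverse:
  assumes "n \<ge> 1" "cplx n C X" "coexact n X" "end_chain_map n C X X h"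
  shows "\<exists>k. end_chain_map n C X X k \<and> homotopic n C X X (\<lambda>i. k i \<bullet> h i) (\<lambda>i. Id C (tm X i))"
proof -
  note X [simp] = cplxD[OF assms(2)] cplx_comp[OF assms(2)]
  have ch: "chain_map n C X X h" and h0 [simp]: "h 0 = Id C (tm X 0)"
    and hn [simp]: "h (Suc n) = Id C (tm X (Suc n))"
    using assms(4) by (auto simp: end_chain_map_def)
  note h [simp] = chain_mapD[OF ch]
  \<comment> \<open>The lowest component can be zero because \<open>h 0\<close> is the identity;
    every further component is a factorization through a weak cokernel.\<close>
  have ex: "\<exists>\<psi>. (\<forall>j \<le> m. \<psi> j \<in> homset C (tm X (Suc j)) (tm X j)) \<and>
      \<psi> 0 = mzero C (tm X 1) (tm X 0) \<and>
      (\<forall>j < m. h (Suc j) \<boxplus> \<boxminus> Id C (tm X (Suc j)) \<boxplus> \<boxminus> (df X j \<bullet> \<psi> j) = \<psi> (Suc j) \<bullet> df X (Suc j))"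
    if "m \<le> n" for m
    using that
  proof (induction m)
    case 0
    then show ?case
      by (intro exI[of _ "\<lambda>j. mzero C (tm X 1) (tm X 0)"]) (auto simp: homset_def)
  next
    case (Suc m)
    then obtain \<psi> where \<psi>: "\<And>j. j \<le> m \<Longrightarrow> \<psi> j \<in> homset C (tm X (Suc j)) (tm X j)"
      "\<psi> 0 = mzero C (tm X 1) (tm X 0)"
      "\<And>j. j < m \<Longrightarrow> h (Suc j) \<boxplus> \<boxminus> Id C (tm X (Suc j)) \<boxplus> \<boxminus> (df X j \<bullet> \<psi> j)
         = \<psi> (Suc j) \<bullet> df X (Suc j)"
      by force
    note \<psi>' = homsetD[OF \<psi>(1)]
    let ?u = "h (Suc m) \<boxplus> \<boxminus> Id C (tm X (Suc m)) \<boxplus> \<boxminus> (df X m \<bullet> \<psi> m)"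
    let ?v = "h m \<boxplus> \<boxminus> Id C (tm X m) \<boxplus> \<boxminus> (\<psi> m \<bullet> df X m)"
    \<comment> \<open>The chain map condition moves the differential to the left. There
      \<open>?v\<close> is zero in degree 0 and otherwise equals
      \<open>df X l \<bullet> \<psi> l\<close> by the previous stage, so the differential kills
      it.\<close>
    have "?u \<bullet> df X m = df X m \<bullet> ?v"
      using Suc.prems \<psi>' by simp
    also have "df X m \<bullet> ?v = mzero C (tm X m) (tm X (Suc m))"
    proof (cases m)
      case 0
      then show ?thesis using Suc.prems \<psi>(2) by simp
    next
      case (Suc l)
      have "h m \<boxplus> \<boxminus> Id C (tm X m) = (df X l \<bullet> \<psi> l) \<boxplus> (\<psi> m \<bullet> df X m)"
        using \<psi>(3)[of l] Suc Suc.prems \<psi>'[of l] \<psi>'[of m]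
          madd_left_cancel[of "\<boxminus> (df X l \<bullet> \<psi> l)" "h m \<boxplus> \<boxminus> Id C (tm X m)"
            "(df X l \<bullet> \<psi> l) \<boxplus> (\<psi> m \<bullet> df X m)"]
        by (simp add: madd_comm)
      then have "?v = df X l \<bullet> \<psi> l"
        using Suc Suc.prems \<psi>'[of l] \<psi>'[of m] by (simp del: comp_madd madd_assoc) simp
      then show ?thesis using Suc Suc.prems \<psi>'[of l] by simp
    qed
    finally obtain g where g: "g \<in> Ar C" "Dom C g = tm X (Suc (Suc m))" "Cod C g = tm X (Suc m)"
      "?u = g \<bullet> df X (Suc m)"
      using assms(3)[unfolded coexact_def, rule_format, of m ?u] Suc.prems \<psi>'[of m] by auto
    show ?case
      by (rule exI[of _ "\<psi>(Suc m := g)"])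
        (use \<psi> g in \<open>auto simp: homset_def le_Suc_eq less_Suc_eq\<close>)
  qed
  obtain \<psi> where \<psi>: "\<And>j. j \<le> n \<Longrightarrow> \<psi> j \<in> homset C (tm X (Suc j)) (tm X j)"
      "\<psi> 0 = mzero C (tm X 1) (tm X 0)"
      "\<And>j. j < n \<Longrightarrow> h (Suc j) \<boxplus> \<boxminus> Id C (tm X (Suc j)) \<boxplus> \<boxminus> (df X j \<bullet> \<psi> j)
         = \<psi> (Suc j) \<bullet> df X (Suc j)"
    using ex[of n] by blast
  note \<psi>' [simp] = homsetD[OF \<psi>(1)]
  obtain l where n: "n = Suc l" using assms(1) by (cases n) auto
  let ?p = "\<psi> n" and ?d = "df X n"
  have pd: "?p \<bullet> ?d = h n \<boxplus> (\<boxminus> Id C (tm X n) \<boxplus> \<boxminus> (df X l \<bullet> \<psi> l))"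
    using \<psi>(3)[of l] n by simp
  \<comment> \<open>As \<open>h (Suc n)\<close> is the identity, d h - d vanishes, and so does d p
    d. Nothing is known about d p itself, which a homotopy relative to the ends requires to be
    zero.\<close>
  have dpd: "?d \<bullet> (?p \<bullet> ?d) = mzero C (tm X n) (tm X (Suc n))"
  proof -
    have "?d \<bullet> h n = h (Suc n) \<bullet> ?d" using h(4)[of n] by simp
    also have "\<dots> = ?d" by (simp del: h(4))
    finally show ?thesis unfolding pd using n by simp
  qed
  have pdpd: "(?p \<bullet> ?d) \<bullet> (?p \<bullet> ?d) = mzero C (tm X n) (tm X n)"
    using dpd n by simp
  define k where "k = (\<lambda>i. if i = n then Id C (tm X n) \<boxplus> \<boxminus> (?p \<bullet> ?d) else Id C (tm X i))"
  have k: "chain_map n C X X k"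
  proof (rule chain_mapI)
    fix i assume "i \<le> n"
    moreover have "k (Suc l) \<bullet> df X l = df X l" using n by (simp add: k_def)
    moreover have "df X n \<bullet> k n = df X n" using dpd n by (simp add: k_def)
    ultimately show "k (Suc i) \<bullet> df X i = df X i \<bullet> k i"
      using n by (cases "i = n"; cases "i = l") (auto simp: k_def)
  qed (auto simp: k_def)
  have kn: "k n \<bullet> h n = Id C (tm X n) \<boxplus> (df X l \<bullet> \<psi> l)"
  proof -
    have hn: "h n = Id C (tm X n) \<boxplus> ((df X l \<bullet> \<psi> l) \<boxplus> (?p \<bullet> ?d))"
    proof -
      have "?p \<bullet> ?d = \<boxminus> (df X l \<bullet> \<psi> l) \<boxplus> (\<boxminus> Id C (tm X n) \<boxplus> h n)"
        unfolding pd using n by (simp add: madd_ac)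
      then show ?thesis using n by simp
    qed
    have "(?p \<bullet> ?d) \<bullet> h n = ?p \<bullet> ?d"
      unfolding hn using n pdpd by simp
    then have "k n \<bullet> h n = \<boxminus> (?p \<bullet> ?d) \<boxplus> h n"
      using n by (simp add: k_def madd_comm)
    moreover have "h n = (?p \<bullet> ?d) \<boxplus> (Id C (tm X n) \<boxplus> (df X l \<bullet> \<psi> l))"
      unfolding hn using n by (simp add: madd_ac)
    ultimately show ?thesis using n by simp
  qed
  show ?thesis
  proof (intro exI[of _ k] conjI)
    show "end_chain_map n C X X k" using k n by (simp add: end_chain_map_def k_def)
    have "homotopic n C X X (\<lambda>i. Id C (tm X i)) (\<lambda>i. k i \<bullet> h i)"
      unfolding homotopic_iff_null null_homotopic_def
    \<comment> \<open>After composition with \<open>k\<close>, the difference from the identity in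
      degree n is \<open>df X l \<bullet> \<psi> l\<close> alone. The top component can therefore be
      replaced by zero, and the condition at the last differential becomes trivial.\<close>
    proof (intro exI[of _ "\<psi>(n := mzero C (tm X (Suc n)) (tm X n))"] conjI allI impI)
      fix j assume j: "j < n"
      show "(k (Suc j) \<bullet> h (Suc j)) \<boxplus> \<boxminus> Id C (tm X (Suc j)) =
         (df X j \<bullet> (\<psi>(n := mzero C (tm X (Suc n)) (tm X n))) j) \<boxplus>
         ((\<psi>(n := mzero C (tm X (Suc n)) (tm X n))) (Suc j) \<bullet> df X (Suc j))"
      proof (cases "j = l")
        case True
        then show ?thesis using n kn by simp
      next
        case False
        have "(df X j \<bullet> \<psi> j) \<boxplus> (\<psi> (Suc j) \<bullet> df X (Suc j)) = h (Suc j) \<boxplus> \<boxminus> Id C (tm X (Suc j))"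
          unfolding \<psi>(3)[OF j, symmetric] using j n by (simp del: madd_assoc)
        then show ?thesis using False j n by (simp add: k_def)
      qed
    qed (use n \<psi>(2) in \<open>auto simp: homset_def\<close>)
    then show "homotopic n C X X (\<lambda>i. k i \<bullet> h i) (\<lambda>i. Id C (tm X i))"
      by (rule homotopic_sym)
        (use chain_map_comp[OF ch k] chain_map_Id assms(2) in auto)
  qed
qed

text \<open>The endomorphism g f has a left inverse k up to homotopy, and then k g is one for
  f.\<close>

lemma end_maps_left_inverse:
  assumes "n \<ge> 1" "cplx n C X" "cplx n C Y" "coexact n X"
    "end_chain_map n C X Y f" "end_chain_map n C Y X g"
  shows "\<exists>k. end_chain_map n C Y X k \<and> homotopic n C X X (\<lambda>i. k i \<bullet> f i) (\<lambda>i. Id C (tm X i))"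
proof -
  obtain k where k: "end_chain_map n C X X k"
    "homotopic n C X X (\<lambda>i. k i \<bullet> (g i \<bullet> f i)) (\<lambda>i. Id C (tm X i))"
    using end_map_left_inverse[OF assms(1,2,4) end_chain_map_comp[OF assms(5,6,2,3,2)]] by blast
  have "chain_map n C X X k" "chain_map n C X Y f" "chain_map n C Y X g"
    using k assms by (auto simp: end_chain_map_def)
  note [simp] = chain_mapD[OF this(1)] chain_mapD[OF this(2)] chain_mapD[OF this(3)]
  have "homotopic n C X X (\<lambda>i. (k i \<bullet> g i) \<bullet> f i) (\<lambda>i. Id C (tm X i))"
    by (rule homotopic_cong[OF k(2)]) simp_all
  then show ?thesis using end_chain_map_comp[OF assms(6) k(1) assms(3,2,2)] by blast
qed

text \<open>A left inverse k of f has itself a left inverse j. Both f and j are homotopic to j k f,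
  so f k is homotopic to j k and thus to the identity.\<close>

lemma homotopy_equivI:
  assumes "n \<ge> 1" "cplx n C X" "cplx n C Y" "coexact n X" "coexact n Y"
    "end_chain_map n C X Y f" "end_chain_map n C Y X g"
  shows "homotopy_equiv n C X Y"
proof -
  obtain k where k: "end_chain_map n C Y X k"
    "homotopic n C X X (\<lambda>i. k i \<bullet> f i) (\<lambda>i. Id C (tm X i))"
    using end_maps_left_inverse[OF assms(1,2,3,4,6,7)] by blast
  obtain j where j: "end_chain_map n C X Y j"
    "homotopic n C Y Y (\<lambda>i. j i \<bullet> k i) (\<lambda>i. Id C (tm Y i))"
    using end_maps_left_inverse[OF assms(1,3,2,5) k(1) assms(6)] by blast
  have c: "chain_map n C Y X k" "chain_map n C X Y j" "chain_map n C X Y f"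
    using k j assms by (auto simp: end_chain_map_def)
  note [simp] = chain_mapD[OF c(1)] chain_mapD[OF c(2)] chain_mapD[OF c(3)]
  note X = assms(2) and Y = assms(3)
  have kf: "chain_map n C X X (\<lambda>i. k i \<bullet> f i)" and jk: "chain_map n C Y Y (\<lambda>i. j i \<bullet> k i)"
    and fk: "chain_map n C Y Y (\<lambda>i. f i \<bullet> k i)"
    using chain_map_comp c X Y by blast+
  have jkf: "chain_map n C X Y (\<lambda>i. j i \<bullet> (k i \<bullet> f i))"
    using chain_map_comp[OF kf c(2) X X Y] .
  have "homotopic n C X Y (\<lambda>i. j i \<bullet> (k i \<bullet> f i)) (\<lambda>i. j i \<bullet> Id C (tm X i))"
    by (rule homotopic_comp_left[OF k(2) c(2) kf chain_map_Id[OF X] X X Y])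
  then have 1: "homotopic n C X Y (\<lambda>i. j i \<bullet> (k i \<bullet> f i)) j"
    by (rule homotopic_cong) simp_all
  have "homotopic n C X Y (\<lambda>i. (j i \<bullet> k i) \<bullet> f i) (\<lambda>i. Id C (tm Y i) \<bullet> f i)"
    by (rule homotopic_comp_right[OF j(2) c(3) jk chain_map_Id[OF Y] X Y Y])
  then have 2: "homotopic n C X Y (\<lambda>i. j i \<bullet> (k i \<bullet> f i)) f"
    by (rule homotopic_cong) simp_all
  have "homotopic n C X Y f j"
    by (rule homotopic_trans[OF homotopic_sym[OF 2 jkf c(3) X Y] 1 c(3) jkf c(2) X Y])
  then have "homotopic n C Y Y (\<lambda>i. f i \<bullet> k i) (\<lambda>i. j i \<bullet> k i)"
    by (rule homotopic_comp_right[OF _ c(1,3,2) Y X Y])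
  then have "homotopic n C Y Y (\<lambda>i. f i \<bullet> k i) (\<lambda>i. Id C (tm Y i))"
    by (rule homotopic_trans[OF _ j(2) fk jk chain_map_Id[OF Y] Y Y])
  then show ?thesis unfolding homotopy_equiv_def using assms(6) k by blast
qed

end

section \<open>Distinguished exangles\<close>

context additive_bifunctor
begin

section \<open>Calculus of extensions under pull-back and push-forward\<close>

lemma EMor_ext [simp]:
  assumes "c \<in> Ar C" "a \<in> Ar C" "Dom C c = Y'" "Cod C a = A'" "\<delta> \<in> ext E (Cod C c) (Dom C a)"
  shows "EMor E c a \<delta> \<in> ext E Y' A'"
  using EMor_hom[of c "Dom C c" "Cod C c" a "Dom C a" "Cod C a"] assms
  by (auto simp: homset_def hom_def)

lemma EMor_EMor [simp]:
  assumes "c \<in> Ar C" "a \<in> Ar C" "c' \<in> Ar C" "a' \<in> Ar C" "\<delta> \<in> ext E (Cod C c) (Dom C a)"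
    "Cod C c' = Dom C c" "Cod C a = Dom C a'"
  shows "EMor E c' a' (EMor E c a \<delta>) = EMor E (c \<bullet> c') (a' \<bullet> a) \<delta>"
  using EMor_comp[of c "Dom C c" "Cod C c" c' "Dom C c'" a "Dom C a" "Cod C a" a' "Cod C a'"] assms
  by (auto simp: homset_def)

lemma EMor_Id [simp]:
  "Y \<in> Ob C \<Longrightarrow> A \<in> Ob C \<Longrightarrow> \<delta> \<in> ext E Y A \<Longrightarrow> EMor E (Id C Y) (Id C A) \<delta> = \<delta>"
  by (rule EMor_id)

lemma ext_group_simps [simp]:
  assumes "Y \<in> Ob C" "A \<in> Ob C"
  shows "ext_zero E Y A \<in> ext E Y A"
    "\<delta> \<in> ext E Y A \<Longrightarrow> \<rho> \<in> ext E Y A \<Longrightarrow> \<delta> \<otimes>\<^bsub>EOb E Y A\<^esub> \<rho> \<in> ext E Y A"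
    "\<delta> \<in> ext E Y A \<Longrightarrow> \<delta> \<otimes>\<^bsub>EOb E Y A\<^esub> ext_zero E Y A = \<delta>"
    "\<delta> \<in> ext E Y A \<Longrightarrow> ext_zero E Y A \<otimes>\<^bsub>EOb E Y A\<^esub> \<delta> = \<delta>"
proof -
  interpret G: comm_group "EOb E Y A" using ext_comm_group assms by blast
  show "ext_zero E Y A \<in> ext E Y A"
    "\<delta> \<in> ext E Y A \<Longrightarrow> \<rho> \<in> ext E Y A \<Longrightarrow> \<delta> \<otimes>\<^bsub>EOb E Y A\<^esub> \<rho> \<in> ext E Y A"
    "\<delta> \<in> ext E Y A \<Longrightarrow> \<delta> \<otimes>\<^bsub>EOb E Y A\<^esub> ext_zero E Y A = \<delta>"
    "\<delta> \<in> ext E Y A \<Longrightarrow> ext_zero E Y A \<otimes>\<^bsub>EOb E Y A\<^esub> \<delta> = \<delta>"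
    by simp_all
qed

lemma EMor_mult [simp]:
  assumes "c \<in> Ar C" "a \<in> Ar C" "Cod C c = Y" "Dom C a = A" "\<delta> \<in> ext E Y A" "\<rho> \<in> ext E Y A"
  shows "EMor E c a (\<delta> \<otimes>\<^bsub>EOb E Y A\<^esub> \<rho>) = EMor E c a \<delta> \<otimes>\<^bsub>EOb E (Dom C c) (Cod C a)\<^esub> EMor E c a \<rho>"
  using EMor_hom[of c "Dom C c" "Cod C c" a "Dom C a" "Cod C a"] assms
  by (auto simp: homset_def hom_def)

lemma EMor_one [simp]:
  assumes "c \<in> Ar C" "a \<in> Ar C" "Cod C c = Y" "Dom C a = A"
  shows "EMor E c a (ext_zero E Y A) = ext_zero E (Dom C c) (Cod C a)"
proof -
  interpret G: comm_group "EOb E Y A" using ext_comm_group assms by auto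
  interpret H: comm_group "EOb E (Dom C c) (Cod C a)" using ext_comm_group assms by auto
  have "EMor E c a \<in> hom (EOb E Y A) (EOb E (Dom C c) (Cod C a))"
    using EMor_hom[of c "Dom C c" "Cod C c" a "Dom C a" "Cod C a"] assms by (auto simp: homset_def)
  then show ?thesis by (rule hom_one) (simp_all add: G.is_group H.is_group)
qed

lemma EMor_madd_left:
  assumes "c \<in> Ar C" "c' \<in> Ar C" "a \<in> Ar C" "Dom C c = Dom C c'" "Cod C c = Cod C c'"
    "\<delta> \<in> ext E (Cod C c') (Dom C a)"
  shows "EMor E (c \<boxplus> c') a \<delta> = EMor E c a \<delta> \<otimes>\<^bsub>EOb E (Dom C c') (Cod C a)\<^esub> EMor E c' a \<delta>"
  using EMor_add_left[of c "Dom C c" "Cod C c" c' a "Dom C a" "Cod C a" \<delta>] assms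
  by (auto simp: homset_def)

lemma EMor_madd_right:
  assumes "c \<in> Ar C" "a \<in> Ar C" "a' \<in> Ar C" "Dom C a = Dom C a'" "Cod C a = Cod C a'"
    "\<delta> \<in> ext E (Cod C c) (Dom C a')"
  shows "EMor E c (a \<boxplus> a') \<delta> = EMor E c a \<delta> \<otimes>\<^bsub>EOb E (Dom C c) (Cod C a')\<^esub> EMor E c a' \<delta>"
  using EMor_add_right[of c "Dom C c" "Cod C c" a "Dom C a" "Cod C a" a' \<delta>] assms
  by (auto simp: homset_def)

lemma EMor_mzero_left [simp]:
  assumes "a \<in> Ar C" "Y' \<in> Ob C" "Y \<in> Ob C" "\<delta> \<in> ext E Y (Dom C a)"
  shows "EMor E (mzero C Y' Y) a \<delta> = ext_zero E Y' (Cod C a)"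
proof -
  interpret G: comm_group "EOb E Y' (Cod C a)" using ext_comm_group assms by auto
  let ?e = "EMor E (mzero C Y' Y) a \<delta>"
  have "?e \<otimes>\<^bsub>EOb E Y' (Cod C a)\<^esub> ?e = ?e"
    using EMor_madd_left[of "mzero C Y' Y" "mzero C Y' Y" a \<delta>] assms by simp
  moreover have "?e \<in> ext E Y' (Cod C a)" using assms by simp
  ultimately show ?thesis using G.l_cancel_one by blast
qed

lemma EMor_mzero_right [simp]:
  assumes "c \<in> Ar C" "A \<in> Ob C" "A' \<in> Ob C" "\<delta> \<in> ext E (Cod C c) A"
  shows "EMor E c (mzero C A A') \<delta> = ext_zero E (Dom C c) A'"
proof -
  interpret G: comm_group "EOb E (Dom C c) A'" using ext_comm_group assms by auto
  let ?e = "EMor E c (mzero C A A') \<delta>"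
  have "?e \<otimes>\<^bsub>EOb E (Dom C c) A'\<^esub> ?e = ?e"
    using EMor_madd_right[of c "mzero C A A'" "mzero C A A'" \<delta>] assms by simp
  moreover have "?e \<in> ext E (Dom C c) A'" using assms by simp
  ultimately show ?thesis using G.l_cancel_one by blast
qed

text \<open>Additivity reduces a comparison of two pull-backs to the vanishing of one, which is the
  form in which exactness can be applied.\<close>

lemma ext_eq_iff:
  assumes "c \<in> Ar C" "c' \<in> Ar C" "a \<in> Ar C" "Dom C c = Dom C c'" "Cod C c = Cod C c'"
    "\<delta> \<in> ext E (Cod C c') (Dom C a)"
  shows "EMor E (c \<boxplus> \<boxminus> c') a \<delta> = ext_zero E (Dom C c') (Cod C a) \<longleftrightarrow> EMor E c a \<delta> = EMor E c' a \<delta>"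
proof -
  interpret G: comm_group "EOb E (Dom C c') (Cod C a)" using ext_comm_group assms by auto
  have m: "EMor E c' a \<delta> \<otimes>\<^bsub>EOb E (Dom C c') (Cod C a)\<^esub> EMor E (\<boxminus> c') a \<delta> = \<one>\<^bsub>EOb E (Dom C c') (Cod C a)\<^esub>"
    using EMor_madd_left[of "c'" "\<boxminus> c'" a \<delta>] assms by simp
  have "EMor E (c \<boxplus> \<boxminus> c') a \<delta> = EMor E c a \<delta> \<otimes>\<^bsub>EOb E (Dom C c') (Cod C a)\<^esub> EMor E (\<boxminus> c') a \<delta>"
    using EMor_madd_left[of c "\<boxminus> c'" a \<delta>] assms by simp
  moreover have "EMor E c a \<delta> \<in> ext E (Dom C c') (Cod C a)" "EMor E c' a \<delta> \<in> ext E (Dom C c') (Cod C a)"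
    "EMor E (\<boxminus> c') a \<delta> \<in> ext E (Dom C c') (Cod C a)"
    using assms by auto
  ultimately show ?thesis using m by (metis G.right_cancel)
qed

lemma ext_eq_iff_right:
  assumes "c \<in> Ar C" "a' \<in> Ar C" "a \<in> Ar C" "Dom C a = Dom C a'" "Cod C a = Cod C a'"
    "\<delta> \<in> ext E (Cod C c) (Dom C a')"
  shows "EMor E c (a \<boxplus> \<boxminus> a') \<delta> = ext_zero E (Dom C c) (Cod C a') \<longleftrightarrow> EMor E c a \<delta> = EMor E c a' \<delta>"
proof -
  interpret G: comm_group "EOb E (Dom C c) (Cod C a')" using ext_comm_group assms by auto
  have m: "EMor E c a' \<delta> \<otimes>\<^bsub>EOb E (Dom C c) (Cod C a')\<^esub> EMor E c (\<boxminus> a') \<delta> = \<one>\<^bsub>EOb E (Dom C c) (Cod C a')\<^esub>"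
    using EMor_madd_right[of c "a'" "\<boxminus> a'" \<delta>] assms by simp
  have "EMor E c (a \<boxplus> \<boxminus> a') \<delta> = EMor E c a \<delta> \<otimes>\<^bsub>EOb E (Dom C c) (Cod C a')\<^esub> EMor E c (\<boxminus> a') \<delta>"
    using EMor_madd_right[of c a "\<boxminus> a'" \<delta>] assms by simp
  moreover have "EMor E c a \<delta> \<in> ext E (Dom C c) (Cod C a')" "EMor E c a' \<delta> \<in> ext E (Dom C c) (Cod C a')"
    "EMor E c (\<boxminus> a') \<delta> \<in> ext E (Dom C c) (Cod C a')"
    using assms by auto
  ultimately show ?thesis using m by (metis G.right_cancel)
qed

text \<open>Both sides are inverse to \<open>EMor E c a \<delta>\<close>. Signs may thus pass
  between the two arguments of an extension.\<close>

lemma EMor_mneg_swap: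
  assumes "c \<in> Ar C" "a \<in> Ar C" "\<delta> \<in> ext E (Cod C c) (Dom C a)"
  shows "EMor E c (\<boxminus> a) \<delta> = EMor E (\<boxminus> c) a \<delta>"
proof -
  interpret G: comm_group "EOb E (Dom C c) (Cod C a)" using ext_comm_group assms by auto
  have "EMor E c a \<delta> \<otimes>\<^bsub>EOb E (Dom C c) (Cod C a)\<^esub> EMor E (\<boxminus> c) a \<delta> = \<one>\<^bsub>EOb E (Dom C c) (Cod C a)\<^esub>"
    using EMor_madd_left[of c "\<boxminus> c" a \<delta>] assms by simp
  moreover have "EMor E c a \<delta> \<otimes>\<^bsub>EOb E (Dom C c) (Cod C a)\<^esub> EMor E c (\<boxminus> a) \<delta> = \<one>\<^bsub>EOb E (Dom C c) (Cod C a)\<^esub>"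
    using EMor_madd_right[of c a "\<boxminus> a" \<delta>] assms by simp
  moreover have "EMor E c a \<delta> \<in> ext E (Dom C c) (Cod C a)"
    "EMor E (\<boxminus> c) a \<delta> \<in> ext E (Dom C c) (Cod C a)" "EMor E c (\<boxminus> a) \<delta> \<in> ext E (Dom C c) (Cod C a)"
    using assms by auto
  ultimately show ?thesis by (metis G.right_cancel G.m_comm)
qed

end

section \<open>Distinguished exangles: exactness, transfer, retracts and sums\<close>

locale positive_exact_realization = exact_realization C E n s
  for C :: "('o, 'm) cat" (structure) and E :: "('o, 'm, 'e) bifun"
    and n :: nat and s :: "('o, 'm, 'e) realiz" +
  assumes n_pos: "n \<ge> 1"
begin

abbreviation dist where "dist X \<delta> \<equiv> distinguished n C E s X \<delta>"

lemma distinguishedD: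
  assumes "dist X \<delta>"
  shows "cplx n C X" "\<delta> \<in> ext E (tm X (Suc n)) (tm X 0)"
  using assms by (auto simp: distinguished_def)

lemma distinguished_coexact:
  assumes "dist X \<delta>"
  shows "coexact n X"
  unfolding coexact_def
proof (intro allI ballI impI)
  fix j f assume j: "j < n" "f \<in> Ar C" "Dom C f = tm X (Suc j)" "f \<bullet> df X j = mzero C (tm X j) (Cod C f)"
  have "f \<in> {f' \<in> homset C (tm X (Suc j)) (Cod C f). f' \<bullet> df X (Suc j - 1) = mzero C (tm X (Suc j - 1)) (Cod C f)}"
    using j by (simp add: homset_def)
  also have "\<dots> = (\<lambda>g. g \<bullet> df X (Suc j)) ` homset C (tm X (Suc j + 1)) (Cod C f)"
  proof -
    have "\<forall>i \<in> {1..n}. {f' \<in> homset C (tm X i) (Cod C f). f' \<bullet> df X (i - 1) = mzero C (tm X (i - 1)) (Cod C f)} =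
           (\<lambda>g. g \<bullet> df X i) ` homset C (tm X (i + 1)) (Cod C f)"
      using R1[OF assms] j(2) cod_ob[of f] unfolding exangle_def by blast
    from bspec[OF this, of "Suc j"] show ?thesis using j(1) by simp
  qed
  finally show "\<exists>g\<in>Ar C. Dom C g = tm X (Suc (Suc j)) \<and> Cod C g = Cod C f \<and> f = g \<bullet> df X (Suc j)"
    by (auto simp: homset_def)
qed

lemma distinguished_pull_exact:
  assumes "dist X \<delta>" "f \<in> Ar C" "Cod C f = tm X (Suc n)"
    "EMor E f (Id C (tm X 0)) \<delta> = ext_zero E (Dom C f) (tm X 0)"
  obtains g where "g \<in> Ar C" "Dom C g = Dom C f" "Cod C g = tm X n" "f = df X n \<bullet> g"
proof -
  have "f \<in> {f' \<in> homset C (Dom C f) (tm X (n + 1)). pull C E f' (tm X 0) \<delta> = ext_zero E (Dom C f) (tm X 0)}"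
    using assms by (simp add: homset_def pull_def)
  also have "\<dots> = (\<lambda>g. df X n \<bullet> g) ` homset C (Dom C f) (tm X n)"
    using R1[OF assms(1)] assms(2) unfolding exangle_def by (simp only: dom_cod_ob)
  finally show ?thesis using that by (auto simp: homset_def)
qed

lemma distinguished_push_exact:
  assumes "dist X \<delta>" "f \<in> Ar C" "Dom C f = tm X 0"
    "EMor E (Id C (tm X (Suc n))) f \<delta> = ext_zero E (tm X (Suc n)) (Cod C f)"
  obtains g where "g \<in> Ar C" "Dom C g = tm X 1" "Cod C g = Cod C f" "f = g \<bullet> df X 0"
proof -
  have "f \<in> {f' \<in> homset C (tm X 0) (Cod C f). push C E (tm X (n + 1)) f' \<delta> = ext_zero E (tm X (n + 1)) (Cod C f)}"
    using assms by (simp add: homset_def push_def)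
  also have "\<dots> = (\<lambda>g. g \<bullet> df X 0) ` homset C (tm X 1) (Cod C f)"
    using R1[OF assms(1)] assms(2) unfolding exangle_def by (simp only: dom_cod_ob)
  finally show ?thesis using that by (auto simp: homset_def)
qed

lemma distinguished_push_zero:
  assumes "dist X \<delta>" "c \<in> Ar C" "Cod C c = tm X (Suc n)" "a \<in> Ar C" "Dom C a = tm X 1"
  shows "EMor E c (df X 0) \<delta> = ext_zero E (Dom C c) (tm X 1)"
    "EMor E c (a \<bullet> df X 0) \<delta> = ext_zero E (Dom C c) (Cod C a)"
proof -
  note X [simp] = distinguishedD[OF assms(1)] cplxD[OF distinguishedD(1)[OF assms(1)]]
  have 1: "EMor E (Id C (tm X (Suc n))) (df X 0) \<delta> = ext_zero E (tm X (Suc n)) (tm X 1)"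
    using R1[OF assms(1)] by (simp add: exangle_def push_def)
  show "EMor E c (df X 0) \<delta> = ext_zero E (Dom C c) (tm X 1)"
    using arg_cong[OF 1, of "EMor E c (Id C (tm X 1))"] assms by simp
  show "EMor E c (a \<bullet> df X 0) \<delta> = ext_zero E (Dom C c) (Cod C a)"
    using arg_cong[OF 1, of "EMor E c a"] assms by simp
qed

lemma distinguished_pull_zero:
  assumes "dist X \<delta>" "a \<in> Ar C" "Dom C a = tm X 0" "c \<in> Ar C" "Cod C c = tm X n"
  shows "EMor E (df X n) a \<delta> = ext_zero E (tm X n) (Cod C a)"
    "EMor E (df X n \<bullet> c) a \<delta> = ext_zero E (Dom C c) (Cod C a)"
proof -
  note X [simp] = distinguishedD[OF assms(1)] cplxD[OF distinguishedD(1)[OF assms(1)]]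
  have 1: "EMor E (df X n) (Id C (tm X 0)) \<delta> = ext_zero E (tm X n) (tm X 0)"
    using R1[OF assms(1)] by (simp add: exangle_def pull_def)
  show "EMor E (df X n) a \<delta> = ext_zero E (tm X n) (Cod C a)"
    using arg_cong[OF 1, of "EMor E (Id C (tm X n)) a"] assms by simp
  show "EMor E (df X n \<bullet> c) a \<delta> = ext_zero E (Dom C c) (Cod C a)"
    using arg_cong[OF 1, of "EMor E c a"] assms by simp
qed

lemma realization:
  assumes "D \<in> Ob C" "A \<in> Ob C" "\<delta> \<in> ext E D A"
  obtains X where "dist X \<delta>" "tm X 0 = A" "tm X (Suc n) = D"
  using realized[OF assms] assms(3) by (auto simp: distinguished_def)

lemma lift:
  assumes "dist X \<delta>" "dist Y \<rho>" "a \<in> Ar C" "Dom C a = tm X 0" "Cod C a = tm Y 0"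
    "c \<in> Ar C" "Dom C c = tm X (Suc n)" "Cod C c = tm Y (Suc n)"
    "EMor E (Id C (tm X (Suc n))) a \<delta> = EMor E c (Id C (tm Y 0)) \<rho>"
  obtains f where "chain_map n C X Y f" "f 0 = a" "f (Suc n) = c"
  using R0[OF assms(1,2), of a c] assms(3-)
  by (auto simp: ext_morphism_def homset_def push_def pull_def)

text \<open>Both complexes have weak cokernels, so \<open>homotopy_equivI\<close> makes them
  homotopy equivalent from one end-preserving map in each direction, and \<open>s\<close> sees only
  the homotopy class.\<close>

lemma distinguished_transfer:
  assumes "dist W \<delta>" "cplx n C Y" "coexact n Y" "end_chain_map n C W Y f" "end_chain_map n C Y W g"
  shows "dist Y \<delta>"
proof -
  have W: "cplx n C W" using distinguishedD[OF assms(1)] by simp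
  have "hclass n C W = hclass n C Y"
    by (rule hclass_eq[OF homotopy_equivI[OF n_pos W assms(2) distinguished_coexact[OF assms(1)] assms(3-5)]
      W assms(2)])
  then show ?thesis using assms by (simp add: distinguished_def end_chain_map_def)
qed

text \<open>Let W realize \<rho>. The conditions on the ends say that the outer components of i and
  p are morphisms of extensions, so they lift to maps between W and Z. Composing these with p and i
  gives maps between W and Y whose ends are p i, that is, identities.\<close>

lemma distinguished_retract:
  assumes "dist Z \<zeta>"
    and Y: "\<And>k. k \<le> n \<Longrightarrow> df Y k \<in> Ar C \<and> Dom C (df Y k) = tm Y k \<and> Cod C (df Y k) = tm Y (Suc k)"
    and i: "chain_map n C Y Z i" and p: "chain_map n C Z Y p"
    and pi: "\<And>k. k \<le> Suc n \<Longrightarrow> p k \<bullet> i k = Id C (tm Y k)"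
    and \<rho>: "\<rho> \<in> ext E (tm Y (Suc n)) (tm Y 0)"
    and e: "EMor E (Id C (tm Y (Suc n))) (i 0) \<rho> = EMor E (i (Suc n)) (Id C (tm Z 0)) \<zeta>"
      "EMor E (Id C (tm Z (Suc n))) (p 0) \<zeta> = EMor E (p (Suc n)) (Id C (tm Y 0)) \<rho>"
  shows "dist Y \<rho>"
proof -
  note Z [simp] = distinguishedD[OF assms(1)] cplxD[OF distinguishedD(1)[OF assms(1)]]
    cplx_comp[OF distinguishedD(1)[OF assms(1)]]
  note ip [simp] = chain_mapD(1-3)[OF i] chain_mapD(1-3)[OF p] pi
  note Y' [simp] = Y[THEN conjunct1] Y[THEN conjunct2, THEN conjunct1] Y[THEN conjunct2, THEN conjunct2]
  have Ob: "tm Y k \<in> Ob C" if "k \<le> Suc n" for k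
    using dom_ob[of "i k"] that by simp
  note [simp] = Ob
  have p_comm: "df Y k \<bullet> (p k \<bullet> u) = p (Suc k) \<bullet> (df Z k \<bullet> u)"
    if "k \<le> n" "u \<in> Ar C" "Cod C u = tm Z k" for k u
    by (rule comp_reassoc[OF chain_mapD(4)[OF p, symmetric]]) (use that in simp_all)
  have Yc: "cplx n C Y"
    unfolding cplx_def
  proof (intro conjI allI impI)
    fix k assume k: "k < n"
    \<comment> \<open>Inserting \<open>p k \<bullet> i k\<close> carries both differentials over to
      Z, where they compose to zero.\<close>
    have "df Y (Suc k) \<bullet> df Y k = df Y (Suc k) \<bullet> (df Y k \<bullet> (p k \<bullet> i k))" using k by simp
    also have "\<dots> = mzero C (tm Y k) (tm Y (Suc (Suc k)))"
      using k by (simp add: p_comm del: pi)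
    finally show "df Y (k + 1) \<bullet> df Y k = mzero C (tm Y k) (tm Y (k + 2))" by simp
  qed (use Ob in \<open>auto simp: homset_def\<close>)
  note [simp] = Ob chain_map_comp'[OF i Yc Z(1)] chain_map_comp'[OF p Z(1) Yc]
  have Yx: "coexact n Y"
    unfolding coexact_def
  proof (intro allI ballI impI)
    fix j f assume j: "j < n" "f \<in> Ar C" "Dom C f = tm Y (Suc j)" "f \<bullet> df Y j = mzero C (tm Y j) (Cod C f)"
    note [simp] = j(2,3)
    have "(f \<bullet> p (Suc j)) \<bullet> df Z j = (f \<bullet> df Y j) \<bullet> p j"
      using chain_mapD(4)[OF p, of j] j(1) by simp
    also have "\<dots> = mzero C (tm Z j) (Cod C f)" using j(1) by (simp add: j(4) del: assoc)
    finally obtain g where g: "g \<in> Ar C" "Dom C g = tm Z (Suc (Suc j))" "Cod C g = Cod C f"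
      "f \<bullet> p (Suc j) = g \<bullet> df Z (Suc j)"
      using distinguished_coexact[OF assms(1), unfolded coexact_def, rule_format, of j "f \<bullet> p (Suc j)"]
      using j(1) by auto
    have "f = (f \<bullet> p (Suc j)) \<bullet> i (Suc j)" using j(1) by simp
    also have "\<dots> = (g \<bullet> i (Suc (Suc j))) \<bullet> df Y (Suc j)"
      using g chain_mapD(4)[OF i, of "Suc j"] j(1) by simp
    finally have "f = (g \<bullet> i (Suc (Suc j))) \<bullet> df Y (Suc j)" .
    moreover have "g \<bullet> i (Suc (Suc j)) \<in> Ar C" "Dom C (g \<bullet> i (Suc (Suc j))) = tm Y (Suc (Suc j))"
      "Cod C (g \<bullet> i (Suc (Suc j))) = Cod C f"
      using g(1-3) j(1) by simp_all
    ultimately show "\<exists>g\<in>Ar C. Dom C g = tm Y (Suc (Suc j)) \<and> Cod C g = Cod C f \<and> f = g \<bullet> df Y (Suc j)"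
      by blast
  qed
  obtain W where W: "dist W \<rho>" "tm W 0 = tm Y 0" "tm W (Suc n) = tm Y (Suc n)"
    using realization[OF Ob Ob \<rho>] by auto
  note [simp] = W(2,3)
  obtain u where u: "chain_map n C W Z u" "u 0 = i 0" "u (Suc n) = i (Suc n)"
    by (rule lift[OF W(1) assms(1), of "i 0" "i (Suc n)"]) (use e in auto)
  obtain v where v: "chain_map n C Z W v" "v 0 = p 0" "v (Suc n) = p (Suc n)"
    by (rule lift[OF assms(1) W(1), of "p 0" "p (Suc n)"]) (use e in auto)
  have "end_chain_map n C W Y (\<lambda>k. p k \<bullet> u k)" "end_chain_map n C Y W (\<lambda>k. v k \<bullet> i k)"
    using chain_map_comp[OF u(1) p] chain_map_comp[OF i v(1)] u v distinguishedD[OF W(1)] Yc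
    by (auto simp: end_chain_map_def)
  then show ?thesis by (rule distinguished_transfer[OF W(1) Yc Yx])
qed

text \<open>An inverse in each degree is automatically a chain map, and the ends of the isomorphism
  dictate the transported extension. The target need not be known to be a complex beforehand, so
  this serves to simplify cones and cocones.\<close>

lemma distinguished_iso:
  assumes "dist Z \<zeta>"
    and Y: "\<And>k. k \<le> n \<Longrightarrow> df Y k \<in> Ar C \<and> Dom C (df Y k) = tm Y k \<and> Cod C (df Y k) = tm Y (Suc k)"
    and p: "chain_map n C Z Y p"
    and i: "\<And>k. k \<le> Suc n \<Longrightarrow> i k \<in> Ar C \<and> Dom C (i k) = tm Y k \<and> Cod C (i k) = tm Z k \<and>
      p k \<bullet> i k = Id C (tm Y k) \<and> i k \<bullet> p k = Id C (tm Z k)"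
  shows "dist Y (EMor E (i (Suc n)) (p 0) \<zeta>)"
proof -
  note Z [simp] = distinguishedD[OF assms(1)] cplxD[OF distinguishedD(1)[OF assms(1)]]
  have i' [simp]: "i k \<in> Ar C" "Dom C (i k) = tm Y k" "Cod C (i k) = tm Z k"
    "p k \<bullet> i k = Id C (tm Y k)" "i k \<bullet> p k = Id C (tm Z k)" if "k \<le> Suc n" for k
    using i[OF that] by auto
  note p' [simp] = chain_mapD(1-3)[OF p]
  note Y' [simp] = Y[THEN conjunct1] Y[THEN conjunct2, THEN conjunct1] Y[THEN conjunct2, THEN conjunct2]
  have Ob [simp]: "tm Y k \<in> Ob C" if "k \<le> Suc n" for k
    using dom_ob[of "i k"] that by simp
  have ch: "chain_map n C Y Z i"
  proof (rule chain_mapI)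
    fix k assume k: "k \<le> n"
    have "i (Suc k) \<bullet> df Y k = i (Suc k) \<bullet> ((df Y k \<bullet> p k) \<bullet> i k)"
      using k by simp
    also have "\<dots> = (i (Suc k) \<bullet> p (Suc k)) \<bullet> (df Z k \<bullet> i k)"
      using k by (subst chain_mapD(4)[OF p, symmetric]) (simp_all del: i'(5))
    finally show "i (Suc k) \<bullet> df Y k = df Z k \<bullet> i k" using k by simp
  qed simp
  show ?thesis
    by (rule distinguished_retract[OF assms(1) Y ch p]) simp_all
qed

lemma distinguished_cong:
  assumes "dist Z \<zeta>" "\<And>k. k \<le> Suc n \<Longrightarrow> tm Y k = tm Z k" "\<And>k. k \<le> n \<Longrightarrow> df Y k = df Z k"
  shows "dist Y \<zeta>"
proof -
  note [simp] = distinguishedD[OF assms(1)] cplxD[OF distinguishedD(1)[OF assms(1)]] assms(2,3)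
  have "dist Y (EMor E (Id C (tm Z (Suc n))) (Id C (tm Z 0)) \<zeta>)"
    by (rule distinguished_iso[OF assms(1), where p = "\<lambda>k. Id C (tm Z k)"])
      (auto intro!: chain_mapI)
  then show ?thesis by simp
qed

text \<open>The decomposition is internal, given by inclusions and projections, so that the terms of
  Z may differ from the chosen \<open>dsum\<close>. The orthogonality relations concern the outer
  degrees, where they make these maps morphisms of extensions; inside, it is enough that the two
  composites add up to the identity.\<close>

lemma distinguished_sum:
  assumes "dist X \<delta>" "dist Y \<rho>"
    and Z: "\<And>k. k \<le> n \<Longrightarrow> df Z k \<in> Ar C \<and> Dom C (df Z k) = tm Z k \<and> Cod C (df Z k) = tm Z (Suc k)"
    and i: "chain_map n C X Z i" and j: "chain_map n C Y Z j"
    and p: "chain_map n C Z X p" and q: "chain_map n C Z Y q"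
    and sum: "\<And>k. k \<le> Suc n \<Longrightarrow> (i k \<bullet> p k) \<boxplus> (j k \<bullet> q k) = Id C (tm Z k)"
    and ends: "p 0 \<bullet> i 0 = Id C (tm X 0)" "q 0 \<bullet> j 0 = Id C (tm Y 0)"
      "p 0 \<bullet> j 0 = mzero C (tm Y 0) (tm X 0)" "q 0 \<bullet> i 0 = mzero C (tm X 0) (tm Y 0)"
      "p (Suc n) \<bullet> i (Suc n) = Id C (tm X (Suc n))" "q (Suc n) \<bullet> j (Suc n) = Id C (tm Y (Suc n))"
      "p (Suc n) \<bullet> j (Suc n) = mzero C (tm Y (Suc n)) (tm X (Suc n))"
      "q (Suc n) \<bullet> i (Suc n) = mzero C (tm X (Suc n)) (tm Y (Suc n))"
  shows "dist Z (EMor E (p (Suc n)) (i 0) \<delta> \<otimes>\<^bsub>EOb E (tm Z (Suc n)) (tm Z 0)\<^esub> EMor E (q (Suc n)) (j 0) \<rho>)"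
    (is "dist Z ?\<zeta>")
proof -
  note X [simp] = distinguishedD[OF assms(1)] cplxD[OF distinguishedD(1)[OF assms(1)]]
    cplx_comp[OF distinguishedD(1)[OF assms(1)]]
  note Y [simp] = distinguishedD[OF assms(2)] cplxD[OF distinguishedD(1)[OF assms(2)]]
    cplx_comp[OF distinguishedD(1)[OF assms(2)]]
  note ijpq [simp] = chain_mapD(1-3)[OF i] chain_mapD(1-3)[OF j] chain_mapD(1-3)[OF p]
    chain_mapD(1-3)[OF q] ends
  note Z' [simp] = Z[THEN conjunct1] Z[THEN conjunct2, THEN conjunct1] Z[THEN conjunct2, THEN conjunct2]
  have Ob [simp]: "tm Z k \<in> Ob C" if "k \<le> Suc n" for k
    using cod_ob[of "i k"] that by simp
  have split: "f = (f \<bullet> (i k \<bullet> p k)) \<boxplus> (f \<bullet> (j k \<bullet> q k))"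
    if "k \<le> Suc n" "f \<in> Ar C" "Dom C f = tm Z k" for f k
    using that comp_madd(1)[of "i k \<bullet> p k" "j k \<bullet> q k" f] by (simp add: sum)
  have i_comm: "df Z k \<bullet> (i k \<bullet> u) = i (Suc k) \<bullet> (df X k \<bullet> u)"
    if "k \<le> n" "u \<in> Ar C" "Cod C u = tm X k" for k u
    by (rule comp_reassoc[OF chain_mapD(4)[OF i, symmetric]]) (use that in simp_all)
  have j_comm: "df Z k \<bullet> (j k \<bullet> u) = j (Suc k) \<bullet> (df Y k \<bullet> u)"
    if "k \<le> n" "u \<in> Ar C" "Cod C u = tm Y k" for k u
    by (rule comp_reassoc[OF chain_mapD(4)[OF j, symmetric]]) (use that in simp_all)
  have Zc: "cplx n C Z"
    unfolding cplx_def
  proof (intro conjI allI impI)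
    fix k assume k: "k < n"
    show "df Z (k + 1) \<bullet> df Z k = mzero C (tm Z k) (tm Z (k + 2))"
      by (subst split[of k]) (use k in \<open>simp_all add: i_comm j_comm\<close>)
  qed (auto simp: homset_def)
  have Zx: "coexact n Z"
    unfolding coexact_def
  proof (intro allI ballI impI)
    fix m f assume m: "m < n" "f \<in> Ar C" "Dom C f = tm Z (Suc m)" "f \<bullet> df Z m = mzero C (tm Z m) (Cod C f)"
    note [simp] = m(2,3)
    have "(f \<bullet> i (Suc m)) \<bullet> df X m = (f \<bullet> df Z m) \<bullet> i m"
      using chain_mapD(4)[OF i, of m] m(1) by simp
    also have "\<dots> = mzero C (tm X m) (Cod C f)" using m(1) by (simp add: m(4) del: assoc)
    finally obtain g where g: "g \<in> Ar C" "Dom C g = tm X (Suc (Suc m))" "Cod C g = Cod C f"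
      "f \<bullet> i (Suc m) = g \<bullet> df X (Suc m)"
      using distinguished_coexact[OF assms(1), unfolded coexact_def, rule_format, of m "f \<bullet> i (Suc m)"]
      using m(1) by auto
    have "(f \<bullet> j (Suc m)) \<bullet> df Y m = (f \<bullet> df Z m) \<bullet> j m"
      using chain_mapD(4)[OF j, of m] m(1) by simp
    also have "\<dots> = mzero C (tm Y m) (Cod C f)" using m(1) by (simp add: m(4) del: assoc)
    finally obtain h where h: "h \<in> Ar C" "Dom C h = tm Y (Suc (Suc m))" "Cod C h = Cod C f"
      "f \<bullet> j (Suc m) = h \<bullet> df Y (Suc m)"
      using distinguished_coexact[OF assms(2), unfolded coexact_def, rule_format, of m "f \<bullet> j (Suc m)"]
      using m(1) by auto
    have "f = ((f \<bullet> i (Suc m)) \<bullet> p (Suc m)) \<boxplus> ((f \<bullet> j (Suc m)) \<bullet> q (Suc m))"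
      using split[of "Suc m" f] m(1) by simp
    also have "\<dots> = ((g \<bullet> p (Suc (Suc m))) \<boxplus> (h \<bullet> q (Suc (Suc m)))) \<bullet> df Z (Suc m)"
      using g h chain_mapD(4)[OF p, of "Suc m"] chain_mapD(4)[OF q, of "Suc m"] m(1) by simp
    finally have "f = ((g \<bullet> p (Suc (Suc m))) \<boxplus> (h \<bullet> q (Suc (Suc m)))) \<bullet> df Z (Suc m)" .
    moreover have "(g \<bullet> p (Suc (Suc m))) \<boxplus> (h \<bullet> q (Suc (Suc m))) \<in> Ar C"
      "Dom C ((g \<bullet> p (Suc (Suc m))) \<boxplus> (h \<bullet> q (Suc (Suc m)))) = tm Z (Suc (Suc m))"
      "Cod C ((g \<bullet> p (Suc (Suc m))) \<boxplus> (h \<bullet> q (Suc (Suc m)))) = Cod C f"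
      using g(1-3) h(1-3) m(1) by simp_all
    ultimately show "\<exists>g\<in>Ar C. Dom C g = tm Z (Suc (Suc m)) \<and> Cod C g = Cod C f \<and> f = g \<bullet> df Z (Suc m)"
      by blast
  qed
  have \<zeta>: "?\<zeta> \<in> ext E (tm Z (Suc n)) (tm Z 0)" by simp
  \<comment> \<open>The comparison with a realization W is glued from lifts to and from each
    summand; at the ends the sums of composites are identities by \<open>sum\<close>.\<close>
  obtain W where W: "dist W ?\<zeta>" "tm W 0 = tm Z 0" "tm W (Suc n) = tm Z (Suc n)"
    using realization[OF Ob Ob \<zeta>] by auto
  note [simp] = W(2,3) distinguishedD(1)[OF W(1)]
  obtain i' where i': "chain_map n C X W i'" "i' 0 = i 0" "i' (Suc n) = i (Suc n)"
    by (rule lift[OF assms(1) W(1), of "i 0" "i (Suc n)"]) simp_all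
  obtain j' where j': "chain_map n C Y W j'" "j' 0 = j 0" "j' (Suc n) = j (Suc n)"
    by (rule lift[OF assms(2) W(1), of "j 0" "j (Suc n)"]) simp_all
  obtain p' where p': "chain_map n C W X p'" "p' 0 = p 0" "p' (Suc n) = p (Suc n)"
    by (rule lift[OF W(1) assms(1), of "p 0" "p (Suc n)"]) simp_all
  obtain q' where q': "chain_map n C W Y q'" "q' 0 = q 0" "q' (Suc n) = q (Suc n)"
    by (rule lift[OF W(1) assms(2), of "q 0" "q (Suc n)"]) simp_all
  have 1: "end_chain_map n C W Z (\<lambda>k. (i k \<bullet> p' k) \<boxplus> (j k \<bullet> q' k))"
    using chain_map_madd[OF chain_map_comp[OF p'(1) i] chain_map_comp[OF q'(1) j]] p' q' sum Zc
    by (auto simp: end_chain_map_def)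
  have 2: "end_chain_map n C Z W (\<lambda>k. (i' k \<bullet> p k) \<boxplus> (j' k \<bullet> q k))"
    using chain_map_madd[OF chain_map_comp[OF p i'(1)] chain_map_comp[OF q j'(1)]] i' j' sum Zc
    by (auto simp: end_chain_map_def)
  show ?thesis by (rule distinguished_transfer[OF W(1) Zc Zx 1 2])
qed

end

section \<open>Exactness at extensions and liftings with prescribed first arrows\<close>

locale positive_exangulated_category = exangulated_category C E n s
  for C :: "('o, 'm) cat" (structure) and E :: "('o, 'm, 'e) bifun"
    and n :: nat and s :: "('o, 'm, 'e) realiz" +
  assumes n_ge_1: "n \<ge> 1"

sublocale positive_exangulated_category \<subseteq> positive_exact_realization C E n s
  by unfold_locales (rule n_ge_1)

context positive_exangulated_category
begin

lemma n_simps [simp]: "0 < n" "Suc 0 \<le> n" "n \<noteq> 0"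
  using n_ge_1 by auto

lemma cone_lift:
  assumes "dist X (EMor E c (Id C (tm Y 0)) \<rho>)" "dist Y \<rho>" "tm X 0 = tm Y 0"
    "c \<in> Ar C" "Dom C c = tm X (Suc n)" "Cod C c = tm Y (Suc n)"
  obtains f where "chain_map n C X Y f" "f 0 = Id C (tm X 0)" "f (Suc n) = c"
    "dist (cone n C X Y f) (EMor E (Id C (tm Y (Suc n))) (df X 0) \<rho>)"
  using EA2[of X Y c \<rho>] assms by (auto simp: pull_def push_def homset_def)

lemma cocone_lift:
  assumes "dist X \<rho>" "dist Y (EMor E (Id C (tm X (Suc n))) a \<rho>)" "tm X (Suc n) = tm Y (Suc n)"
    "a \<in> Ar C" "Dom C a = tm X 0" "Cod C a = tm Y 0"
  obtains h where "chain_map n C X Y h" "h 0 = a" "h (Suc n) = Id C (tm X (Suc n))"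
    "dist (cocone n C X Y h) (EMor E (df Y n) (Id C (tm X 0)) \<rho>)"
  using EA2_op[of X Y a \<rho>] assms by (auto simp: pull_def push_def homset_def)

text \<open>
  For a distinguished \<open>\<langle>X, \<delta>\<rangle>\<close> and \<open>\<rho>\<close> killed by the inflation, the cone of the inclusion of \<open>\<delta>\<close>
  into \<open>\<theta> = p\<^sub>1\<^sup>* \<delta> + p\<^sub>2\<^sup>* \<rho>\<close> carries the zero extension, so its deflation splits.
\<close>

lemma extension_pull_exact:
  assumes X: "dist X \<delta>" and D: "D \<in> Ob C" and \<rho>: "\<rho> \<in> ext E D (tm X 0)"
    and z: "EMor E (Id C D) (df X 0) \<rho> = ext_zero E D (tm X 1)"
  obtains c where "c \<in> Ar C" "Dom C c = D" "Cod C c = tm X (Suc n)" "EMor E c (Id C (tm X 0)) \<delta> = \<rho>"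
proof -
  note [simp] = distinguishedD[OF X] cplxD[OF distinguishedD(1)[OF X]] D \<rho>
  obtain B A S where BAS [simp]: "tm X (Suc n) = B" "tm X 0 = A" "dsum C B D = S" by blast
  have [simp]: "A \<in> Ob C" "B \<in> Ob C" "\<delta> \<in> ext E B A" "\<rho> \<in> ext E D A"
    using cplxD(1)[OF distinguishedD(1)[OF X], of 0] cplxD(1)[OF distinguishedD(1)[OF X], of "Suc n"]
      distinguishedD(2)[OF X] \<rho> by simp_all
  have [simp]: "S \<in> Ob C" unfolding BAS(3)[symmetric] by (simp del: BAS(3))
  define \<theta> where "\<theta> = EMor E (proj1 C B D) (Id C A) \<delta> \<otimes>\<^bsub>EOb E S A\<^esub> EMor E (proj2 C B D) (Id C A) \<rho>"
  have \<theta> [simp]: "\<theta> \<in> ext E S A" by (simp add: \<theta>_def)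
  obtain P where P: "dist P \<theta>" "tm P 0 = A" "tm P (Suc n) = S"
    by (rule realization[of S A \<theta>]) simp_all
  note [simp] = P(2,3) cplxD[OF distinguishedD(1)[OF P(1)]]
  have \<theta>1: "EMor E (inj1 C B D) (Id C A) \<theta> = \<delta>" by (simp add: \<theta>_def)
  have \<theta>2: "EMor E (inj2 C B D) (Id C A) \<theta> = \<rho>" by (simp add: \<theta>_def)
  obtain f where f: "f (Suc n) = inj1 C B D" "dist (cone n C X P f) (EMor E (Id C S) (df X 0) \<theta>)"
    by (rule cone_lift[of X "inj1 C B D" P \<theta>]) (use X P \<theta>1 in auto)
  have "EMor E (proj2 C B D) (Id C (tm X 1)) (EMor E (Id C D) (df X 0) \<rho>) = ext_zero E S (tm X 1)"
    unfolding z by simp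
  then have "EMor E (proj2 C B D) (df X 0) \<rho> = ext_zero E S (tm X 1)" by simp
  moreover have "EMor E (proj1 C B D) (df X 0) \<delta> = ext_zero E S (tm X 1)"
    using distinguished_push_zero(1)[OF X, of "proj1 C B D" "Id C (tm X 1)"] by simp
  ultimately have 0: "EMor E (Id C S) (df X 0) \<theta> = ext_zero E S (tm X 1)"
    by (simp add: \<theta>_def)
  \<comment> \<open>Every arrow pulls a zero extension back to zero, so the identity itself factors
    through the deflation of the cone.\<close>
  obtain g where g0: "g \<in> Ar C" "Dom C g = Dom C (Id C S)" "Cod C g = tm (cone n C X P f) n"
    "Id C S = df (cone n C X P f) n \<bullet> g"
    using distinguished_pull_exact[OF f(2), of "Id C S"] by (auto simp: 0 cone_def)
  have g: "g \<in> Ar C" "Dom C g = S" "Cod C g = dsum C B (tm P n)"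
    using g0(1-3) by (simp_all add: cone_def)
  have gS: "Id C S = row C (inj1 C B D) (df P n) \<bullet> g"
    using g0(4) by (simp add: cone_def f(1))
  define c where "c = proj1 C B (tm P n) \<bullet> (g \<bullet> inj2 C B D)"
  define v where "v = proj2 C B (tm P n) \<bullet> (g \<bullet> inj2 C B D)"
  have c: "c \<in> Ar C" "Dom C c = D" "Cod C c = B" "v \<in> Ar C" "Dom C v = D" "Cod C v = tm P n"
    using g by (simp_all add: c_def v_def)
  have "g \<bullet> inj2 C B D = col C c v"
    using col_eta[of "g \<bullet> inj2 C B D" B "tm P n"] g by (simp add: c_def v_def)
  moreover have "inj2 C B D = row C (inj1 C B D) (df P n) \<bullet> (g \<bullet> inj2 C B D)"
    using arg_cong[OF gS, of "\<lambda>h. h \<bullet> inj2 C B D"] g(1-3) by simp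
  \<comment> \<open>Up to an arrow through the deflation of P, the injection of D factors through B
    by \<open>c\<close>. Pulling \<theta> back along this equation leaves \<rho> on one side and the
    pull-back of \<delta> along \<open>c\<close> on the other, since the deflation kills
    \<theta>.\<close>
  ultimately have i2: "inj2 C B D = (inj1 C B D \<bullet> c) \<boxplus> (df P n \<bullet> v)"
    using c by simp
  have "EMor E (df P n \<bullet> v) (Id C A) \<theta> = ext_zero E D A"
    using distinguished_pull_zero(2)[OF P(1), of "Id C A" v] c by simp
  moreover have "EMor E (inj1 C B D \<bullet> c) (Id C A) \<theta> = EMor E c (Id C A) \<delta>"
    unfolding \<theta>1[symmetric] using c by simp
  ultimately have "\<rho> = EMor E c (Id C A) \<delta>"
    unfolding \<theta>2[symmetric] by (subst i2, subst EMor_madd_left) (use c in simp_all)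
  then show ?thesis using that[of c] c by simp
qed

text \<open>Dually, \<theta> is the sum of the push-forwards of \<delta> and \<rho> to A \<oplus> D,
  and its projection onto \<delta> has a cocone with zero extension. The inflation of that cocone is
  a split monomorphism, and the entry of a retraction from A to D is the required
  \<open>a\<close>.\<close>

lemma extension_push_exact:
  assumes X: "dist X \<delta>" and D: "D \<in> Ob C" and \<rho>: "\<rho> \<in> ext E (tm X (Suc n)) D"
    and z: "EMor E (df X n) (Id C D) \<rho> = ext_zero E (tm X n) D"
  obtains a where "a \<in> Ar C" "Dom C a = tm X 0" "Cod C a = D" "EMor E (Id C (tm X (Suc n))) a \<delta> = \<rho>"
proof -
  note [simp] = distinguishedD[OF X] cplxD[OF distinguishedD(1)[OF X]] D \<rho>
  obtain B A S where BAS [simp]: "tm X (Suc n) = B" "tm X 0 = A" "dsum C A D = S" by blast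
  have [simp]: "A \<in> Ob C" "B \<in> Ob C" "\<delta> \<in> ext E B A" "\<rho> \<in> ext E B D"
    using cplxD(1)[OF distinguishedD(1)[OF X], of 0] cplxD(1)[OF distinguishedD(1)[OF X], of "Suc n"]
      distinguishedD(2)[OF X] \<rho> by simp_all
  have [simp]: "S \<in> Ob C" unfolding BAS(3)[symmetric] by (simp del: BAS(3))
  define \<theta> where "\<theta> = EMor E (Id C B) (inj1 C A D) \<delta> \<otimes>\<^bsub>EOb E B S\<^esub> EMor E (Id C B) (inj2 C A D) \<rho>"
  have \<theta> [simp]: "\<theta> \<in> ext E B S" by (simp add: \<theta>_def)
  obtain P where P: "dist P \<theta>" "tm P 0 = S" "tm P (Suc n) = B"
    by (rule realization[of B S \<theta>]) simp_all
  note [simp] = P(2,3) cplxD[OF distinguishedD(1)[OF P(1)]]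
  have \<theta>1: "EMor E (Id C B) (proj1 C A D) \<theta> = \<delta>" by (simp add: \<theta>_def)
  have \<theta>2: "EMor E (Id C B) (proj2 C A D) \<theta> = \<rho>" by (simp add: \<theta>_def)
  obtain h where h: "h 0 = proj1 C A D" "dist (cocone n C P X h) (EMor E (df X n) (Id C S) \<theta>)"
    by (rule cocone_lift[of P \<theta> X "proj1 C A D"]) (use X P \<theta>1 in auto)
  have "EMor E (Id C (tm X n)) (inj2 C A D) (EMor E (df X n) (Id C D) \<rho>) = ext_zero E (tm X n) S"
    unfolding z by simp
  then have "EMor E (df X n) (inj2 C A D) \<rho> = ext_zero E (tm X n) S" by simp
  moreover have "EMor E (df X n) (inj1 C A D) \<delta> = ext_zero E (tm X n) S"
    using distinguished_pull_zero(1)[OF X, of "inj1 C A D" "Id C (tm X n)"] by simp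
  ultimately have 0: "EMor E (df X n) (Id C S) \<theta> = ext_zero E (tm X n) S"
    by (simp add: \<theta>_def)
  obtain g where g0: "g \<in> Ar C" "Dom C g = tm (cocone n C P X h) 1" "Cod C g = Cod C (Id C S)"
    "Id C S = g \<bullet> df (cocone n C P X h) 0"
    using distinguished_push_exact[OF h(2), of "Id C S"] by (auto simp: 0 cocone_def)
  have g: "g \<in> Ar C" "Dom C g = dsum C A (tm P 1)" "Cod C g = S"
    using g0(1-3) by (simp_all add: cocone_def)
  have gS: "Id C S = g \<bullet> col C (proj1 C A D) (df P 0)"
    using g0(4) by (simp add: cocone_def h(1))
  define a where "a = (proj2 C A D \<bullet> g) \<bullet> inj1 C A (tm P 1)"
  define v where "v = (proj2 C A D \<bullet> g) \<bullet> inj2 C A (tm P 1)"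
  have a: "a \<in> Ar C" "Dom C a = A" "Cod C a = D" "v \<in> Ar C" "Cod C v = D" "Dom C v = tm P 1"
    using g by (simp_all add: a_def v_def)
  have "proj2 C A D \<bullet> g = row C a v"
    using row_eta[of "proj2 C A D \<bullet> g" A "tm P 1"] g by (simp add: a_def v_def)
  moreover have "proj2 C A D = (proj2 C A D \<bullet> g) \<bullet> col C (proj1 C A D) (df P 0)"
    using arg_cong[OF gS, of "\<lambda>h. proj2 C A D \<bullet> h"] g(1-3) by simp
  ultimately have p2: "proj2 C A D = (a \<bullet> proj1 C A D) \<boxplus> (v \<bullet> df P 0)"
    using a by simp
  have "EMor E (Id C B) (v \<bullet> df P 0) \<theta> = ext_zero E B D"
    using distinguished_push_zero(2)[OF P(1), of "Id C B" v] a by simp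
  moreover have "EMor E (Id C B) (a \<bullet> proj1 C A D) \<theta> = EMor E (Id C B) a \<delta>"
    unfolding \<theta>1[symmetric] using a by simp
  ultimately have "\<rho> = EMor E (Id C B) a \<delta>"
    unfolding \<theta>2[symmetric] by (subst p2, subst EMor_madd_right) (use a in simp_all)
  then show ?thesis using that[of a] a by simp
qed

text \<open>
  Axiom (EA2) gives a lift whose first component agrees with \<open>b\<close> up to a map factoring through \<open>d\<^sub>1\<close>, say
  \<open>e d\<^sub>1\<close>. Correcting by the homotopy \<open>e\<close> changes the cone by the automorphism \<open>[1 0; -e 1]\<close>.
\<close>

lemma good_lift:
  assumes X: "dist X \<alpha>" and Y: "dist Y \<rho>" and A: "tm X 0 = tm Y 0"
    and b: "b \<in> Ar C" "Dom C b = tm X 1" "Cod C b = tm Y 1" "b \<bullet> df X 0 = df Y 0"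
  obtains f where "chain_map n C X Y f" "f 0 = Id C (tm X 0)" "f 1 = b"
    "EMor E (f (Suc n)) (Id C (tm Y 0)) \<rho> = \<alpha>"
    "dist (cone n C X Y f) (EMor E (Id C (tm Y (Suc n))) (df X 0) \<rho>)"
proof -
  note X' [simp] = distinguishedD[OF X] cplxD[OF distinguishedD(1)[OF X]]
    cplx_comp[OF distinguishedD(1)[OF X]]
  note Y' [simp] = distinguishedD[OF Y] cplxD[OF distinguishedD(1)[OF Y]]
    cplx_comp[OF distinguishedD(1)[OF Y]] A b(1-3)
  have \<alpha>: "\<alpha> \<in> ext E (tm X (Suc n)) (tm Y 0)" using X'(2) by simp
  \<comment> \<open>The inflation of Y factors as b after that of X, so it kills \<alpha>. Exactness
    at the extensions then makes \<alpha> a pull-back of \<rho>, as (EA2) requires.\<close>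
  have "EMor E (Id C (tm X (Suc n))) (df Y 0) \<alpha> = ext_zero E (tm X (Suc n)) (tm Y 1)"
    using distinguished_push_zero(2)[OF X, of "Id C (tm X (Suc n))" b] b by simp
  then obtain c where c: "c \<in> Ar C" "Dom C c = tm X (Suc n)" "Cod C c = tm Y (Suc n)"
    "EMor E c (Id C (tm Y 0)) \<rho> = \<alpha>"
    using extension_pull_exact[OF Y, of "tm X (Suc n)" \<alpha>] \<alpha> by (metis X'(3) order_refl)
  obtain f where f: "chain_map n C X Y f" "f 0 = Id C (tm X 0)" "f (Suc n) = c"
    "dist (cone n C X Y f) (EMor E (Id C (tm Y (Suc n))) (df X 0) \<rho>)"
    by (rule cone_lift[of X c Y \<rho>]) (use X Y c in auto)
  note f' [simp] = chain_mapD(1-3)[OF f(1)] f(2)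
  have f1: "f 1 \<bullet> df X 0 = df Y 0" using chain_mapD(4)[OF f(1), of 0] by simp
  have "(b \<boxplus> \<boxminus> f 1) \<bullet> df X 0 = mzero C (tm X 0) (tm Y 1)" using f1 b by simp
  then obtain e where e: "e \<in> Ar C" "Dom C e = tm X 2" "Cod C e = tm Y 1" "b \<boxplus> \<boxminus> f 1 = e \<bullet> df X 1"
    using distinguished_coexact[OF X, unfolded coexact_def, rule_format, of 0 "b \<boxplus> \<boxminus> f 1"]
    by (auto simp: numeral_2_eq_2)
  have b_eq: "b = f 1 \<boxplus> (e \<bullet> df X 1)" unfolding e(4)[symmetric] by simp
  note [simp] = e(1-3)
  define g where "g = (\<lambda>i. if i = 1 then b else if i = 2 then f 2 \<boxplus> (df Y 1 \<bullet> e) else f i)"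
  have two: "2 = Suc (Suc 0)" by simp
  have g: "chain_map n C X Y g"
  proof (rule chain_mapI)
    fix i assume i: "i \<le> n"
    have fi: "f (Suc i) \<bullet> df X i = df Y i \<bullet> f i" using chain_mapD(4)[OF f(1) i] .
    consider "i = 0" | "i = 1" | "i = 2" | "i > 2" by linarith
    then show "g (Suc i) \<bullet> df X i = df Y i \<bullet> g i"
    proof cases
      case 1
      then show ?thesis using b by (simp add: g_def)
    next
      case 2
      then show ?thesis using fi i by (simp add: g_def two b_eq)
    next
      case 3
      then show ?thesis using fi i by (simp add: g_def two)
    qed (use fi in \<open>simp add: g_def\<close>)
  qed (auto simp: g_def two)
  note g' [simp] = chain_mapD(1-3)[OF g]
  have gn: "EMor E (g (Suc n)) (Id C (tm Y 0)) \<rho> = \<alpha>"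
  \<comment> \<open>For n = 1 the corrected degree 2 is the last one, so \<open>c\<close> changes by
    an arrow through the deflation of Y; the pull-back of \<rho> does not notice this.\<close>
  proof (cases "n = 1")
    case True
    have "EMor E (df Y n \<bullet> e) (Id C (tm Y 0)) \<rho> = ext_zero E (tm X (Suc n)) (tm Y 0)"
      using distinguished_pull_zero(2)[OF Y, of "Id C (tm Y 0)" e] True by (simp add: two)
    then have "EMor E (f 2 \<boxplus> (df Y 1 \<bullet> e)) (Id C (tm Y 0)) \<rho> = \<alpha>"
      using True f(3) c \<alpha> Y'(2) by (subst EMor_madd_left) (simp_all add: two)
    then show ?thesis using True by (simp add: g_def two)
  qed (use f(3) c in \<open>simp add: g_def\<close>)
  let ?p = "\<lambda>k. if k = 1 then mat C (Id C (tm X 2)) (mzero C (tm Y 1) (tm X 2)) (\<boxminus> e) (Id C (tm Y 1))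
     else Id C (tm (cone n C X Y f) k)"
  let ?i = "\<lambda>k. if k = 1 then mat C (Id C (tm X 2)) (mzero C (tm Y 1) (tm X 2)) e (Id C (tm Y 1))
     else Id C (tm (cone n C X Y f) k)"
  have [simp]: "tm (cone n C X Y f) k \<in> Ob C" if "k \<le> Suc n" for k
    using that by (simp add: cone_def)
  have "dist (cone n C X Y g)
    (EMor E (?i (Suc n)) (?p 0) (EMor E (Id C (tm Y (Suc n))) (df X 0) \<rho>))"
  proof (rule distinguished_iso[OF f(4), where p = ?p and i = ?i])
    show "df (cone n C X Y g) k \<in> Ar C \<and> Dom C (df (cone n C X Y g) k) = tm (cone n C X Y g) k
       \<and> Cod C (df (cone n C X Y g) k) = tm (cone n C X Y g) (Suc k)" if "k \<le> n" for k
      using that by (auto simp: cone_def mat_def)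
    show "?i k \<in> Ar C \<and> Dom C (?i k) = tm (cone n C X Y g) k \<and> Cod C (?i k) = tm (cone n C X Y f) k \<and>
      ?p k \<bullet> ?i k = Id C (tm (cone n C X Y g) k) \<and> ?i k \<bullet> ?p k = Id C (tm (cone n C X Y f) k)"
      if "k \<le> Suc n" for k
    proof (cases "k = 1")
      case True
      have "mat C (Id C (tm X 2)) (mzero C (tm Y 1) (tm X 2)) (mzero C (tm X 2) (tm Y 1)) (Id C (tm Y 1))
         = Id C (dsum C (tm X 2) (tm Y 1))"
        by (rule col_ext[of _ _ "tm X 2" "tm Y 1"]; (rule row_ext[of _ _ "tm X 2" "tm Y 1"])?)
          (simp_all add: mat_def two)
      then show ?thesis using True by (simp add: cone_def mat_def two)
    qed (use that in \<open>auto simp: cone_def\<close>)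
    show "chain_map n C (cone n C X Y f) (cone n C X Y g) ?p"
    proof (rule chain_mapI)
      show "?p k \<in> Ar C \<and> Dom C (?p k) = tm (cone n C X Y f) k \<and> Cod C (?p k) = tm (cone n C X Y g) k"
        if "k \<le> Suc n" for k
        using that by (auto simp: cone_def mat_def two)
      fix k assume k: "k \<le> n"
      consider "k = 0" | "k = 1" "n = 1" | "k = 1" "n > 1" | "k > 1" using n_ge_1 k by linarith
      then show "?p (Suc k) \<bullet> df (cone n C X Y f) k = df (cone n C X Y g) k \<bullet> ?p k"
      proof cases
        case 1
        then show ?thesis by (simp add: cone_def mat_def two g_def b_eq madd_comm)
      next
        case 2
        then show ?thesis by (simp add: cone_def mat_def two g_def)
      next
        case 3
        then show ?thesis by (simp add: cone_def mat_def two g_def)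
      next
        case 4
        then show ?thesis using k by (auto simp: cone_def mat_def g_def)
      qed
    qed
  qed
  then have "dist (cone n C X Y g) (EMor E (Id C (tm Y (Suc n))) (df X 0) \<rho>)"
    by (simp add: cone_def)
  then show ?thesis using that[of g] g gn by (simp add: g_def)
qed

end

section \<open>Trivial exangles and the suspension\<close>

context positive_exangulated_category
begin

text \<open>The complex is kept existential because the information lies in the extension, which is
  a universal element for both E(-, A) and E(D, -).\<close>

definition trivial_exangle where
  "trivial_exangle D A \<delta> \<longleftrightarrow> (\<exists>X. dist X \<delta> \<and> tm X 0 = A \<and> tm X (Suc n) = D \<and>
     (\<forall>i \<in> {1..n}. zero_object C (tm X i)))"

lemma trivial_exangleE:
  assumes "trivial_exangle D A \<delta>"
  obtains X where "dist X \<delta>" "tm X 0 = A" "tm X (Suc n) = D"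
    "\<And>i. 1 \<le> i \<Longrightarrow> i \<le> n \<Longrightarrow> zero_object C (tm X i)"
    "df X 0 = mzero C A (tm X 1)" "df X n = mzero C (tm X n) D"
proof -
  obtain X where X: "dist X \<delta>" "tm X 0 = A" "tm X (Suc n) = D"
    "\<And>i. 1 \<le> i \<Longrightarrow> i \<le> n \<Longrightarrow> zero_object C (tm X i)"
    using assms by (auto simp: trivial_exangle_def)
  note [simp] = cplxD[OF distinguishedD(1)[OF X(1)]]
  have "df X 0 = mzero C A (tm X 1)" "df X n = mzero C (tm X n) D"
    using into_zero[of "df X 0"] from_zero[of "df X n"] X by simp_all
  with X show ?thesis using that by blast
qed

lemma trivial_exangleD:
  assumes "trivial_exangle D A \<delta>"
  shows "D \<in> Ob C" "A \<in> Ob C" "\<delta> \<in> ext E D A"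
proof -
  obtain X where X: "dist X \<delta>" "tm X 0 = A" "tm X (Suc n) = D"
    using trivial_exangleE[OF assms] by blast
  show "D \<in> Ob C" "A \<in> Ob C" "\<delta> \<in> ext E D A"
    using distinguishedD[OF X(1)] cplxD(1)[of n X 0] cplxD(1)[of n X "Suc n"] X(2,3) by auto
qed

text \<open>The inflation of a trivial exangle is zero and kills every extension, so exactness at
  the E-term exhibits each extension as a pull-back.\<close>

lemma trivial_pull_surj:
  assumes "trivial_exangle D A \<delta>" "T \<in> Ob C" "\<rho> \<in> ext E T A"
  obtains c where "c \<in> Ar C" "Dom C c = T" "Cod C c = D" "EMor E c (Id C A) \<delta> = \<rho>"
proof -
  obtain X where X: "dist X \<delta>" "tm X 0 = A" "tm X (Suc n) = D" "df X 0 = mzero C A (tm X 1)"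
    using trivial_exangleE[OF assms(1)] by metis
  have "tm X 1 \<in> Ob C" using cplxD(1)[OF distinguishedD(1)[OF X(1)]] by simp
  then have "\<rho> \<in> ext E T (tm X 0)" "EMor E (Id C T) (df X 0) \<rho> = ext_zero E T (tm X 1)"
    using X assms trivial_exangleD[OF assms(1)] by simp_all
  then obtain c where "c \<in> Ar C" "Dom C c = T" "Cod C c = tm X (Suc n)" "EMor E c (Id C (tm X 0)) \<delta> = \<rho>"
    by (rule extension_pull_exact[OF X(1) assms(2)])
  then show ?thesis using that X by simp
qed

lemma trivial_push_surj:
  assumes "trivial_exangle D A \<delta>" "T \<in> Ob C" "\<rho> \<in> ext E D T"
  obtains a where "a \<in> Ar C" "Dom C a = A" "Cod C a = T" "EMor E (Id C D) a \<delta> = \<rho>"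
proof -
  obtain X where X: "dist X \<delta>" "tm X 0 = A" "tm X (Suc n) = D" "df X n = mzero C (tm X n) D"
    using trivial_exangleE[OF assms(1)] by metis
  have "tm X n \<in> Ob C" using cplxD(1)[OF distinguishedD(1)[OF X(1)]] by simp
  then have "\<rho> \<in> ext E (tm X (Suc n)) T" "EMor E (df X n) (Id C T) \<rho> = ext_zero E (tm X n) T"
    using X assms trivial_exangleD[OF assms(1)] by simp_all
  then obtain a where "a \<in> Ar C" "Dom C a = tm X 0" "Cod C a = T" "EMor E (Id C (tm X (Suc n))) a \<delta> = \<rho>"
    by (rule extension_push_exact[OF X(1) assms(2)])
  then show ?thesis using that X by simp
qed

text \<open>The difference of the two arrows pulls \<delta> back to zero, hence factors through the
  deflation, which is zero.\<close>

lemma trivial_pull_inj: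
  assumes "trivial_exangle D A \<delta>" "c \<in> Ar C" "c' \<in> Ar C" "Dom C c = Dom C c'" "Cod C c = D" "Cod C c' = D"
    "EMor E c (Id C A) \<delta> = EMor E c' (Id C A) \<delta>"
  shows "c = c'"
proof -
  note t = trivial_exangleD[OF assms(1)]
  obtain X where X: "dist X \<delta>" "tm X 0 = A" "tm X (Suc n) = D" "df X n = mzero C (tm X n) D"
    using trivial_exangleE[OF assms(1)] by metis
  have "EMor E (c \<boxplus> \<boxminus> c') (Id C A) \<delta> = ext_zero E (Dom C c') A"
    using ext_eq_iff[of c c' "Id C A" \<delta>] assms t by simp
  then have "c \<boxplus> \<boxminus> c' \<in> Ar C" "Cod C (c \<boxplus> \<boxminus> c') = tm X (Suc n)"
    "EMor E (c \<boxplus> \<boxminus> c') (Id C (tm X 0)) \<delta> = ext_zero E (Dom C (c \<boxplus> \<boxminus> c')) (tm X 0)"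
    using X assms(2-6) by simp_all
  then obtain g where g: "g \<in> Ar C" "Dom C g = Dom C (c \<boxplus> \<boxminus> c')" "Cod C g = tm X n"
    "c \<boxplus> \<boxminus> c' = df X n \<bullet> g"
    by (rule distinguished_pull_exact[OF X(1)])
  have "c \<boxplus> \<boxminus> c' = mzero C (Dom C c') D"
    unfolding g(4) X(4) using g(1-3) t assms(2-6) by simp
  then show ?thesis using diff_eq_zeroD[of c c'] assms(2-6) by simp
qed

lemma trivial_push_inj:
  assumes "trivial_exangle D A \<delta>" "a \<in> Ar C" "a' \<in> Ar C" "Cod C a = Cod C a'" "Dom C a = A" "Dom C a' = A"
    "EMor E (Id C D) a \<delta> = EMor E (Id C D) a' \<delta>"
  shows "a = a'"
proof -
  note t = trivial_exangleD[OF assms(1)]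
  obtain X where X: "dist X \<delta>" "tm X 0 = A" "tm X (Suc n) = D" "df X 0 = mzero C A (tm X 1)"
    using trivial_exangleE[OF assms(1)] by metis
  have "EMor E (Id C D) (a \<boxplus> \<boxminus> a') \<delta> = ext_zero E D (Cod C a')"
    using ext_eq_iff_right[of "Id C D" a' a \<delta>] assms t by simp
  then have "a \<boxplus> \<boxminus> a' \<in> Ar C" "Dom C (a \<boxplus> \<boxminus> a') = tm X 0"
    "EMor E (Id C (tm X (Suc n))) (a \<boxplus> \<boxminus> a') \<delta> = ext_zero E (tm X (Suc n)) (Cod C (a \<boxplus> \<boxminus> a'))"
    using X assms(2-6) by simp_all
  then obtain g where g: "g \<in> Ar C" "Dom C g = tm X 1" "Cod C g = Cod C (a \<boxplus> \<boxminus> a')"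
    "a \<boxplus> \<boxminus> a' = g \<bullet> df X 0"
    by (rule distinguished_push_exact[OF X(1)])
  have "a \<boxplus> \<boxminus> a' = mzero C A (Cod C a')"
    unfolding g(4) X(4) using g(1-3) t assms(2-6) by simp
  then show ?thesis using diff_eq_zeroD[of a a'] assms(2-6) by simp
qed

text \<open>Uniqueness of universal elements: the arrow obtained from the opposite comparison is
  inverse to \<open>a\<close>, as both composites fix a universal extension.\<close>

lemma trivial_push_iso:
  assumes t: "trivial_exangle D A \<delta>" "trivial_exangle D A' \<delta>'"
    and a: "a \<in> Ar C" "Dom C a = A" "Cod C a = A'" "EMor E (Id C D) a \<delta> = \<delta>'"
  shows "is_iso C a"
proof -
  note t' = trivial_exangleD[OF t(1)] trivial_exangleD[OF t(2)]
  obtain b where b: "b \<in> Ar C" "Dom C b = A'" "Cod C b = A" "EMor E (Id C D) b \<delta>' = \<delta>"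
    using trivial_push_surj[OF t(2), of A \<delta>] t' by blast
  have "EMor E (Id C D) (b \<bullet> a) \<delta> = EMor E (Id C D) b (EMor E (Id C D) a \<delta>)"
    using a(1-3) b(1-3) t' by simp
  then have "b \<bullet> a = Id C A"
    using trivial_push_inj[OF t(1), of "b \<bullet> a" "Id C A"] a b t' by simp
  moreover have "EMor E (Id C D) (a \<bullet> b) \<delta>' = EMor E (Id C D) a (EMor E (Id C D) b \<delta>')"
    using a(1-3) b(1-3) t' by simp
  then have "a \<bullet> b = Id C A'"
    using trivial_push_inj[OF t(2), of "a \<bullet> b" "Id C A'"] a b t' by simp
  ultimately show ?thesis using a b unfolding is_iso_def homset_def by blast
qed

lemma trivial_pull_iso:
  assumes t: "trivial_exangle D A \<delta>" "trivial_exangle D' A \<delta>'"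
    and c: "c \<in> Ar C" "Dom C c = D'" "Cod C c = D" "EMor E c (Id C A) \<delta> = \<delta>'"
  shows "is_iso C c"
proof -
  note t' = trivial_exangleD[OF t(1)] trivial_exangleD[OF t(2)]
  obtain b where b: "b \<in> Ar C" "Dom C b = D" "Cod C b = D'" "EMor E b (Id C A) \<delta>' = \<delta>"
    using trivial_pull_surj[OF t(2), of D \<delta>] t' by blast
  have "EMor E (c \<bullet> b) (Id C A) \<delta> = EMor E b (Id C A) (EMor E c (Id C A) \<delta>)"
    using c(1-3) b(1-3) t' by simp
  then have "c \<bullet> b = Id C D"
    using trivial_pull_inj[OF t(1), of "c \<bullet> b" "Id C D"] c b t' by simp
  moreover have "EMor E (b \<bullet> c) (Id C A) \<delta>' = EMor E c (Id C A) (EMor E b (Id C A) \<delta>')"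
    using c(1-3) b(1-3) t' by simp
  then have "b \<bullet> c = Id C D'"
    using trivial_pull_inj[OF t(2), of "b \<bullet> c" "Id C D'"] c b t' by simp
  ultimately show ?thesis using c b unfolding is_iso_def homset_def by blast
qed

text \<open>The cocone of a trivial exangle pushed forward along f begins with a column whose
  entries are f and an arrow into a zero object. Deleting that object makes f itself an
  inflation.\<close>

lemma trivial_inflation_all:
  assumes t: "trivial_exangle D (Dom C f) \<delta>" and f: "f \<in> Ar C"
  obtains X \<rho> where "dist X \<rho>" "df X 0 = f" "tm X 0 = Dom C f"
proof -
  define B where "B = Cod C f"
  have [simp]: "Cod C f = B" "B \<in> Ob C" using f by (simp_all add: B_def)
  obtain T where T: "dist T \<delta>" "tm T 0 = Dom C f" "tm T (Suc n) = D"
    "\<And>i. 1 \<le> i \<Longrightarrow> i \<le> n \<Longrightarrow> zero_object C (tm T i)"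
    using trivial_exangleE[OF t] by metis
  note T' [simp] = distinguishedD[OF T(1)] cplxD[OF distinguishedD(1)[OF T(1)]] T(2,3) f
  note D [simp] = trivial_exangleD[OF t]
  have \<epsilon>: "EMor E (Id C D) f \<delta> \<in> ext E D B" by simp
  obtain Y where Y: "dist Y (EMor E (Id C D) f \<delta>)" "tm Y 0 = B" "tm Y (Suc n) = D"
    using realization[OF D(1) _ \<epsilon>] by auto
  note Y' [simp] = cplxD[OF distinguishedD(1)[OF Y(1)]] Y(2,3)
  obtain h where h: "h 0 = f" "dist (cocone n C T Y h) (EMor E (df Y n) (Id C (Dom C f)) \<delta>)"
    by (rule cocone_lift[OF T(1), of Y f]) (use Y in auto)
  let ?N = "cocone n C T Y h"
  let ?Z = "tm T (Suc 0)"
  have Z: "zero_object C ?Z" using T(4) by simp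
  have N0: "df ?N 0 = col C f (df T 0)" and N1: "tm ?N 1 = dsum C B ?Z" "tm ?N 0 = Dom C f"
    by (simp_all add: cocone_def h(1))
  note N [simp] = distinguishedD[OF h(2)] cplxD[OF distinguishedD(1)[OF h(2)]]
  \<comment> \<open>Only B \<oplus> 0 in degree 1 is replaced by B, so the two differentials meeting
    there are the ones to be adjusted.\<close>
  define X where "X = \<lparr>tm = (tm ?N)(1 := B),
    df = (\<lambda>i. if i = 0 then f else if i = 1 then df ?N 1 \<bullet> inj1 C B ?Z else df ?N i)\<rparr>"
  let ?p = "\<lambda>k. if k = 1 then proj1 C B ?Z else Id C (tm ?N k)"
  let ?i = "\<lambda>k. if k = 1 then inj1 C B ?Z else Id C (tm ?N k)"
  have [simp]: "inj1 C B ?Z \<bullet> proj1 C B ?Z = Id C (dsum C B ?Z)"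
    using inj1_proj1_zero Z by simp
  have dN1: "Dom C (df ?N 1) = dsum C B ?Z" using N1 N(4)[of 1] by simp
  have "dist X (EMor E (?i (Suc n)) (?p 0) (EMor E (df Y n) (Id C (Dom C f)) \<delta>))"
  proof (rule distinguished_iso[OF h(2), where p = ?p and i = ?i])
    show "df X k \<in> Ar C \<and> Dom C (df X k) = tm X k \<and> Cod C (df X k) = tm X (Suc k)" if "k \<le> n" for k
      using that N1 dN1 by (auto simp: X_def)
    show "?i k \<in> Ar C \<and> Dom C (?i k) = tm X k \<and> Cod C (?i k) = tm ?N k \<and>
      ?p k \<bullet> ?i k = Id C (tm X k) \<and> ?i k \<bullet> ?p k = Id C (tm ?N k)" if "k \<le> Suc n" for k
      using that N1 by (auto simp: X_def)
    show "chain_map n C ?N X ?p"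
    proof (rule chain_mapI)
      show "?p k \<in> Ar C \<and> Dom C (?p k) = tm ?N k \<and> Cod C (?p k) = tm X k" if "k \<le> Suc n" for k
        using that N1 by (auto simp: X_def)
      show "?p (Suc k) \<bullet> df ?N k = df X k \<bullet> ?p k" if "k \<le> n" for k
        using that N1 N0 dN1 by (auto simp: X_def)
    qed
  qed
  then show ?thesis by (rule that) (simp_all add: X_def N1)
qed

end

section \<open>The suspension functor and its quasi-inverse\<close>

locale trivially_exangulated_category = positive_exangulated_category +
  assumes ex_trivial_left: "A \<in> Ob C \<Longrightarrow> \<exists>D \<delta>. trivial_exangle D A \<delta>"
    and ex_trivial_right: "D \<in> Ob C \<Longrightarrow> \<exists>A \<delta>. trivial_exangle D A \<delta>"
begin

definition susp_ob where "susp_ob A = (SOME D. \<exists>\<delta>. trivial_exangle D A \<delta>)"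
definition susp_ext where "susp_ext A = (SOME \<delta>. trivial_exangle (susp_ob A) A \<delta>)"
definition loop_ob where "loop_ob D = (SOME A. \<exists>\<delta>. trivial_exangle D A \<delta>)"
definition loop_ext where "loop_ext D = (SOME \<delta>. trivial_exangle D (loop_ob D) \<delta>)"

lemma trivial_susp: "A \<in> Ob C \<Longrightarrow> trivial_exangle (susp_ob A) A (susp_ext A)"
  unfolding susp_ext_def susp_ob_def using ex_trivial_left by (metis (mono_tags, lifting) someI_ex)

lemma trivial_loop: "D \<in> Ob C \<Longrightarrow> trivial_exangle D (loop_ob D) (loop_ext D)"
  unfolding loop_ext_def loop_ob_def using ex_trivial_right by (metis (mono_tags, lifting) someI_ex)

lemmas susp_simps [simp] = trivial_susp[THEN trivial_exangleD(1)] trivial_susp[THEN trivial_exangleD(3)]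
lemmas loop_simps [simp] = trivial_loop[THEN trivial_exangleD(2)] trivial_loop[THEN trivial_exangleD(3)]

text \<open>The unique c for which (f, c) is a morphism between the chosen universal extensions.
  \<open>loop\<close> reverses the roles and solves for the first component.\<close>

definition susp where
  "susp f = (SOME c. c \<in> Ar C \<and> Dom C c = susp_ob (Dom C f) \<and> Cod C c = susp_ob (Cod C f) \<and>
     EMor E c (Id C (Cod C f)) (susp_ext (Cod C f)) = EMor E (Id C (susp_ob (Dom C f))) f (susp_ext (Dom C f)))"

definition loop where
  "loop g = (SOME a. a \<in> Ar C \<and> Dom C a = loop_ob (Dom C g) \<and> Cod C a = loop_ob (Cod C g) \<and>
     EMor E (Id C (Dom C g)) a (loop_ext (Dom C g)) = EMor E g (Id C (loop_ob (Cod C g))) (loop_ext (Cod C g)))"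

lemma susp_props:
  assumes "f \<in> Ar C"
  shows "susp f \<in> Ar C \<and> Dom C (susp f) = susp_ob (Dom C f) \<and> Cod C (susp f) = susp_ob (Cod C f) \<and>
    EMor E (susp f) (Id C (Cod C f)) (susp_ext (Cod C f)) = EMor E (Id C (susp_ob (Dom C f))) f (susp_ext (Dom C f))"
  unfolding susp_def
proof (rule someI_ex)
  obtain c where "c \<in> Ar C" "Dom C c = susp_ob (Dom C f)" "Cod C c = susp_ob (Cod C f)"
    "EMor E c (Id C (Cod C f)) (susp_ext (Cod C f)) = EMor E (Id C (susp_ob (Dom C f))) f (susp_ext (Dom C f))"
    by (rule trivial_pull_surj[OF trivial_susp, of "Cod C f" "susp_ob (Dom C f)"
        "EMor E (Id C (susp_ob (Dom C f))) f (susp_ext (Dom C f))"]) (use assms in auto)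
  then show "\<exists>c. c \<in> Ar C \<and> Dom C c = susp_ob (Dom C f) \<and> Cod C c = susp_ob (Cod C f) \<and>
     EMor E c (Id C (Cod C f)) (susp_ext (Cod C f)) = EMor E (Id C (susp_ob (Dom C f))) f (susp_ext (Dom C f))"
    by blast
qed

lemma loop_props:
  assumes "g \<in> Ar C"
  shows "loop g \<in> Ar C \<and> Dom C (loop g) = loop_ob (Dom C g) \<and> Cod C (loop g) = loop_ob (Cod C g) \<and>
    EMor E (Id C (Dom C g)) (loop g) (loop_ext (Dom C g)) = EMor E g (Id C (loop_ob (Cod C g))) (loop_ext (Cod C g))"
  unfolding loop_def
proof (rule someI_ex)
  obtain a where "a \<in> Ar C" "Dom C a = loop_ob (Dom C g)" "Cod C a = loop_ob (Cod C g)"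
    "EMor E (Id C (Dom C g)) a (loop_ext (Dom C g)) = EMor E g (Id C (loop_ob (Cod C g))) (loop_ext (Cod C g))"
    by (rule trivial_push_surj[OF trivial_loop, of "Dom C g" "loop_ob (Cod C g)"
        "EMor E g (Id C (loop_ob (Cod C g))) (loop_ext (Cod C g))"]) (use assms in auto)
  then show "\<exists>a. a \<in> Ar C \<and> Dom C a = loop_ob (Dom C g) \<and> Cod C a = loop_ob (Cod C g) \<and>
     EMor E (Id C (Dom C g)) a (loop_ext (Dom C g)) = EMor E g (Id C (loop_ob (Cod C g))) (loop_ext (Cod C g))"
    by blast
qed

lemma susp_mor_simps [simp]:
  assumes "f \<in> Ar C"
  shows "susp f \<in> Ar C" "Dom C (susp f) = susp_ob (Dom C f)" "Cod C (susp f) = susp_ob (Cod C f)"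
  using susp_props[OF assms] by auto

lemma loop_mor_simps [simp]:
  assumes "g \<in> Ar C"
  shows "loop g \<in> Ar C" "Dom C (loop g) = loop_ob (Dom C g)" "Cod C (loop g) = loop_ob (Cod C g)"
  using loop_props[OF assms] by auto

text \<open>The defining equation with arbitrary arrows composed on both sides. It trades
  \<open>susp f\<close> in the contravariant argument for f in the covariant one, so that
  suspensions disappear from computations with extensions.\<close>

lemma EMor_susp:
  assumes "f \<in> Ar C" "c \<in> Ar C" "a \<in> Ar C" "Cod C c = susp_ob (Dom C f)" "Dom C a = Cod C f"
  shows "EMor E (susp f \<bullet> c) a (susp_ext (Cod C f)) = EMor E c (a \<bullet> f) (susp_ext (Dom C f))"
proof -
  have "EMor E c a (EMor E (susp f) (Id C (Cod C f)) (susp_ext (Cod C f)))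
     = EMor E c a (EMor E (Id C (susp_ob (Dom C f))) f (susp_ext (Dom C f)))"
    using susp_props[OF assms(1)] by simp
  then show ?thesis using assms by simp
qed

lemma EMor_loop:
  assumes "g \<in> Ar C" "c \<in> Ar C" "a \<in> Ar C" "Cod C c = Dom C g" "Dom C a = loop_ob (Cod C g)"
  shows "EMor E c (a \<bullet> loop g) (loop_ext (Dom C g)) = EMor E (g \<bullet> c) a (loop_ext (Cod C g))"
proof -
  have "EMor E c a (EMor E (Id C (Dom C g)) (loop g) (loop_ext (Dom C g)))
     = EMor E c a (EMor E g (Id C (loop_ob (Cod C g))) (loop_ext (Cod C g)))"
    using loop_props[OF assms(1)] by simp
  then show ?thesis using assms by simp
qed

text \<open>The proof principle for equations between arrows into a suspension: compare the
  extensions that they classify.\<close>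

lemma susp_unique:
  assumes "c \<in> Ar C" "c' \<in> Ar C" "Dom C c = Dom C c'" "Cod C c = susp_ob B" "Cod C c' = susp_ob B" "B \<in> Ob C"
    "EMor E c (Id C B) (susp_ext B) = EMor E c' (Id C B) (susp_ext B)"
  shows "c = c'"
  using trivial_pull_inj[OF trivial_susp] assms by blast

lemma loop_unique:
  assumes "a \<in> Ar C" "a' \<in> Ar C" "Cod C a = Cod C a'" "Dom C a = loop_ob B" "Dom C a' = loop_ob B" "B \<in> Ob C"
    "EMor E (Id C B) a (loop_ext B) = EMor E (Id C B) a' (loop_ext B)"
  shows "a = a'"
  using trivial_push_inj[OF trivial_loop] assms by blast

lemma EMor_susp': "f \<in> Ar C \<Longrightarrow> a \<in> Ar C \<Longrightarrow> Dom C a = Cod C f \<Longrightarrow>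
    EMor E (susp f) a (susp_ext (Cod C f)) = EMor E (Id C (susp_ob (Dom C f))) (a \<bullet> f) (susp_ext (Dom C f))"
  using EMor_susp[of f "Id C (susp_ob (Dom C f))" a] by simp

lemma EMor_loop': "g \<in> Ar C \<Longrightarrow> c \<in> Ar C \<Longrightarrow> Cod C c = Dom C g \<Longrightarrow>
    EMor E c (loop g) (loop_ext (Dom C g)) = EMor E (g \<bullet> c) (Id C (loop_ob (Cod C g))) (loop_ext (Cod C g))"
  using EMor_loop[of g c "Id C (loop_ob (Cod C g))"] by simp

definition Susp where "Susp = \<lparr>FOb = susp_ob, FMor = susp\<rparr>"
definition Loop where "Loop = \<lparr>FOb = loop_ob, FMor = loop\<rparr>"

lemma Susp_functor: "is_functor C Susp"
  unfolding is_functor_def Susp_def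
proof (intro conjI allI ballI, simp_all)
  fix A assume A: "A \<in> Ob C"
  show "susp (Id C A) = Id C (susp_ob A)"
    by (rule susp_unique[of _ _ A]) (use A EMor_susp'[of "Id C A" "Id C A"] in simp_all)
next
  fix A B f assume "f \<in> homset C A B"
  then show "susp f \<in> homset C (susp_ob A) (susp_ob B)" by (auto simp: homset_def)
next
  fix A B D f g assume fg: "f \<in> homset C A B" "g \<in> homset C B D"
  note [simp] = homsetD[OF fg(1)] homsetD[OF fg(2)]
  have "EMor E (susp g \<bullet> susp f) (Id C D) (susp_ext D) = EMor E (susp f) g (susp_ext B)"
    using EMor_susp[of g "susp f" "Id C D"] by simp
  then show "susp (g \<bullet> f) = susp g \<bullet> susp f"
    by (intro susp_unique[of _ _ D])
      (use EMor_susp'[of "g \<bullet> f" "Id C D"] EMor_susp'[of f g] in simp_all)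
qed

lemma Loop_functor: "is_functor C Loop"
  unfolding is_functor_def Loop_def
proof (intro conjI allI ballI, simp_all)
  fix A assume A: "A \<in> Ob C"
  show "loop (Id C A) = Id C (loop_ob A)"
    by (rule loop_unique[of _ _ A]) (use A EMor_loop'[of "Id C A" "Id C A"] in simp_all)
next
  fix A B f assume "f \<in> homset C A B"
  then show "loop f \<in> homset C (loop_ob A) (loop_ob B)" by (auto simp: homset_def)
next
  fix A B D f g assume fg: "f \<in> homset C A B" "g \<in> homset C B D"
  note [simp] = homsetD[OF fg(1)] homsetD[OF fg(2)]
  have "EMor E (Id C A) (loop g \<bullet> loop f) (loop_ext A) = EMor E f (loop g) (loop_ext B)"
    using EMor_loop[of f "Id C A" "loop g"] by simp
  then show "loop (g \<bullet> f) = loop g \<bullet> loop f"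
    by (intro loop_unique[of _ _ A])
      (use EMor_loop'[of "g \<bullet> f" "Id C A"] EMor_loop'[of g f] in simp_all)
qed

text \<open>Both \<open>loop_ext (susp_ob A)\<close> and \<open>susp_ext A\<close> are universal
  over \<open>susp_ob A\<close>. Their comparison is the component at A, and naturality holds
  because both paths push one universal extension to the same result.\<close>

lemma loop_susp: "nat_isomorphic C (comp_functor Loop Susp) id_functor"
proof -
  have "\<exists>\<eta>. \<forall>A \<in> Ob C. \<eta> A \<in> Ar C \<and> Dom C (\<eta> A) = loop_ob (susp_ob A) \<and> Cod C (\<eta> A) = A \<and>
     EMor E (Id C (susp_ob A)) (\<eta> A) (loop_ext (susp_ob A)) = susp_ext A"
    by (rule bchoice) (metis trivial_push_surj trivial_loop susp_simps)
  then obtain \<eta> where \<eta>: "\<And>A. A \<in> Ob C \<Longrightarrow> \<eta> A \<in> Ar C" "\<And>A. A \<in> Ob C \<Longrightarrow> Dom C (\<eta> A) = loop_ob (susp_ob A)"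
    "\<And>A. A \<in> Ob C \<Longrightarrow> Cod C (\<eta> A) = A"
    "\<And>A. A \<in> Ob C \<Longrightarrow> EMor E (Id C (susp_ob A)) (\<eta> A) (loop_ext (susp_ob A)) = susp_ext A"
    by blast
  have iso: "is_iso C (\<eta> A)" if "A \<in> Ob C" for A
    by (rule trivial_push_iso[OF trivial_loop trivial_susp]) (use that \<eta> in auto)
  have nat: "\<eta> B \<bullet> loop (susp f) = f \<bullet> \<eta> A" if "f \<in> homset C A B" for A B f
  proof -
    note [simp] = homsetD[OF that] \<eta>(1-3)
    have "EMor E (Id C (susp_ob A)) (\<eta> B \<bullet> loop (susp f)) (loop_ext (susp_ob A))
      = EMor E (susp f) (\<eta> B) (loop_ext (susp_ob B))"
      using EMor_loop[of "susp f" "Id C (susp_ob A)" "\<eta> B"] by simp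
    also have "\<dots> = EMor E (susp f) (Id C B) (susp_ext B)"
      by (subst \<eta>(4)[symmetric]) simp_all
    also have "\<dots> = EMor E (Id C (susp_ob A)) f (susp_ext A)"
      using EMor_susp'[of f "Id C B"] by simp
    also have "\<dots> = EMor E (Id C (susp_ob A)) (f \<bullet> \<eta> A) (loop_ext (susp_ob A))"
      by (subst \<eta>(4)[symmetric]) simp_all
    finally show ?thesis by (intro loop_unique[of _ _ "susp_ob A"]) simp_all
  qed
  show ?thesis
    unfolding nat_isomorphic_def
    by (rule exI[of _ \<eta>])
      (auto simp: comp_functor_def Loop_def Susp_def id_functor_def homset_def \<eta> iso intro: nat[unfolded homset_def])
qed

text \<open>Dual comparison: \<open>susp_ext (loop_ob A)\<close> and \<open>loop_ext A\<close> are
  universal extensions with the same first term.\<close>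

lemma susp_loop: "nat_isomorphic C (comp_functor Susp Loop) id_functor"
proof -
  have "\<exists>\<eta>. \<forall>A \<in> Ob C. \<eta> A \<in> Ar C \<and> Dom C (\<eta> A) = susp_ob (loop_ob A) \<and> Cod C (\<eta> A) = A \<and>
     EMor E (\<eta> A) (Id C (loop_ob A)) (loop_ext A) = susp_ext (loop_ob A)"
    by (rule bchoice) (metis trivial_pull_surj trivial_loop susp_simps loop_simps)
  then obtain \<eta> where \<eta>: "\<And>A. A \<in> Ob C \<Longrightarrow> \<eta> A \<in> Ar C" "\<And>A. A \<in> Ob C \<Longrightarrow> Dom C (\<eta> A) = susp_ob (loop_ob A)"
    "\<And>A. A \<in> Ob C \<Longrightarrow> Cod C (\<eta> A) = A"
    "\<And>A. A \<in> Ob C \<Longrightarrow> EMor E (\<eta> A) (Id C (loop_ob A)) (loop_ext A) = susp_ext (loop_ob A)"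
    by blast
  have iso: "is_iso C (\<eta> A)" if "A \<in> Ob C" for A
    by (rule trivial_pull_iso[OF trivial_loop trivial_susp]) (use that \<eta> in auto)
  have nat: "\<eta> B \<bullet> susp (loop f) = f \<bullet> \<eta> A" if "f \<in> homset C A B" for A B f
  proof -
    note [simp] = homsetD[OF that] \<eta>(1-3)
    have "EMor E (\<eta> B \<bullet> susp (loop f)) (Id C (loop_ob B)) (loop_ext B)
      = EMor E (susp (loop f)) (Id C (loop_ob B)) (susp_ext (loop_ob B))"
      by (subst \<eta>(4)[symmetric]) simp_all
    also have "\<dots> = EMor E (Id C (susp_ob (loop_ob A))) (loop f) (susp_ext (loop_ob A))"
      using EMor_susp'[of "loop f" "Id C (loop_ob B)"] by simp
    also have "\<dots> = EMor E (\<eta> A) (loop f) (loop_ext A)"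
      by (subst \<eta>(4)[symmetric]) simp_all
    also have "\<dots> = EMor E (f \<bullet> \<eta> A) (Id C (loop_ob B)) (loop_ext B)"
      using EMor_loop'[of f "\<eta> A"] by simp
    finally show ?thesis by (intro trivial_pull_inj[OF trivial_loop, of B]) simp_all
  qed
  show ?thesis
    unfolding nat_isomorphic_def
    by (rule exI[of _ \<eta>])
      (auto simp: comp_functor_def Loop_def Susp_def id_functor_def homset_def \<eta> iso intro: nat[unfolded homset_def])
qed

lemma Susp_auto_equivalence: "auto_equivalence C Susp"
  unfolding auto_equivalence_def using Susp_functor Loop_functor loop_susp susp_loop by blast

lemma Susp_simps [simp]: "FOb Susp = susp_ob" "FMor Susp = susp"
  by (simp_all add: Susp_def)

section \<open>The angulation\<close>

definition angle_ext where
  "angle_ext A = EMor E (df A (Suc n)) (Id C (tm A 0)) (susp_ext (tm A 0))"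

text \<open>By universality of \<open>susp_ext\<close>, a distinguished exangle has exactly one last
  arrow that completes it to an angle with its given extension.\<close>

definition angles where
  "angles = {A. sigma_seq n C Susp A \<and> dist A (angle_ext A)}"

lemma sigma_seqD:
  assumes "sigma_seq n C Susp A"
  shows "i \<le> Suc n \<Longrightarrow> tm A i \<in> Ob C" "i \<le> Suc n \<Longrightarrow> df A i \<in> Ar C"
    "i \<le> Suc n \<Longrightarrow> Dom C (df A i) = tm A i" "i \<le> n \<Longrightarrow> Cod C (df A i) = tm A (Suc i)"
    "Cod C (df A (Suc n)) = susp_ob (tm A 0)"
  using assms by (auto simp: sigma_seq_def homset_def le_Suc_eq)

lemma sigma_seqI:
  assumes "\<And>i. i \<le> n \<Longrightarrow> df A i \<in> Ar C \<and> Dom C (df A i) = tm A i \<and> Cod C (df A i) = tm A (Suc i)"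
    "df A (Suc n) \<in> Ar C" "Dom C (df A (Suc n)) = tm A (Suc n)" "Cod C (df A (Suc n)) = susp_ob (tm A 0)"
  shows "sigma_seq n C Susp A"
proof -
  have "tm A i \<in> Ob C" if "i \<le> Suc n" for i
    using that assms(1)[of i] assms(2,3) dom_ob by (metis le_SucE)
  then show ?thesis using assms by (auto simp: sigma_seq_def homset_def)
qed

lemma seq_morphismD:
  assumes "seq_morphism n C Susp A B \<phi>"
  shows "i \<le> Suc n \<Longrightarrow> \<phi> i \<in> Ar C" "i \<le> Suc n \<Longrightarrow> Dom C (\<phi> i) = tm A i"
    "i \<le> Suc n \<Longrightarrow> Cod C (\<phi> i) = tm B i" "i \<le> n \<Longrightarrow> \<phi> (Suc i) \<bullet> df A i = df B i \<bullet> \<phi> i"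
    "susp (\<phi> 0) \<bullet> df A (Suc n) = df B (Suc n) \<bullet> \<phi> (Suc n)"
  using assms by (auto simp: seq_morphism_def homset_def)

lemma seq_morphism_chain_map: "seq_morphism n C Susp A B \<phi> \<Longrightarrow> chain_map n C A B \<phi>"
  by (auto simp: seq_morphism_def chain_map_def)

lemma angles_iso:
  assumes "A \<in> angles" "sigma_seq n C Susp B" "seq_isomorphic n C Susp A B"
  shows "B \<in> angles"
proof -
  obtain \<phi> where \<phi>: "seq_morphism n C Susp A B \<phi>" "\<And>i. i \<le> Suc n \<Longrightarrow> is_iso C (\<phi> i)"
    using assms(3) by (auto simp: seq_isomorphic_def)
  note p [simp] = seq_morphismD(1-3)[OF \<phi>(1)] and B [simp] = sigma_seqD[OF assms(2)]
  have A: "dist A (angle_ext A)" "sigma_seq n C Susp A" using assms(1) by (auto simp: angles_def)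
  note A' [simp] = sigma_seqD[OF A(2)]
  have "\<exists>i. \<forall>k \<in> {..Suc n}. i k \<in> Ar C \<and> Dom C (i k) = tm B k \<and> Cod C (i k) = tm A k \<and>
      \<phi> k \<bullet> i k = Id C (tm B k) \<and> i k \<bullet> \<phi> k = Id C (tm A k)"
    by (rule bchoice) (use \<phi>(2) in \<open>force simp: is_iso_def homset_def\<close>)
  then obtain i where i: "\<And>k. k \<le> Suc n \<Longrightarrow> i k \<in> Ar C \<and> Dom C (i k) = tm B k \<and> Cod C (i k) = tm A k \<and>
      \<phi> k \<bullet> i k = Id C (tm B k) \<and> i k \<bullet> \<phi> k = Id C (tm A k)"
    by auto
  have "dist B (EMor E (i (Suc n)) (\<phi> 0) (angle_ext A))"
    by (rule distinguished_iso[OF A(1) _ seq_morphism_chain_map[OF \<phi>(1)] i]) simp_all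
  \<comment> \<open>The last square of \<phi> determines the last arrow of B from that of A, and
    \<open>EMor_susp\<close> turns the factor \<open>susp (\<phi> 0)\<close> into a push-forward
    along \<open>\<phi> 0\<close>.\<close>
  also have "EMor E (i (Suc n)) (\<phi> 0) (angle_ext A) = angle_ext B"
  proof -
    have i' [simp]: "i (Suc n) \<in> Ar C" "Dom C (i (Suc n)) = tm B (Suc n)" "Cod C (i (Suc n)) = tm A (Suc n)"
      "\<phi> (Suc n) \<bullet> i (Suc n) = Id C (tm B (Suc n))"
      using i[of "Suc n"] by auto
    have "df B (Suc n) = df B (Suc n) \<bullet> (\<phi> (Suc n) \<bullet> i (Suc n))" by simp
    also have "\<dots> = (df B (Suc n) \<bullet> \<phi> (Suc n)) \<bullet> i (Suc n)" by (simp del: i'(4))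
    also have "\<dots> = susp (\<phi> 0) \<bullet> (df A (Suc n) \<bullet> i (Suc n))"
      unfolding seq_morphismD(5)[OF \<phi>(1), symmetric] by simp
    finally show ?thesis
      using EMor_susp[of "\<phi> 0" "df A (Suc n) \<bullet> i (Suc n)" "Id C (tm B 0)"]
      by (simp add: angle_ext_def)
  qed
  finally show ?thesis using assms(2) by (simp add: angles_def)
qed

lemma angles_id:
  assumes [simp]: "A \<in> Ob C"
  shows "seq_id n C Susp A \<in> angles"
proof -
  have "sigma_seq n C Susp (seq_id n C Susp A)"
    by (rule sigma_seqI) (auto simp: seq_id_def id_left_def)
  moreover have "dist (seq_id n C Susp A) (ext_zero E (zero_ob C) A)"
    by (rule distinguished_cong[OF R2_left[of A]]) (auto simp: seq_id_def)
  moreover have "angle_ext (seq_id n C Susp A) = ext_zero E (zero_ob C) A"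
    by (simp add: angle_ext_def seq_id_def id_left_def)
  ultimately show ?thesis by (simp add: angles_def)
qed

text \<open>A trivial exangle on the domain makes f an inflation; the arrow classifying the
  resulting extension is taken as last arrow.\<close>

lemma angles_ex:
  assumes "f \<in> Ar C"
  shows "\<exists>A \<in> angles. df A 0 = f"
proof -
  obtain X \<rho> where X: "dist X \<rho>" "df X 0 = f" "tm X 0 = Dom C f"
    using trivial_inflation_all[OF trivial_susp, of f] assms by auto
  note [simp] = distinguishedD[OF X(1)] cplxD[OF distinguishedD(1)[OF X(1)]] X(3)
  have \<rho>: "\<rho> \<in> ext E (tm X (Suc n)) (Dom C f)" using distinguishedD(2)[OF X(1)] by simp
  obtain c where c: "c \<in> Ar C" "Dom C c = tm X (Suc n)" "Cod C c = susp_ob (Dom C f)"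
    "EMor E c (Id C (Dom C f)) (susp_ext (Dom C f)) = \<rho>"
    using trivial_pull_surj[OF trivial_susp _ \<rho>] assms by auto
  define A where "A = X\<lparr>df := (df X)(Suc n := c)\<rparr>"
  have "sigma_seq n C Susp A"
    by (rule sigma_seqI) (auto simp: A_def c)
  moreover have "dist A \<rho>"
    by (rule distinguished_cong[OF X(1)]) (auto simp: A_def)
  moreover have "angle_ext A = \<rho>" using c by (simp add: angle_ext_def A_def)
  ultimately show ?thesis using X(2) by (intro bexI[of _ A]) (auto simp: angles_def A_def)
qed

lemma EMor_sg_swap:
  "c \<in> Ar C \<Longrightarrow> a \<in> Ar C \<Longrightarrow> \<delta> \<in> ext E (Cod C c) (Dom C a) \<Longrightarrow>
    EMor E c (sg k a) \<delta> = EMor E (sg k c) a \<delta>"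
  by (simp add: sg_def EMor_mneg_swap)

lemma angle_ext_closed [simp]:
  assumes "sigma_seq n C Susp A"
  shows "angle_ext A \<in> ext E (tm A (Suc n)) (tm A 0)"
  using sigma_seqD[OF assms] by (simp add: angle_ext_def)

lemma sigma_sum_eq: "sigma_sum C Susp A B = row C (susp (inj1 C A B)) (susp (inj2 C A B))"
  by (simp add: sigma_sum_def)

text \<open>The composite expands to a sum of two arrows, each beginning with u or v and followed by
  the suspension of an injection. Moving the suspensions across shows that \<open>sigma_sum\<close>
  is the comparison matching sums of extensions.\<close>

lemma EMor_sigma_sum:
  assumes [simp]: "u \<in> Ar C" "v \<in> Ar C" "Dom C u = Dom C v" "Cod C u = susp_ob A" "Cod C v = susp_ob B"
    "A \<in> Ob C" "B \<in> Ob C"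
  shows "EMor E (sigma_sum C Susp A B \<bullet> col C u v) (Id C (dsum C A B)) (susp_ext (dsum C A B))
    = EMor E u (inj1 C A B) (susp_ext A) \<otimes>\<^bsub>EOb E (Dom C v) (dsum C A B)\<^esub> EMor E v (inj2 C A B) (susp_ext B)"
  using EMor_susp[of "inj1 C A B" u "Id C (dsum C A B)"] EMor_susp[of "inj2 C A B" v "Id C (dsum C A B)"]
  by (simp add: sigma_sum_eq EMor_madd_left)

lemma seq_dsum_simps:
  assumes "sigma_seq n C Susp A" "sigma_seq n C Susp B"
  shows "tm (seq_dsum n C Susp A B) i = dsum C (tm A i) (tm B i)"
    "i \<le> n \<Longrightarrow> df (seq_dsum n C Susp A B) i =
       col C (df A i \<bullet> proj1 C (tm A i) (tm B i)) (df B i \<bullet> proj2 C (tm A i) (tm B i))"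
    "df (seq_dsum n C Susp A B) (Suc n) = sigma_sum C Susp (tm A 0) (tm B 0) \<bullet>
       col C (df A (Suc n) \<bullet> proj1 C (tm A (Suc n)) (tm B (Suc n)))
             (df B (Suc n) \<bullet> proj2 C (tm A (Suc n)) (tm B (Suc n)))"
  using sigma_seqD[OF assms(1)] sigma_seqD[OF assms(2)]
  by (simp_all add: seq_dsum_def Let_def mat_def col_row_zero)

lemma sigma_seq_dsum:
  assumes "sigma_seq n C Susp A" "sigma_seq n C Susp B"
  shows "sigma_seq n C Susp (seq_dsum n C Susp A B)"
proof -
  note [simp] = sigma_seqD[OF assms(1)] sigma_seqD[OF assms(2)]
  show ?thesis
    by (rule sigma_seqI) (simp_all add: seq_dsum_simps[OF assms] sigma_sum_eq)
qed

lemma angle_ext_dsum: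
  assumes "sigma_seq n C Susp A" "sigma_seq n C Susp B"
  shows "angle_ext (seq_dsum n C Susp A B) =
    EMor E (proj1 C (tm A (Suc n)) (tm B (Suc n))) (inj1 C (tm A 0) (tm B 0)) (angle_ext A)
    \<otimes>\<^bsub>EOb E (dsum C (tm A (Suc n)) (tm B (Suc n))) (dsum C (tm A 0) (tm B 0))\<^esub>
    EMor E (proj2 C (tm A (Suc n)) (tm B (Suc n))) (inj2 C (tm A 0) (tm B 0)) (angle_ext B)"
proof -
  note [simp] = sigma_seqD[OF assms(1)] sigma_seqD[OF assms(2)]
  show ?thesis
    unfolding angle_ext_def seq_dsum_simps[OF assms] by (subst EMor_sigma_sum) simp_all
qed

lemma dsum_chain_maps:
  assumes "sigma_seq n C Susp A" "sigma_seq n C Susp B"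
  shows "chain_map n C A (seq_dsum n C Susp A B) (\<lambda>i. inj1 C (tm A i) (tm B i))"
    "chain_map n C B (seq_dsum n C Susp A B) (\<lambda>i. inj2 C (tm A i) (tm B i))"
    "chain_map n C (seq_dsum n C Susp A B) A (\<lambda>i. proj1 C (tm A i) (tm B i))"
    "chain_map n C (seq_dsum n C Susp A B) B (\<lambda>i. proj2 C (tm A i) (tm B i))"
proof -
  note [simp] = sigma_seqD[OF assms(1)] sigma_seqD[OF assms(2)] seq_dsum_simps[OF assms]
  show "chain_map n C A (seq_dsum n C Susp A B) (\<lambda>i. inj1 C (tm A i) (tm B i))"
    "chain_map n C B (seq_dsum n C Susp A B) (\<lambda>i. inj2 C (tm A i) (tm B i))"
    "chain_map n C (seq_dsum n C Susp A B) A (\<lambda>i. proj1 C (tm A i) (tm B i))"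
    "chain_map n C (seq_dsum n C Susp A B) B (\<lambda>i. proj2 C (tm A i) (tm B i))"
    by (rule chain_mapI; simp add: col_row_zero)+
qed

lemma angles_sum:
  assumes "A \<in> angles" "B \<in> angles"
  shows "seq_dsum n C Susp A B \<in> angles"
proof -
  have AB: "sigma_seq n C Susp A" "sigma_seq n C Susp B" "dist A (angle_ext A)" "dist B (angle_ext B)"
    using assms by (auto simp: angles_def)
  note AB' [simp] = sigma_seqD[OF AB(1)] sigma_seqD[OF AB(2)]
  note Z [simp] = sigma_seqD[OF sigma_seq_dsum[OF AB(1,2)]] and t [simp] = seq_dsum_simps(1)[OF AB(1,2)]
  have "dist (seq_dsum n C Susp A B) (angle_ext (seq_dsum n C Susp A B))"
    unfolding angle_ext_dsum[OF AB(1,2)] t[of "Suc n", symmetric] t[of 0, symmetric]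
    by (rule distinguished_sum[OF AB(3,4) _ dsum_chain_maps[OF AB(1,2)]]) simp_all
  then show ?thesis using sigma_seq_dsum[OF AB(1,2)] by (simp add: angles_def)
qed

text \<open>Each summand is a retract, and the sum of the two extensions restricts and projects to
  the extension of that summand.\<close>

lemma angles_summand:
  assumes A: "sigma_seq n C Susp A" and B: "sigma_seq n C Susp B" and "seq_dsum n C Susp A B \<in> angles"
  shows "A \<in> angles" "B \<in> angles"
proof -
  have d: "dist (seq_dsum n C Susp A B) (angle_ext (seq_dsum n C Susp A B))"
    using assms(3) by (simp add: angles_def)
  note [simp] = sigma_seqD[OF A] sigma_seqD[OF B] A B seq_dsum_simps(1)[OF A B]
  have "dist A (angle_ext A)"
    by (rule distinguished_retract[OF d _ dsum_chain_maps(1,3)[OF A B]])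
      (simp_all add: angle_ext_dsum[OF A B])
  then show "A \<in> angles" by (simp add: angles_def)
  have "dist B (angle_ext B)"
    by (rule distinguished_retract[OF d _ dsum_chain_maps(2,4)[OF A B]])
      (simp_all add: angle_ext_dsum[OF A B])
  then show "B \<in> angles" by (simp add: angles_def)
qed

section \<open>Rotation of angles\<close>

lemma left_rotation_simps:
  "i \<le> n \<Longrightarrow> tm (left_rotation n C Susp A) i = tm A (Suc i)"
  "tm (left_rotation n C Susp A) (Suc n) = susp_ob (tm A 0)"
  "i \<le> n \<Longrightarrow> df (left_rotation n C Susp A) i = df A (Suc i)"
  "df (left_rotation n C Susp A) (Suc n) = sg n (susp (df A 0))"
  by (simp_all add: left_rotation_def sg_def)

lemma sigma_seq_left_rotation:
  assumes "sigma_seq n C Susp A"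
  shows "sigma_seq n C Susp (left_rotation n C Susp A)"
proof -
  note [simp] = sigma_seqD[OF assms] left_rotation_simps
  have "Cod C (df A (Suc i)) = tm (left_rotation n C Susp A) (Suc i)" if "i \<le> n" for i
    using that by (cases "i = n") auto
  then show ?thesis by (intro sigma_seqI) simp_all
qed

text \<open>The sign is left on the identity of the suspension, because this is the automorphism
  through which the extension of the cone is transported.\<close>

lemma angle_ext_left_rotation:
  assumes "sigma_seq n C Susp A"
  shows "angle_ext (left_rotation n C Susp A) = EMor E (sg n (Id C (susp_ob (tm A 0)))) (df A 0) (susp_ext (tm A 0))"
proof -
  note [simp] = sigma_seqD[OF assms] left_rotation_simps
  show ?thesis
    using EMor_susp[of "df A 0" "sg n (Id C (susp_ob (tm A 0)))" "Id C (tm A (Suc 0))"]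
    by (simp add: angle_ext_def)
qed

text \<open>Lift A to the trivial exangle T of its first term along the last arrow of A. In the cone
  the middle terms of T are zero, which leaves the terms of the rotation, and the extension is the
  push-forward of the universal one along \<open>df A 0\<close>.\<close>

lemma left_rotation_angle:
  assumes "A \<in> angles"
  shows "left_rotation n C Susp A \<in> angles"
proof -
  have A: "sigma_seq n C Susp A" "dist A (angle_ext A)" using assms by (auto simp: angles_def)
  let ?L = "left_rotation n C Susp A" and ?\<delta> = "susp_ext (tm A 0)"
  note L [simp] = sigma_seqD[OF A(1)] left_rotation_simps
  have A0: "tm A 0 \<in> Ob C" by simp
  obtain T where T: "dist T ?\<delta>" "tm T 0 = tm A 0" "tm T (Suc n) = susp_ob (tm A 0)"
    "\<And>i. 1 \<le> i \<Longrightarrow> i \<le> n \<Longrightarrow> zero_object C (tm T i)" "df T n = mzero C (tm T n) (susp_ob (tm A 0))"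
    using trivial_exangleE[OF trivial_susp[OF A0]] by metis
  note T' [simp] = distinguishedD[OF T(1)] cplxD[OF distinguishedD(1)[OF T(1)]] T(2,3,5)
  obtain f where f: "chain_map n C A T f" "f (Suc n) = df A (Suc n)"
    "dist (cone n C A T f) (EMor E (Id C (susp_ob (tm A 0))) (df A 0) ?\<delta>)"
    by (rule cone_lift[of A "df A (Suc n)" T ?\<delta>]) (use A T(1) in \<open>auto simp: angle_ext_def\<close>)
  note f' [simp] = chain_mapD(1-3)[OF f(1)] f(2)
  \<comment> \<open>The first n differentials of the cone are negated and the last one is not.
    Degree k is therefore scaled by (-1)^k up to n, and degree n + 1 keeps (-1)^n, the sign in the
    rotation.\<close>
  let ?p = "\<lambda>k. if k = 0 then Id C (tm A 1) else if k \<le> n then sg k (proj1 C (tm A (Suc k)) (tm T k))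
     else sg n (Id C (susp_ob (tm A 0)))"
  let ?i = "\<lambda>k. if k = 0 then Id C (tm A 1) else if k \<le> n then sg k (inj1 C (tm A (Suc k)) (tm T k))
     else sg n (Id C (susp_ob (tm A 0)))"
  have [simp]: "inj1 C (tm A (Suc k)) (tm T k) \<bullet> proj1 C (tm A (Suc k)) (tm T k)
      = Id C (dsum C (tm A (Suc k)) (tm T k))" if "0 < k" "k \<le> n" for k
    using that inj1_proj1_zero T(4) by simp
  have "dist ?L (EMor E (?i (Suc n)) (?p 0) (EMor E (Id C (susp_ob (tm A 0))) (df A 0) ?\<delta>))"
  proof (rule distinguished_iso[OF f(3), where p = ?p and i = ?i])
    show "df ?L k \<in> Ar C \<and> Dom C (df ?L k) = tm ?L k \<and> Cod C (df ?L k) = tm ?L (Suc k)" if "k \<le> n" for k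
      using that sigma_seqD[OF sigma_seq_left_rotation[OF A(1)]] by (simp del: L)
    show "?i k \<in> Ar C \<and> Dom C (?i k) = tm ?L k \<and> Cod C (?i k) = tm (cone n C A T f) k \<and>
      ?p k \<bullet> ?i k = Id C (tm ?L k) \<and> ?i k \<bullet> ?p k = Id C (tm (cone n C A T f) k)" if "k \<le> Suc n" for k
    proof (cases "k = Suc n")
      case False
      then show ?thesis using that by (cases "k = 0") (auto simp: cone_def)
    qed (simp add: cone_def)
    show "chain_map n C (cone n C A T f) ?L ?p"
    proof (rule chain_mapI)
      show "?p k \<in> Ar C \<and> Dom C (?p k) = tm (cone n C A T f) k \<and> Cod C (?p k) = tm ?L k"
        if "k \<le> Suc n" for k
      proof (cases "k = Suc n")
        case False
        then show ?thesis using that by (cases "k = 0") (auto simp: cone_def)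
      qed (simp add: cone_def)
      show "?p (Suc k) \<bullet> df (cone n C A T f) k = df ?L k \<bullet> ?p k" if k: "k \<le> n" for k
      proof -
        consider "k = 0" | "0 < k" "k < n" | "k = n" "0 < k" using k n_ge_1 by linarith
        then show ?thesis
          by cases (auto simp: cone_def mat_def col_row_zero)
      qed
    qed
  qed
  then have "dist ?L (angle_ext ?L)"
    using angle_ext_left_rotation[OF A(1)] by simp
  then show ?thesis using sigma_seq_left_rotation[OF A(1)] by (simp add: angles_def)
qed

text \<open>Dually, take the cocone of a lift from the trivial exangle of \<open>tm A 0\<close> to
  the rotation. The sign of the rotated extension is moved to the first component of the lift, which
  becomes (-1)^n times \<open>df A 0\<close>.\<close>

lemma left_rotation_angle_converse:
  assumes A: "sigma_seq n C Susp A" and "left_rotation n C Susp A \<in> angles"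
  shows "A \<in> angles"
proof -
  let ?L = "left_rotation n C Susp A" and ?\<delta> = "susp_ext (tm A 0)"
  have L: "dist ?L (angle_ext ?L)" using assms by (simp add: angles_def)
  note L' [simp] = sigma_seqD[OF A] left_rotation_simps
  have A0: "tm A 0 \<in> Ob C" by simp
  obtain T where T: "dist T ?\<delta>" "tm T 0 = tm A 0" "tm T (Suc n) = susp_ob (tm A 0)"
    "\<And>i. 1 \<le> i \<Longrightarrow> i \<le> n \<Longrightarrow> zero_object C (tm T i)"
    using trivial_exangleE[OF trivial_susp[OF A0]] by metis
  note T' [simp] = distinguishedD[OF T(1)] cplxD[OF distinguishedD(1)[OF T(1)]] T(2,3)
  have "angle_ext ?L = EMor E (Id C (susp_ob (tm A 0))) (sg n (df A 0)) ?\<delta>"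
    using EMor_sg_swap[of "Id C (susp_ob (tm A 0))" "df A 0" ?\<delta> n] by (simp add: angle_ext_left_rotation[OF A])
  then obtain h where h: "chain_map n C T ?L h" "h 0 = sg n (df A 0)"
    "dist (cocone n C T ?L h) (EMor E (df ?L n) (Id C (tm A 0)) ?\<delta>)"
    using cocone_lift[OF T(1), of ?L "sg n (df A 0)"] L by (auto simp del: L'(6-9) simp: left_rotation_simps)
  have h0 [simp]: "h k = mzero C (tm T k) (tm A (Suc k))" if "0 < k" "k \<le> n" for k
    using chain_mapD(1-3)[OF h(1), of k] T(4)[of k] from_zero[of "h k"] that by simp
  \<comment> \<open>The sign (-1)^n of the first differential cancels against the n negated ones
    that follow, so both ends can be identities and the extension is unchanged.\<close>
  let ?p = "\<lambda>k. if k = 0 then Id C (tm A 0) else if k \<le> n then sg (n + Suc k) (proj1 C (tm A k) (tm T k))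
     else Id C (tm A (Suc n))"
  let ?i = "\<lambda>k. if k = 0 then Id C (tm A 0) else if k \<le> n then sg (n + Suc k) (inj1 C (tm A k) (tm T k))
     else Id C (tm A (Suc n))"
  have [simp]: "inj1 C (tm A k) (tm T k) \<bullet> proj1 C (tm A k) (tm T k)
      = Id C (dsum C (tm A k) (tm T k))" if "0 < k" "k \<le> n" for k
    using that inj1_proj1_zero T(4) by simp
  have L1: "tm ?L (k - Suc 0) = tm A k" "df ?L (k - Suc 0) = df A k" if "0 < k" "k \<le> n" for k
    using that by (cases k; simp)+
  have "dist A (EMor E (?i (Suc n)) (?p 0) (EMor E (df ?L n) (Id C (tm A 0)) ?\<delta>))"
  proof (rule distinguished_iso[OF h(3), where p = ?p and i = ?i])
    show "df A k \<in> Ar C \<and> Dom C (df A k) = tm A k \<and> Cod C (df A k) = tm A (Suc k)" if "k \<le> n" for k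
      using that by simp
    show "?i k \<in> Ar C \<and> Dom C (?i k) = tm A k \<and> Cod C (?i k) = tm (cocone n C T ?L h) k \<and>
      ?p k \<bullet> ?i k = Id C (tm A k) \<and> ?i k \<bullet> ?p k = Id C (tm (cocone n C T ?L h) k)" if "k \<le> Suc n" for k
    proof (cases "k = Suc n")
      case False
      then show ?thesis using that by (cases "k = 0") (auto simp: cocone_def L1)
    qed (simp add: cocone_def)
    show "chain_map n C (cocone n C T ?L h) A ?p"
    proof (rule chain_mapI)
      show "?p k \<in> Ar C \<and> Dom C (?p k) = tm (cocone n C T ?L h) k \<and> Cod C (?p k) = tm A k"
        if "k \<le> Suc n" for k
      proof (cases "k = Suc n")
        case False
        then show ?thesis using that by (cases "k = 0") (auto simp: cocone_def L1)
      qed (simp add: cocone_def)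
      show "?p (Suc k) \<bullet> df (cocone n C T ?L h) k = df A k \<bullet> ?p k" if k: "k \<le> n" for k
      proof -
        consider "k = 0" | "0 < k" "k < n" | "k = n" "0 < k" using k n_ge_1 by linarith
        then show ?thesis
          by cases (auto simp: cocone_def mat_def col_row_zero h(2) L1)
      qed
    qed
  qed
  then have "dist A (angle_ext A)" by (simp add: angle_ext_def)
  then show ?thesis using A by (simp add: angles_def)
qed

text \<open>
  The cone of a morphism \<open>\<phi>\<close> of angles \<open>A \<rightarrow> B\<close> is an exangle cone over an identity: \<open>A\<close> and the
  trivial sequence on \<open>B\<^sub>0\<close> are summed and twisted by \<open>\<phi>\<^sub>0\<close>, \<open>B\<close> is summed with the trivial
  exangle of \<open>A\<^sub>0\<close>, so that both complexes start at \<open>A\<^sub>0 \<oplus> B\<^sub>0\<close>.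
\<close>

definition twisted_sum where
  "twisted_sum A B \<phi>0 = \<lparr>
     tm = (\<lambda>k. if k = 0 then dsum C (tm A 0) (tm B 0) else if k = 1 then dsum C (tm A 1) (tm B 0) else tm A k),
     df = (\<lambda>k. if k = 0 then mat C (df A 0) (mzero C (tm B 0) (tm A 1)) (\<boxminus> \<phi>0) (Id C (tm B 0))
       else if k = 1 then row C (df A 1) (mzero C (tm B 0) (tm A 2)) else df A k)\<rparr>"

definition trivial_sum where
  "trivial_sum A B = \<lparr>
     tm = (\<lambda>k. if k = 0 then dsum C (tm A 0) (tm B 0) else if k \<le> n then tm B k
       else dsum C (susp_ob (tm A 0)) (tm B (Suc n))),
     df = (\<lambda>k. if k = 0 then row C (mzero C (tm A 0) (tm B 1)) (df B 0) else if k < n then df B k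
       else col C (mzero C (tm B n) (susp_ob (tm A 0))) (df B n))\<rparr>"

text \<open>The complex is the sum of A and the identity complex on \<open>tm B 0\<close>, with A
  included in degree 0 as the graph of \<phi>0. The second summand carries the zero extension, so
  what remains is the extension of A pushed along the graph.\<close>

lemma twisted_sum_distinguished:
  assumes A: "A \<in> angles" and B: "sigma_seq n C Susp B"
    and \<phi>0: "\<phi>0 \<in> Ar C" "Dom C \<phi>0 = tm A 0" "Cod C \<phi>0 = tm B 0"
  shows "dist (twisted_sum A B \<phi>0) (EMor E (Id C (tm A (Suc n))) (col C (Id C (tm A 0)) \<phi>0) (angle_ext A))"
proof -
  have A': "sigma_seq n C Susp A" "dist A (angle_ext A)" using A by (auto simp: angles_def)
  note [simp] = sigma_seqD[OF A'(1)] sigma_seqD[OF B] \<phi>0 angle_ext_closed[OF A'(1)]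
  have two: "2 = Suc (Suc 0)" by simp
  define X where "X = twisted_sum A B \<phi>0"
  define T where "T = id_left C (tm B 0)"
  have T: "dist T (ext_zero E (zero_ob C) (tm B 0))" unfolding T_def by (rule R2_left) simp
  have Tt [simp]: "tm T k = (if k \<le> 1 then tm B 0 else zero_ob C)"
    "df T k = (if k = 0 then Id C (tm B 0) else if k = 1 then mzero C (tm B 0) (zero_ob C) else mzero C (zero_ob C) (zero_ob C))"
    for k by (auto simp: T_def id_left_def)
  have [simp]: "mzero C (zero_ob C) (zero_ob C) = Id C (zero_ob C)"
    using into_zero[of "Id C (zero_ob C)"] zero_object_zero_ob by simp
  let ?i = "\<lambda>k. if k = 0 then col C (Id C (tm A 0)) \<phi>0 else if k = 1 then inj1 C (tm A 1) (tm B 0) else Id C (tm A k)"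
  let ?p = "\<lambda>k. if k = 0 then proj1 C (tm A 0) (tm B 0) else if k = 1 then proj1 C (tm A 1) (tm B 0) else Id C (tm A k)"
  let ?j = "\<lambda>k. if k = 0 then inj2 C (tm A 0) (tm B 0) else if k = 1 then inj2 C (tm A 1) (tm B 0) else mzero C (zero_ob C) (tm A k)"
  let ?q = "\<lambda>k. if k = 0 then row C (\<boxminus> \<phi>0) (Id C (tm B 0)) else if k = 1 then proj2 C (tm A 1) (tm B 0) else mzero C (tm A k) (zero_ob C)"
  have cases: "P k" if "P 0" "P 1" "\<And>k. k > 1 \<Longrightarrow> P k" for P and k :: nat
    using that by (cases "k = 0"; cases "k = 1") auto
  have "dist X (EMor E (?p (Suc n)) (?i 0) (angle_ext A) \<otimes>\<^bsub>EOb E (tm X (Suc n)) (tm X 0)\<^esub>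
     EMor E (?q (Suc n)) (?j 0) (ext_zero E (zero_ob C) (tm B 0)))"
  proof (rule distinguished_sum[OF A'(2) T, where p = ?p and i = ?i and q = ?q and j = ?j])
    show "df X k \<in> Ar C \<and> Dom C (df X k) = tm X k \<and> Cod C (df X k) = tm X (Suc k)" if "k \<le> n" for k
      using that by (auto simp: X_def twisted_sum_def mat_def two)
    have 1: "\<lbrakk>k \<le> Suc n\<rbrakk> \<Longrightarrow> ?i k \<in> Ar C \<and> Dom C (?i k) = tm A k \<and> Cod C (?i k) = tm X k"
      "\<lbrakk>k \<le> Suc n\<rbrakk> \<Longrightarrow> ?p k \<in> Ar C \<and> Dom C (?p k) = tm X k \<and> Cod C (?p k) = tm A k"
      "\<lbrakk>k \<le> Suc n\<rbrakk> \<Longrightarrow> ?j k \<in> Ar C \<and> Dom C (?j k) = tm T k \<and> Cod C (?j k) = tm X k"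
      "\<lbrakk>k \<le> Suc n\<rbrakk> \<Longrightarrow> ?q k \<in> Ar C \<and> Dom C (?q k) = tm X k \<and> Cod C (?q k) = tm T k" for k
      by (auto simp: X_def twisted_sum_def)
    show "chain_map n C A X ?i"
    proof (rule chain_mapI)
      show "?i (Suc k) \<bullet> df A k = df X k \<bullet> ?i k" if "k \<le> n" for k
        using that by (induction k rule: cases) (auto simp: X_def twisted_sum_def mat_def two col_row_zero)
    qed (rule 1)
    show "chain_map n C T X ?j"
    proof (rule chain_mapI)
      show "?j (Suc k) \<bullet> df T k = df X k \<bullet> ?j k" if "k \<le> n" for k
        using that by (induction k rule: cases) (auto simp: X_def twisted_sum_def mat_def two col_row_zero)
    qed (rule 1)
    show "chain_map n C X A ?p"
    proof (rule chain_mapI)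
      show "?p (Suc k) \<bullet> df X k = df A k \<bullet> ?p k" if "k \<le> n" for k
        using that by (induction k rule: cases) (auto simp: X_def twisted_sum_def mat_def two col_row_zero)
    qed (rule 1)
    show "chain_map n C X T ?q"
    proof (rule chain_mapI)
      show "?q (Suc k) \<bullet> df X k = df T k \<bullet> ?q k" if "k \<le> n" for k
        using that by (induction k rule: cases) (auto simp: X_def twisted_sum_def mat_def two col_row_zero)
    qed (rule 1)
    have "(col C (Id C (tm A 0)) \<phi>0 \<bullet> proj1 C (tm A 0) (tm B 0)) \<boxplus> (inj2 C (tm A 0) (tm B 0) \<bullet> row C (\<boxminus> \<phi>0) (Id C (tm B 0)))
       = Id C (dsum C (tm A 0) (tm B 0))"
      by (rule row_ext[of _ _ "tm A 0" "tm B 0"]; (rule col_ext[of _ _ "tm A 0" "tm B 0"])?) simp_all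
    then show "(?i k \<bullet> ?p k) \<boxplus> (?j k \<bullet> ?q k) = Id C (tm X k)" if "k \<le> Suc n" for k
      using that by (induction k rule: cases) (auto simp: X_def twisted_sum_def)
  qed simp_all
  then show ?thesis by (simp add: X_def twisted_sum_def)
qed

text \<open>The middle terms of the trivial exangle are dropped: its inclusion and projection are
  zero there, and those of B are identities. Compatibility in the outer degrees comes from the
  vanishing of the outer differentials of the trivial exangle.\<close>

lemma trivial_sum_distinguished:
  assumes A: "tm A 0 \<in> Ob C" and B: "B \<in> angles"
  shows "dist (trivial_sum A B)
    (EMor E (proj1 C (susp_ob (tm A 0)) (tm B (Suc n))) (inj1 C (tm A 0) (tm B 0)) (susp_ext (tm A 0))
     \<otimes>\<^bsub>EOb E (dsum C (susp_ob (tm A 0)) (tm B (Suc n))) (dsum C (tm A 0) (tm B 0))\<^esub>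
     EMor E (proj2 C (susp_ob (tm A 0)) (tm B (Suc n))) (inj2 C (tm A 0) (tm B 0)) (angle_ext B))"
proof -
  have B': "sigma_seq n C Susp B" "dist B (angle_ext B)" using B by (auto simp: angles_def)
  note [simp] = sigma_seqD[OF B'(1)] A
  obtain T where T: "dist T (susp_ext (tm A 0))" "tm T 0 = tm A 0" "tm T (Suc n) = susp_ob (tm A 0)"
    "df T 0 = mzero C (tm A 0) (tm T 1)" "df T n = mzero C (tm T n) (susp_ob (tm A 0))"
    using trivial_exangleE[OF trivial_susp[OF A]] by metis
  note T' [simp] = distinguishedD[OF T(1)] cplxD[OF distinguishedD(1)[OF T(1)]] T(2-5)
  define Y where "Y = trivial_sum A B"
  let ?S = "susp_ob (tm A 0)" and ?B = "tm B (Suc n)"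
  let ?i = "\<lambda>k. if k = 0 then inj1 C (tm A 0) (tm B 0) else if k \<le> n then mzero C (tm T k) (tm B k) else inj1 C ?S ?B"
  let ?p = "\<lambda>k. if k = 0 then proj1 C (tm A 0) (tm B 0) else if k \<le> n then mzero C (tm B k) (tm T k) else proj1 C ?S ?B"
  let ?j = "\<lambda>k. if k = 0 then inj2 C (tm A 0) (tm B 0) else if k \<le> n then Id C (tm B k) else inj2 C ?S ?B"
  let ?q = "\<lambda>k. if k = 0 then proj2 C (tm A 0) (tm B 0) else if k \<le> n then Id C (tm B k) else proj2 C ?S ?B"
  have cases: "P k" if "k \<le> n" "P 0" "P n" "\<And>k. k > 0 \<Longrightarrow> k < n \<Longrightarrow> P k" for P and k :: nat
    using that by (cases "k = 0"; cases "k = n") auto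
  have Suc_cases: "P k" if "k \<le> Suc n" "P 0" "P (Suc n)" "\<And>k. k > 0 \<Longrightarrow> k \<le> n \<Longrightarrow> P k" for P and k :: nat
    using that by (cases "k = 0"; cases "k = Suc n") auto
  have "dist Y (EMor E (?p (Suc n)) (?i 0) (susp_ext (tm A 0)) \<otimes>\<^bsub>EOb E (tm Y (Suc n)) (tm Y 0)\<^esub>
     EMor E (?q (Suc n)) (?j 0) (angle_ext B))"
  proof (rule distinguished_sum[OF T(1) B'(2), where p = ?p and i = ?i and q = ?q and j = ?j])
    show "df Y k \<in> Ar C \<and> Dom C (df Y k) = tm Y k \<and> Cod C (df Y k) = tm Y (Suc k)" if "k \<le> n" for k
      using that by (induction k rule: cases[consumes 1]) (auto simp: Y_def trivial_sum_def)
    have 1: "\<lbrakk>k \<le> Suc n\<rbrakk> \<Longrightarrow> ?i k \<in> Ar C \<and> Dom C (?i k) = tm T k \<and> Cod C (?i k) = tm Y k"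
      "\<lbrakk>k \<le> Suc n\<rbrakk> \<Longrightarrow> ?p k \<in> Ar C \<and> Dom C (?p k) = tm Y k \<and> Cod C (?p k) = tm T k"
      "\<lbrakk>k \<le> Suc n\<rbrakk> \<Longrightarrow> ?j k \<in> Ar C \<and> Dom C (?j k) = tm B k \<and> Cod C (?j k) = tm Y k"
      "\<lbrakk>k \<le> Suc n\<rbrakk> \<Longrightarrow> ?q k \<in> Ar C \<and> Dom C (?q k) = tm Y k \<and> Cod C (?q k) = tm B k" for k
      by (induction k rule: Suc_cases[consumes 1]; auto simp: Y_def trivial_sum_def)+
    show "chain_map n C T Y ?i"
    proof (rule chain_mapI)
      show "?i (Suc k) \<bullet> df T k = df Y k \<bullet> ?i k" if "k \<le> n" for k
        using that by (induction k rule: cases[consumes 1]) (auto simp: Y_def trivial_sum_def col_row_zero)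
    qed (rule 1)
    show "chain_map n C B Y ?j"
    proof (rule chain_mapI)
      show "?j (Suc k) \<bullet> df B k = df Y k \<bullet> ?j k" if "k \<le> n" for k
        using that by (induction k rule: cases[consumes 1]) (auto simp: Y_def trivial_sum_def col_row_zero)
    qed (rule 1)
    show "chain_map n C Y T ?p"
    proof (rule chain_mapI)
      show "?p (Suc k) \<bullet> df Y k = df T k \<bullet> ?p k" if "k \<le> n" for k
        using that by (induction k rule: cases[consumes 1]) (auto simp: Y_def trivial_sum_def col_row_zero)
    qed (rule 1)
    show "chain_map n C Y B ?q"
    proof (rule chain_mapI)
      show "?q (Suc k) \<bullet> df Y k = df B k \<bullet> ?q k" if "k \<le> n" for k
        using that by (induction k rule: cases[consumes 1]) (auto simp: Y_def trivial_sum_def col_row_zero)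
    qed (rule 1)
    show "(?i k \<bullet> ?p k) \<boxplus> (?j k \<bullet> ?q k) = Id C (tm Y k)" if "k \<le> Suc n" for k
      using that by (induction k rule: Suc_cases[consumes 1]) (auto simp: Y_def trivial_sum_def)
  qed simp_all
  then show ?thesis by (simp add: Y_def trivial_sum_def)
qed

text \<open>\<open>good_lift\<close> between the two enlarged complexes contains a morphism of
  angles. The entries of its last component are found by comparing extensions, and its cone is the
  cone of the morphism up to one sign in the last term.\<close>

lemma angles_cone:
  assumes A: "A \<in> angles" and B: "B \<in> angles"
    and \<phi>0: "\<phi>0 \<in> Ar C" "Dom C \<phi>0 = tm A 0" "Cod C \<phi>0 = tm B 0"
    and \<phi>1: "\<phi>1 \<in> Ar C" "Dom C \<phi>1 = tm A 1" "Cod C \<phi>1 = tm B 1"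
    and sq: "\<phi>1 \<bullet> df A 0 = df B 0 \<bullet> \<phi>0"
  shows "\<exists>\<phi>. \<phi> 0 = \<phi>0 \<and> \<phi> 1 = \<phi>1 \<and> seq_morphism n C Susp A B \<phi> \<and> seq_cone n C Susp A B \<phi> \<in> angles"
proof -
  have A': "sigma_seq n C Susp A" and B': "sigma_seq n C Susp B" using A B by (auto simp: angles_def)
  note [simp] = sigma_seqD[OF A'] sigma_seqD[OF B'] \<phi>0 \<phi>1
    angle_ext_closed[OF A'] angle_ext_closed[OF B']
  have two: "2 = Suc (Suc 0)" by simp
  let ?\<delta> = "susp_ext (tm A 0)" and ?S = "susp_ob (tm A 0)" and ?B = "tm B (Suc n)"
  let ?\<rho> = "EMor E (proj1 C ?S ?B) (inj1 C (tm A 0) (tm B 0)) ?\<delta>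
     \<otimes>\<^bsub>EOb E (dsum C ?S ?B) (dsum C (tm A 0) (tm B 0))\<^esub>
     EMor E (proj2 C ?S ?B) (inj2 C (tm A 0) (tm B 0)) (angle_ext B)"
  let ?\<alpha> = "EMor E (Id C (tm A (Suc n))) (col C (Id C (tm A 0)) \<phi>0) (angle_ext A)"
  define X Y where "X = twisted_sum A B \<phi>0" and "Y = trivial_sum A B"
  have X: "dist X ?\<alpha>" unfolding X_def by (rule twisted_sum_distinguished[OF A B' \<phi>0])
  have Y: "dist Y ?\<rho>" unfolding Y_def by (rule trivial_sum_distinguished) (use B in simp_all)
  have tX: "tm X 0 = dsum C (tm A 0) (tm B 0)" "tm X 1 = dsum C (tm A 1) (tm B 0)"
    "k > 1 \<Longrightarrow> tm X k = tm A k"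
    "df X 0 = mat C (df A 0) (mzero C (tm B 0) (tm A 1)) (\<boxminus> \<phi>0) (Id C (tm B 0))"
    "df X 1 = row C (df A 1) (mzero C (tm B 0) (tm A 2))" "k > 1 \<Longrightarrow> df X k = df A k" for k
    by (simp_all add: X_def twisted_sum_def)
  have tY: "tm Y 0 = dsum C (tm A 0) (tm B 0)" "0 < k \<Longrightarrow> k \<le> n \<Longrightarrow> tm Y k = tm B k"
    "tm Y (Suc n) = dsum C ?S ?B" "df Y 0 = row C (mzero C (tm A 0) (tm B 1)) (df B 0)"
    "0 < k \<Longrightarrow> k < n \<Longrightarrow> df Y k = df B k" "df Y n = col C (mzero C (tm B n) ?S) (df B n)" for k
    by (simp_all add: Y_def trivial_sum_def)
  \<comment> \<open>The condition on the second arrow is the given square in the entry on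
    \<open>tm A 0\<close>, where the twist supplies the minus sign, and trivial in the entry on
    \<open>tm B 0\<close>.\<close>
  obtain f where f: "chain_map n C X Y f" "f 0 = Id C (tm X 0)" "f 1 = row C \<phi>1 (df B 0)"
    "EMor E (f (Suc n)) (Id C (tm Y 0)) ?\<rho> = ?\<alpha>"
    "dist (cone n C X Y f) (EMor E (Id C (tm Y (Suc n))) (df X 0) ?\<rho>)"
    by (rule good_lift[OF X Y, of "row C \<phi>1 (df B 0)"])
      (use sq in \<open>simp_all add: tX[simplified] tY[simplified] mat_def\<close>)
  have fn: "f (Suc n) \<in> Ar C" "Dom C (f (Suc n)) = tm A (Suc n)" "Cod C (f (Suc n)) = dsum C ?S ?B"
    using chain_mapD(1-3)[OF f(1), of "Suc n"] tX(3)[of "Suc n"] tY(3) by auto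
  define t w where "t = proj1 C ?S ?B \<bullet> f (Suc n)" and "w = proj2 C ?S ?B \<bullet> f (Suc n)"
  have tw [simp]: "t \<in> Ar C" "Dom C t = tm A (Suc n)" "Cod C t = ?S"
    "w \<in> Ar C" "Dom C w = tm A (Suc n)" "Cod C w = ?B"
    using fn by (simp_all add: t_def w_def)
  have fn_col: "f (Suc n) = col C t w"
    unfolding t_def w_def by (rule col_eta) (use fn in simp_all)
  \<comment> \<open>Pushed along the first projection, the equation of extensions says that t
    classifies the extension of A.\<close>
  have t: "t = df A (Suc n)"
  proof (rule susp_unique[of _ _ "tm A 0"])
    have "EMor E t (Id C (tm A 0)) ?\<delta>
        = EMor E (Id C (tm A (Suc n))) (proj1 C (tm A 0) (tm B 0)) (EMor E (f (Suc n)) (Id C (tm Y 0)) ?\<rho>)"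
      unfolding fn_col by (simp add: tY)
    also have "\<dots> = angle_ext A" unfolding f(4) by simp
    finally show "EMor E t (Id C (tm A 0)) ?\<delta> = EMor E (df A (Suc n)) (Id C (tm A 0)) ?\<delta>"
      by (simp add: angle_ext_def)
  qed simp_all
  \<comment> \<open>Along the second projection the graph contributes \<phi>0, and the resulting
    equation of extensions is the last square of a morphism of angles.\<close>
  have w: "susp \<phi>0 \<bullet> df A (Suc n) = df B (Suc n) \<bullet> w"
  proof (rule susp_unique[of _ _ "tm B 0"])
    have "EMor E w (Id C (tm B 0)) (angle_ext B)
        = EMor E (Id C (tm A (Suc n))) (proj2 C (tm A 0) (tm B 0)) (EMor E (f (Suc n)) (Id C (tm Y 0)) ?\<rho>)"
      unfolding fn_col by (simp add: tY)
    also have "\<dots> = EMor E (Id C (tm A (Suc n))) \<phi>0 (angle_ext A)" unfolding f(4) by simp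
    finally show "EMor E (susp \<phi>0 \<bullet> df A (Suc n)) (Id C (tm B 0)) (susp_ext (tm B 0))
        = EMor E (df B (Suc n) \<bullet> w) (Id C (tm B 0)) (susp_ext (tm B 0))"
      using EMor_susp[of \<phi>0 "df A (Suc n)" "Id C (tm B 0)"] by (simp add: angle_ext_def)
  qed simp_all
  have fm: "f k \<in> Ar C" "Dom C (f k) = tm A k" "Cod C (f k) = tm B k" if "1 < k" "k \<le> n" for k
    using chain_mapD(1-3)[OF f(1), of k] that tX(3) tY(2) by auto
  \<comment> \<open>Strictly between degrees 1 and n + 1 the enlarged complexes have the terms of A
    and B, so f is used unchanged; at the ends only the entry between A and B is kept.\<close>
  define \<phi> where "\<phi> = (\<lambda>k. if k = 0 then \<phi>0 else if k = 1 then \<phi>1 else if k = Suc n then w else f k)"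
  have \<phi>_mor: "\<phi> k \<in> Ar C" "Dom C (\<phi> k) = tm A k" "Cod C (\<phi> k) = tm B k" if "k \<le> Suc n" for k
    using that fm[of k] by (auto simp: \<phi>_def)
  have mor: "seq_morphism n C Susp A B \<phi>"
    unfolding seq_morphism_def
  proof (intro conjI allI impI)
    show "\<phi> k \<in> homset C (tm A k) (tm B k)" if "k \<le> n + 1" for k
      using \<phi>_mor[of k] that by (simp add: homset_def)
    show "FMor Susp (\<phi> 0) \<bullet> df A (n + 1) = df B (n + 1) \<bullet> \<phi> (n + 1)"
      using w by (simp add: \<phi>_def)
    fix k assume k: "k \<le> n"
    have ch: "f (Suc k) \<bullet> df X k = df Y k \<bullet> f k" by (rule chain_mapD(4)[OF f(1) k])
    consider "k = 0" | "k = 1" "n = 1" | "k = 1" "n > 1" | "1 < k" "k < n" | "1 < k" "k = n"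
      using k n_ge_1 by linarith
    then show "\<phi> (k + 1) \<bullet> df A k = df B k \<bullet> \<phi> k"
    proof cases
      case 1
      then show ?thesis using sq by (simp add: \<phi>_def)
    next
      \<comment> \<open>For n = 1 this square starts in a sum and ends in one, so it is restricted
        along an injection and followed by a projection at the same time.\<close>
      case 2
      have n1: "tm A (Suc n) = tm A (Suc (Suc 0))" "tm B (Suc n) = tm B (Suc (Suc 0))"
        "f (Suc n) \<bullet> df X (Suc 0) = df Y (Suc 0) \<bullet> f (Suc 0)"
        using 2 ch by simp_all
      have dXY: "df X (Suc 0) = row C (df A (Suc 0)) (mzero C (tm B 0) (tm A (Suc (Suc 0))))"
        "df Y (Suc 0) = col C (mzero C (tm B (Suc 0)) ?S) (df B (Suc 0))"
        using 2 tX(5) tY(6) by (simp_all add: two)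
      have "proj2 C ?S ?B \<bullet> ((f (Suc n) \<bullet> df X (Suc 0)) \<bullet> inj1 C (tm A 1) (tm B 0))
         = proj2 C ?S ?B \<bullet> ((df Y (Suc 0) \<bullet> f (Suc 0)) \<bullet> inj1 C (tm A 1) (tm B 0))"
        unfolding n1(3) ..
      then have "w \<bullet> df A (Suc 0) = df B (Suc 0) \<bullet> \<phi>1"
        using fn_col f(3) dXY by (simp add: n1(1,2))
      then show ?thesis using 2 by (simp add: \<phi>_def)
    next
      case 3
      have "(f (Suc k) \<bullet> df X k) \<bullet> inj1 C (tm A 1) (tm B 0) = (df Y k \<bullet> f k) \<bullet> inj1 C (tm A 1) (tm B 0)"
        unfolding ch ..
      then show ?thesis
        using 3 f(3) tX(5) tY(5)[of 1] fm[of 2] by (simp add: \<phi>_def two)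
    next
      case 4
      then show ?thesis using ch tX(6)[of k] tY(5)[of k] by (simp add: \<phi>_def)
    next
      case 5
      have "proj2 C ?S ?B \<bullet> (f (Suc k) \<bullet> df X k) = proj2 C ?S ?B \<bullet> (df Y k \<bullet> f k)"
        unfolding ch ..
      then show ?thesis
        using 5 fn_col tX(6)[of k] tY(6) fm[of k] by (simp add: \<phi>_def)
    qed
  qed
  let ?K = "cone n C X Y f" and ?M = "seq_cone n C Susp A B \<phi>"
  \<comment> \<open>The cone of f has t, the last arrow of A, where the cone of the morphism has its
    negative; \<open>?r\<close> changes the sign of that row.\<close>
  let ?r = "mat C (\<boxminus> Id C ?S) (mzero C ?B ?S) (mzero C ?S ?B) (Id C ?B)"
  let ?p = "\<lambda>k. if k = Suc n then ?r else Id C (tm ?M k)"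
  have M_tm: "tm ?M k = (if k \<le> n then dsum C (tm A (Suc k)) (tm B k) else dsum C ?S ?B)" for k
    by (simp add: seq_cone_def)
  have M0: "df ?M 0 = col C (row C (\<boxminus> (df A 1)) (mzero C (tm B 0) (tm A 2))) (row C \<phi>1 (df B 0))"
    by (simp add: seq_cone_def mat_def \<phi>_def two)
  have Mk: "df ?M k = mat C (\<boxminus> df A (Suc k)) (mzero C (tm B k) (tm A (Suc (Suc k)))) (f (Suc k)) (df B k)"
    if "0 < k" "k < n" for k
    using that by (simp add: seq_cone_def \<phi>_def)
  have Mn: "df ?M n = mat C (\<boxminus> df A (Suc n)) (mzero C (tm B n) ?S) w (df B n)"
    by (simp add: seq_cone_def \<phi>_def)
  have MSn: "df ?M (Suc n) = sigma_sum C Susp (tm A 1) (tm B 0) \<bullet>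
     col C (\<boxminus> susp (df A 0) \<bullet> proj1 C ?S ?B) (row C (susp \<phi>0) (df B (Suc n)))"
    by (simp add: seq_cone_def \<phi>_def mat_def col_row_zero)
  have K_tm: "tm ?K k = tm ?M k" if "k \<le> Suc n" for k
    using that tX(2) tX(3)[of "Suc k"] tY(2)[of k] tY(3) by (auto simp: M_tm cone_def)
  have M: "df ?M k \<in> Ar C \<and> Dom C (df ?M k) = tm ?M k \<and> Cod C (df ?M k) = tm ?M (Suc k)" if "k \<le> n" for k
  proof -
    consider "k = 0" | "0 < k" "k < n" | "k = n" "0 < k" using \<open>k \<le> n\<close> by linarith
    then show ?thesis
    proof cases
      case 2
      then show ?thesis using fm[of "Suc k"] by (simp add: Mk M_tm mat_def)
    qed (simp_all add: M0 Mn M_tm mat_def two)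
  qed
  have sM: "sigma_seq n C Susp ?M"
    by (rule sigma_seqI[OF M]) (simp_all add: MSn sigma_sum_eq M_tm)
  note M' [simp] = sigma_seqD(1)[OF sM]
  have r: "?r \<in> Ar C" "Dom C ?r = dsum C ?S ?B" "Cod C ?r = dsum C ?S ?B"
    "?r \<bullet> ?r = Id C (dsum C ?S ?B)"
  proof -
    show "?r \<bullet> ?r = Id C (dsum C ?S ?B)"
      by (rule col_ext[of _ _ ?S ?B]; (rule row_ext[of _ _ ?S ?B])?) (simp_all add: mat_def)
  qed (simp_all add: mat_def)
  have "dist ?M (EMor E (?p (Suc n)) (?p 0) (EMor E (Id C (tm Y (Suc n))) (df X 0) ?\<rho>))"
  proof (rule distinguished_iso[OF f(5) M, where p = ?p and i = ?p])
    show "?p k \<in> Ar C \<and> Dom C (?p k) = tm ?M k \<and> Cod C (?p k) = tm ?K k \<and>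
      ?p k \<bullet> ?p k = Id C (tm ?M k) \<and> ?p k \<bullet> ?p k = Id C (tm ?K k)" if "k \<le> Suc n" for k
      using that r K_tm[OF that] by (auto simp: M_tm)
    show "chain_map n C ?K ?M ?p"
    proof (rule chain_mapI)
      show "?p k \<in> Ar C \<and> Dom C (?p k) = tm ?K k \<and> Cod C (?p k) = tm ?M k" if "k \<le> Suc n" for k
        using that r K_tm[OF that] by (auto simp: M_tm)
      fix k assume k: "k \<le> n"
      consider "k = 0" | "0 < k" "k < n" | "k = n" "0 < k" using k by linarith
      then show "?p (Suc k) \<bullet> df ?K k = df ?M k \<bullet> ?p k"
      proof cases
        case 1
        have "df ?K 0 = df ?M 0"
          unfolding M0 using tX(5) f(3) by (simp add: cone_def two)
        then show ?thesis using 1 M[of 0] by simp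
      next
        case 2
        have "df ?K k = df ?M k"
          unfolding Mk[OF 2] using 2 tX(3)[of "Suc (Suc k)"] tX(6)[of "Suc k"] tY(2)[of k] tY(5)[of k]
          by (simp add: cone_def)
        then show ?thesis using 2 M[of k] by simp
      next
        case 3
        have "df ?K n = row C (col C t w) (col C (mzero C (tm B n) ?S) (df B n))"
          using tY(6) fn_col by (simp add: cone_def)
        then have "?r \<bullet> df ?K n = df ?M n"
          unfolding Mn t by (simp add: mat_def row_col_interchange)
        then show ?thesis using 3 M[of n] by simp
      qed
    qed
  qed
  also have "EMor E (?p (Suc n)) (?p 0) (EMor E (Id C (tm Y (Suc n))) (df X 0) ?\<rho>) = angle_ext ?M"
  proof -
    let ?A1B0 = "dsum C (tm A 1) (tm B 0)"
    let ?i1 = "inj1 C (tm A 1) (tm B 0)" and ?i2 = "inj2 C (tm A 1) (tm B 0)"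
    let ?p1 = "proj1 C ?S ?B" and ?p2 = "proj2 C ?S ?B"
    let ?op = "mult (EOb E (dsum C ?S ?B) ?A1B0)"
    interpret G: comm_group "EOb E (dsum C ?S ?B) ?A1B0" by (rule ext_comm_group) simp_all
    have d1: "df X 0 \<bullet> inj1 C (tm A 0) (tm B 0) = (?i1 \<bullet> df A 0) \<boxplus> \<boxminus> (?i2 \<bullet> \<phi>0)"
      unfolding tX(4) by (simp add: mat_def col_def)
    have d2: "df X 0 \<bullet> inj2 C (tm A 0) (tm B 0) = ?i2"
      unfolding tX(4) by (simp add: mat_def col_row_zero)
    have dX: "df X 0 \<in> Ar C" "Dom C (df X 0) = dsum C (tm A 0) (tm B 0)" "Cod C (df X 0) = ?A1B0"
      unfolding tX(4) by (simp_all add: mat_def)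
    have r1: "?p1 \<bullet> ?r = \<boxminus> ?p1" "?p2 \<bullet> ?r = ?p2"
      by (simp_all add: mat_def col_row_zero)
    have "EMor E (?p (Suc n)) (?p 0) (EMor E (Id C (tm Y (Suc n))) (df X 0) ?\<rho>)
        = EMor E ?r (df X 0) ?\<rho>"
      using r dX by (simp add: M_tm tY)
    also have "\<dots> = ?op (EMor E (\<boxminus> ?p1) ((?i1 \<bullet> df A 0) \<boxplus> \<boxminus> (?i2 \<bullet> \<phi>0)) ?\<delta>) (EMor E ?p2 ?i2 (angle_ext B))"
      using r dX by (simp add: r1 d1 d2)
    \<comment> \<open>In the mixed term the minus sign of the twist cancels the one from
      \<open>?r\<close>, in agreement with the unsigned entry \<open>susp \<phi>0\<close> of the
      cone.\<close>
    also have "EMor E (\<boxminus> ?p1) ((?i1 \<bullet> df A 0) \<boxplus> \<boxminus> (?i2 \<bullet> \<phi>0)) ?\<delta>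
        = ?op (EMor E (\<boxminus> ?p1) (?i1 \<bullet> df A 0) ?\<delta>) (EMor E ?p1 (?i2 \<bullet> \<phi>0) ?\<delta>)"
      by (simp add: EMor_madd_right EMor_mneg_swap)
    finally have 1: "EMor E (?p (Suc n)) (?p 0) (EMor E (Id C (tm Y (Suc n))) (df X 0) ?\<rho>)
      = ?op (?op (EMor E (\<boxminus> ?p1) (?i1 \<bullet> df A 0) ?\<delta>) (EMor E ?p1 (?i2 \<bullet> \<phi>0) ?\<delta>)) (EMor E ?p2 ?i2 (angle_ext B))" .
    have row: "row C (susp \<phi>0) (df B (Suc n)) = (susp \<phi>0 \<bullet> ?p1) \<boxplus> (df B (Suc n) \<bullet> ?p2)"
      by (simp add: row_def)
    have "angle_ext ?M = ?op (EMor E (\<boxminus> susp (df A 0) \<bullet> ?p1) ?i1 (susp_ext (tm A 1)))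
        (EMor E (row C (susp \<phi>0) (df B (Suc n))) ?i2 (susp_ext (tm B 0)))"
      unfolding angle_ext_def MSn by (subst M_tm, subst M_tm, simp, subst EMor_sigma_sum) simp_all
    also have "EMor E (row C (susp \<phi>0) (df B (Suc n))) ?i2 (susp_ext (tm B 0))
        = ?op (EMor E (susp \<phi>0 \<bullet> ?p1) ?i2 (susp_ext (tm B 0))) (EMor E (df B (Suc n) \<bullet> ?p2) ?i2 (susp_ext (tm B 0)))"
      unfolding row by (subst EMor_madd_left) simp_all
    also have "EMor E (susp \<phi>0 \<bullet> ?p1) ?i2 (susp_ext (tm B 0)) = EMor E ?p1 (?i2 \<bullet> \<phi>0) ?\<delta>"
      using EMor_susp[of \<phi>0 ?p1 ?i2] by simp
    also have "EMor E (df B (Suc n) \<bullet> ?p2) ?i2 (susp_ext (tm B 0)) = EMor E ?p2 ?i2 (angle_ext B)"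
      by (simp add: angle_ext_def)
    also have "EMor E (\<boxminus> susp (df A 0) \<bullet> ?p1) ?i1 (susp_ext (tm A 1)) = EMor E (\<boxminus> ?p1) (?i1 \<bullet> df A 0) ?\<delta>"
      using EMor_susp[of "df A 0" "\<boxminus> ?p1" ?i1] by simp
    finally show ?thesis unfolding 1 by (subst G.m_assoc) simp_all
  qed
  finally have "?M \<in> angles" using sM by (simp add: angles_def)
  then show ?thesis using mor by (intro exI[of _ \<phi>]) (simp add: \<phi>_def)
qed

lemma angulated: "angulated_category C n Susp angles"
proof unfold_locales
  show "auto_equivalence C Susp" by (rule Susp_auto_equivalence)
  show "sigma_seq n C Susp A" if "A \<in> angles" for A using that by (simp add: angles_def)
  show "B \<in> angles" if "A \<in> angles" "sigma_seq n C Susp B" "seq_isomorphic n C Susp A B" for A B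
    using angles_iso that by blast
  show "seq_dsum n C Susp A B \<in> angles" if "A \<in> angles" "B \<in> angles" for A B
    using angles_sum that by blast
  show "A \<in> angles \<and> B \<in> angles" if "sigma_seq n C Susp A" "sigma_seq n C Susp B"
    "seq_dsum n C Susp A B \<in> angles" for A B
    using angles_summand that by blast
  show "seq_id n C Susp X \<in> angles" if "X \<in> Ob C" for X using angles_id that by blast
  show "\<exists>A\<in>angles. df A 0 = f" if "f \<in> Ar C" for f using angles_ex that by blast
  show "(A \<in> angles) = (left_rotation n C Susp A \<in> angles)" if "sigma_seq n C Susp A" for A
    using left_rotation_angle left_rotation_angle_converse that by blast
next
  fix A B \<phi>0 \<phi>1
  assume *: "A \<in> angles" "B \<in> angles" "\<phi>0 \<in> homset C (tm A 0) (tm B 0)" "\<phi>1 \<in> homset C (tm A 1) (tm B 1)"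
    "\<phi>1 \<bullet> df A 0 = df B 0 \<bullet> \<phi>0"
  \<comment> \<open>The lift with a good cone also serves for the axiom that asks only for a
    lift.\<close>
  show cone: "\<exists>\<phi>. \<phi> 0 = \<phi>0 \<and> \<phi> 1 = \<phi>1 \<and> seq_morphism n C Susp A B \<phi> \<and> seq_cone n C Susp A B \<phi> \<in> angles"
    by (rule angles_cone[OF *(1,2)]) (use * in \<open>auto simp: homset_def\<close>)
  then show "\<exists>\<phi>. \<phi> 0 = \<phi>0 \<and> \<phi> 1 = \<phi>1 \<and> seq_morphism n C Susp A B \<phi>" by blast
qed

lemma compatible: "E_compatible n C E s angles"
  unfolding E_compatible_def using distinguishedD(2) by (auto simp: angles_def)

end

section \<open>Trivial inflations and deflations from a compatible angulation\<close>

context positive_exangulated_category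
begin

lemma trivially_exangulatedI:
  assumes "\<And>X. X \<in> Ob C \<Longrightarrow> trivial_inflation n C E s (mzero C X (zero_ob C)) \<and>
    trivial_deflation n C E s (mzero C (zero_ob C) X)"
  shows "trivially_exangulated_category C E n s"
proof unfold_locales
  fix A assume A: "A \<in> Ob C"
  obtain X \<delta> where X: "dist X \<delta>" "\<forall>i \<in> {1..n}. zero_object C (tm X i)" "df X 0 = mzero C A (zero_ob C)"
    using assms[OF A] by (auto simp: trivial_inflation_def)
  have "tm X 0 = A" using cplxD(3)[OF distinguishedD(1)[OF X(1)], of 0] X(3) A by simp
  then show "\<exists>D \<delta>. trivial_exangle D A \<delta>" using X unfolding trivial_exangle_def by blast
next
  fix D assume D: "D \<in> Ob C"
  obtain X \<delta> where X: "dist X \<delta>" "\<forall>i \<in> {1..n}. zero_object C (tm X i)" "df X n = mzero C (zero_ob C) D"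
    using assms[OF D] by (auto simp: trivial_deflation_def)
  have "tm X (Suc n) = D" using cplxD(4)[OF distinguishedD(1)[OF X(1)], of n] X(3) D by simp
  then show "\<exists>A \<delta>. trivial_exangle D A \<delta>" using X unfolding trivial_exangle_def by blast
qed

text \<open>This angle runs from X through zero objects to the suspension of X, so compatibility
  makes it a trivial exangle.\<close>

lemma rotated_trivial_angle:
  assumes "angulated_category C n \<Sigma> \<Theta>" and X: "X \<in> Ob C"
  shows "left_rotation n C \<Sigma> (seq_id n C \<Sigma> X) \<in> \<Theta>"
proof -
  interpret ang: angulated_category C n \<Sigma> \<Theta> by fact
  show ?thesis using ang.N2 ang.angles_seq ang.N1b[OF X] by blast
qed

lemma angulated_trivial_inflation:
  assumes "angulated_category C n \<Sigma> \<Theta>" "E_compatible n C E s \<Theta>" and X: "X \<in> Ob C"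
  shows "trivial_inflation n C E s (mzero C X (zero_ob C))"
proof -
  let ?L = "left_rotation n C \<Sigma> (seq_id n C \<Sigma> X)"
  obtain \<delta> where "dist ?L \<delta>"
    using rotated_trivial_angle[OF assms(1) X] assms(2) by (auto simp: E_compatible_def)
  moreover have "\<forall>i \<in> {1..n}. zero_object C (tm ?L i)"
    using zero_object_zero_ob by (auto simp: left_rotation_def seq_id_def id_left_def)
  moreover have "df ?L 0 = mzero C X (zero_ob C)"
    by (simp add: left_rotation_def seq_id_def id_left_def)
  ultimately show ?thesis unfolding trivial_inflation_def by blast
qed

text \<open>A rotated identity angle ends in a suspension, so it is started at the image of X under
  a quasi-inverse and its end is moved to X along the natural isomorphism.\<close>

lemma angulated_trivial_deflation:
  assumes "angulated_category C n \<Sigma> \<Theta>" "E_compatible n C E s \<Theta>" and X: "X \<in> Ob C"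
  shows "trivial_deflation n C E s (mzero C (zero_ob C) X)"
proof -
  interpret ang: angulated_category C n \<Sigma> \<Theta> by fact
  obtain G where G: "is_functor C G" "nat_isomorphic C (comp_functor \<Sigma> G) id_functor"
    using ang.sigma_equiv by (auto simp: auto_equivalence_def)
  define Z where "Z = FOb G X"
  have Z [simp]: "Z \<in> Ob C" using G(1) X by (auto simp: is_functor_def Z_def)
  obtain \<eta> where "\<eta> \<in> homset C (FOb \<Sigma> Z) X" "is_iso C \<eta>"
    using G(2) X by (auto simp: nat_isomorphic_def comp_functor_def id_functor_def Z_def)
  then obtain \<theta> where \<eta> [simp]: "\<eta> \<in> Ar C" "Dom C \<eta> = FOb \<Sigma> Z" "Cod C \<eta> = X"
    "\<theta> \<in> Ar C" "Dom C \<theta> = X" "Cod C \<theta> = FOb \<Sigma> Z" "\<theta> \<bullet> \<eta> = Id C (FOb \<Sigma> Z)"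
    by (auto simp: is_iso_def homset_def)
  have \<Sigma> [simp]: "FOb \<Sigma> Z \<in> Ob C" "FMor \<Sigma> (Id C Z) = Id C (FOb \<Sigma> Z)"
    using ang.sigma_equiv by (auto simp: auto_equivalence_def is_functor_def)
  let ?L = "left_rotation n C \<Sigma> (seq_id n C \<Sigma> Z)"
  have L: "?L \<in> \<Theta>" by (rule rotated_trivial_angle[OF assms(1) Z])
  have sL: "sigma_seq n C \<Sigma> ?L" by (rule ang.angles_seq[OF L])
  have L_tm: "tm ?L i = (if i = 0 then Z else if i \<le> n then zero_ob C else FOb \<Sigma> Z)" for i
    by (simp add: left_rotation_def seq_id_def id_left_def)
  have L_df: "df ?L i = mzero C (tm ?L i) (tm ?L (Suc i))" if "i \<le> n" for i
    using that by (auto simp: left_rotation_def seq_id_def id_left_def)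
  have L_last: "df ?L (Suc n) \<in> Ar C" "Dom C (df ?L (Suc n)) = FOb \<Sigma> Z" "Cod C (df ?L (Suc n)) = FOb \<Sigma> Z"
    using sL by (auto simp: sigma_seq_def homset_def L_tm)
  \<comment> \<open>Only the last object is exchanged for X: the arrow into it stays zero, and the
    last arrow is precomposed with the inverse of \<eta>.\<close>
  define B where "B = \<lparr>tm = (tm ?L)(Suc n := X),
    df = (\<lambda>i. if i < n then df ?L i else if i = n then mzero C (zero_ob C) X else df ?L (Suc n) \<bullet> \<theta>)\<rparr>"
  have sB: "sigma_seq n C \<Sigma> B"
    unfolding sigma_seq_def using X L_last by (auto simp: B_def L_tm L_df homset_def)
  have "seq_isomorphic n C \<Sigma> ?L B"
    unfolding seq_isomorphic_def
  proof (intro exI[of _ "\<lambda>i. if i \<le> n then Id C (tm ?L i) else \<eta>"] conjI allI impI)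
    show "seq_morphism n C \<Sigma> ?L B (\<lambda>i. if i \<le> n then Id C (tm ?L i) else \<eta>)"
      unfolding seq_morphism_def
      using X L_last by (auto simp: B_def L_tm L_df homset_def)
    show "is_iso C (if i \<le> n then Id C (tm ?L i) else \<eta>)" if "i \<le> n + 1" for i
      using \<open>is_iso C \<eta>\<close> is_iso_Id by (auto simp: L_tm)
  qed
  then have "B \<in> \<Theta>" by (rule ang.N1a_iso[OF L sB])
  then obtain \<delta> where "dist B \<delta>" using assms(2) by (auto simp: E_compatible_def)
  moreover have "\<forall>i \<in> {1..n}. zero_object C (tm B i)"
    using zero_object_zero_ob by (auto simp: B_def L_tm)
  moreover have "df B n = mzero C (zero_ob C) X" by (simp add: B_def)
  ultimately show ?thesis unfolding trivial_deflation_def by blast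
qed

end

theorem theorem3p5:
  fixes n :: nat and C :: "('o, 'm) cat" and E :: "('o, 'm, 'e) bifun"
    and s :: "('o, 'm, 'e) realiz"
  assumes "n \<ge> 1" and "exangulated_category C E n s"
  shows "(\<exists>\<Sigma> \<Theta>. angulated_category C n \<Sigma> \<Theta> \<and> E_compatible n C E s \<Theta>) \<longleftrightarrow>
    (\<forall>X \<in> Ob C. trivial_inflation n C E s (mzero C X (zero_ob C)) \<and>
                trivial_deflation n C E s (mzero C (zero_ob C) X))"
proof -
  interpret positive_exangulated_category C E n s
    by (intro positive_exangulated_category.intro positive_exangulated_category_axioms.intro assms)
  show ?thesis
  proof
    assume "\<exists>\<Sigma> \<Theta>. angulated_category C n \<Sigma> \<Theta> \<and> E_compatible n C E s \<Theta>"
    then show "\<forall>X \<in> Ob C. trivial_inflation n C E s (mzero C X (zero_ob C)) \<and>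
                trivial_deflation n C E s (mzero C (zero_ob C) X)"
      using angulated_trivial_inflation angulated_trivial_deflation by blast
  next
    assume "\<forall>X \<in> Ob C. trivial_inflation n C E s (mzero C X (zero_ob C)) \<and>
                trivial_deflation n C E s (mzero C (zero_ob C) X)"
    then interpret T: trivially_exangulated_category C E n s
      by (intro trivially_exangulatedI) blast
    show "\<exists>\<Sigma> \<Theta>. angulated_category C n \<Sigma> \<Theta> \<and> E_compatible n C E s \<Theta>"
      using T.angulated T.compatible by blast
  qed
qed

end
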